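(* Suppose that $(\Sigma_0,\mu_0),\ldots,(\Sigma_m,\mu_m)$ are measure spaces, and $\mathscr{S}_j$ is the collection of all simple functions on $\Sigma_j$, $j=1,\ldots,m$. Denote by $\mathfrak{M}(\Sigma_0)$ the set of all measurable functions on $\Sigma_0$. Let $T:\mathscr{S}=\mathscr{S}_1\times\cdots\times\mathscr{S}_m\to\mathfrak{M}(\Sigma_0)$ be an $m$-linear operator. Let $0<p_0,q_0<\infty$, $1\le p_j,q_j\le\infty$ $(j=1,\ldots,m)$, and let $w_j,v_j$ be weights on $\Sigma_j$ $(j=0,\ldots,m)$. Assume that there exist $M_1,M_2\in(0,\infty)$ such that $$\|T\|_{L^{p_1}(\Sigma_1,w_1^{p_1})\times\cdots\times L^{p_m}(\Sigma_m,w_m^{p_m})\to L^{p_0}(\Sigma_0,w_0^{p_0})}\le M_1,$$ $$\|T\|_{L^{q_1}(\Sigma_1,v_1^{q_1})\times\cdots\times L^{q_m}(\Sigma_m,v_m^{q_m})\to L^{q_0}(\Sigma_0,v_0^{q_0})}\le M_2.$$ Then $$\|T\|_{L^{r_1}(\Sigma_1,u_1^{r_1})\times\cdots\times L^{r_m}(\Sigma_m,u_m^{r_m})\to L^{r_0}(\Sigma_0,u_0^{r_0})}\le M_1^{1-\theta}M_2^\theta$$ for all exponents and weights satisfying $0<\theta<1$, $\frac1{r_j}=\frac{1-\theta}{p_j}+\frac{\theta}{q_j}$ and $u_j=w_j^{1-\theta}v_j^\theta$, $j=0,\ldots,m$.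
   Context: A weight on a measure space $(\Sigma,\mu)$ is a measurable function $w$ with $0<w<\infty$ $\mu$-a.e. A simple function is a finite linear combination of indicator functions of measurable sets of finite measure. $\|f\|_{L^p(\Sigma,w^p)}=\|fw\|_{L^p(\Sigma,\mu)}$ (also used as the definition when $p=\infty$). Meaning of the norm bounds for the operator $T$, which is given on simple functions: the hypotheses mean that $\|T(\vec f)w_0\|_{L^{p_0}(\Sigma_0,\mu_0)}\le M_1\prod_{j=1}^m\|f_jw_j\|_{L^{p_j}(\Sigma_j,\mu_j)}$ for all $\vec f=(f_1,\ldots,f_m)\in\mathscr{S}$ with all $\|f_jw_j\|_{L^{p_j}}<\infty$, and $\|T(\vec f)v_0\|_{L^{q_0}(\Sigma_0,\mu_0)}\le M_2\prod_{j=1}^m\|f_jv_j\|_{L^{q_j}(\Sigma_j,\mu_j)}$ for all $\vec f\in\mathscr{S}$ with all $\|f_jv_j\|_{L^{q_j}}<\infty$. The conclusion means that $\|T(\vec f)u_0\|_{L^{r_0}(\Sigma_0,\mu_0)}\le M_1^{1-\theta}M_2^\theta\prod_{j=1}^m\|f_ju_j\|_{L^{r_j}(\Sigma_j,\mu_j)}$ for all $\vec f\in\mathscr{S}$ with $\|f_jw_j\|_{L^{p_j}}<\infty$ and $\|f_jv_j\|_{L^{q_j}}<\infty$, $j=1,\ldots,m$ (the norm on $L^{r_1}(\Sigma_1,u_1^{r_1})\times\cdots\times L^{r_m}(\Sigma_m,u_m^{r_m})$ being that of the extension of $T$ by density from such tuples, when they are dense). *)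

theory Defs
  imports "HOL-Analysis.Analysis" "HOL-Probability.Essential_Supremum"
begin

text \<open>
  Measure spaces are indexed by \<open>j = 0, \<dots>, m\<close> as \<open>\<mu> j :: 'a measure\<close>. They share the type \<open>'a\<close>
  but have unrelated carriers \<open>space (\<mu> j)\<close>, so a family of spaces over different types is
  covered by taking \<open>'a\<close> to be their sum type. Functions are complex-valued. Weights and the moduli
  whose \<open>L\<^sup>p\<close> norms are taken have values in \<open>[0,\<infinity>]\<close>, i.e. in \<^typ>\<open>ennreal\<close>;
  exponents are in \<^typ>\<open>ennreal\<close> as well, with \<open>1 / \<infinity> = 0\<close>.
\<close>

text \<open>The power \<open>x\<^sup>a\<close> on \<open>[0,\<infinity>]\<close>; meaningful only for real exponents \<open>a > 0\<close>.\<close>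

definition ennpow :: "ennreal \<Rightarrow> real \<Rightarrow> ennreal" where
  "ennpow x a = (if x = \<infinity> then \<infinity> else ennreal (enn2real x powr a))"

definition weight :: "'a measure \<Rightarrow> ('a \<Rightarrow> ennreal) \<Rightarrow> bool" where
  "weight M w \<longleftrightarrow> w \<in> borel_measurable M \<and> (AE x in M. 0 < w x \<and> w x < \<infinity>)"

text \<open>The (quasi-)norm of \<open>L\<^sup>p(M)\<close>, for \<open>0 < p \<le> \<infinity>\<close> and a \<open>[0,\<infinity>]\<close>-valued function.\<close>

definition Lp_norm :: "ennreal \<Rightarrow> 'a measure \<Rightarrow> ('a \<Rightarrow> ennreal) \<Rightarrow> ennreal" where
  "Lp_norm p M g =
     (if p = \<infinity> then esssup M g
      else ennpow (\<integral>\<^sup>+ x. ennpow (g x) (enn2real p) \<partial>M) (1 / enn2real p))"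

definition wLp_norm ::
    "ennreal \<Rightarrow> 'a measure \<Rightarrow> ('a \<Rightarrow> ennreal) \<Rightarrow> ('a \<Rightarrow> complex) \<Rightarrow> ennreal" where
  "wLp_norm p M w f = Lp_norm p M (\<lambda>x. ennreal (cmod (f x)) * w x)"

text \<open>
  Unlike \<^const>\<open>simple_function\<close>, this forces the functions to vanish outside
  \<open>space M\<close>, so that each of them is determined by its restriction to \<open>space M\<close>.
\<close>

definition simple_functions :: "'a measure \<Rightarrow> ('a \<Rightarrow> complex) set" where
  "simple_functions M =
     {f. \<exists>(n::nat) c A. (\<forall>i<n. A i \<in> fmeasurable M) \<and> f = (\<lambda>x. \<Sum>i<n. c i * indicator (A i) x)}"

definition simple_tuples :: "nat \<Rightarrow> (nat \<Rightarrow> 'a measure) \<Rightarrow> (nat \<Rightarrow> 'a \<Rightarrow> complex) set" where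
  "simple_tuples m \<mu> = (\<Pi>\<^sub>E j\<in>{1..m}. simple_functions (\<mu> j))"

text \<open>
  Linearity is required almost everywhere; this covers both the case where the values of \<open>T\<close> are
  functions and the case where they are classes of functions modulo null sets
  (\<open>T f\<close> then being a representative).
\<close>

definition multilinear_operator ::
    "nat \<Rightarrow> (nat \<Rightarrow> 'a measure) \<Rightarrow> ((nat \<Rightarrow> 'a \<Rightarrow> complex) \<Rightarrow> 'a \<Rightarrow> complex) \<Rightarrow> bool" where
  "multilinear_operator m \<mu> T \<longleftrightarrow>
     (\<forall>f\<in>simple_tuples m \<mu>. T f \<in> borel_measurable (\<mu> 0)) \<and>
     (\<forall>f\<in>simple_tuples m \<mu>. \<forall>j\<in>{1..m}.
        \<forall>g\<in>simple_functions (\<mu> j). \<forall>h\<in>simple_functions (\<mu> j). \<forall>a b.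
          AE x in \<mu> 0. T (f(j := (\<lambda>y. a * g y + b * h y))) x
                        = a * T (f(j := g)) x + b * T (f(j := h)) x)"

definition finite_norm_tuples ::
    "nat \<Rightarrow> (nat \<Rightarrow> 'a measure) \<Rightarrow> (nat \<Rightarrow> ennreal) \<Rightarrow> (nat \<Rightarrow> 'a \<Rightarrow> ennreal) \<Rightarrow>
     (nat \<Rightarrow> 'a \<Rightarrow> complex) set" where
  "finite_norm_tuples m \<mu> p w =
     {f \<in> simple_tuples m \<mu>. \<forall>j\<in>{1..m}. wLp_norm (p j) (\<mu> j) (w j) (f j) < \<infinity>}"

text \<open>
  The bound \<open>\<parallel>T\<parallel> \<le> C\<close> from \<open>L\<^bsup>p 1\<^esup>(w 1) \<times> \<dots> \<times> L\<^bsup>p m\<^esup>(w m)\<close> to \<open>L\<^bsup>p 0\<^esup>(w 0)\<close>, tested on the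
  tuples in \<open>D\<close>.
\<close>

definition norm_bound_on ::
    "(nat \<Rightarrow> 'a \<Rightarrow> complex) set \<Rightarrow> nat \<Rightarrow> (nat \<Rightarrow> 'a measure) \<Rightarrow>
     ((nat \<Rightarrow> 'a \<Rightarrow> complex) \<Rightarrow> 'a \<Rightarrow> complex) \<Rightarrow>
     (nat \<Rightarrow> ennreal) \<Rightarrow> (nat \<Rightarrow> 'a \<Rightarrow> ennreal) \<Rightarrow> real \<Rightarrow> bool" where
  "norm_bound_on D m \<mu> T p w C \<longleftrightarrow>
     (\<forall>f\<in>D. wLp_norm (p 0) (\<mu> 0) (w 0) (T f)
              \<le> ennreal C * (\<Prod>j=1..m. wLp_norm (p j) (\<mu> j) (w j) (f j)))"

end

theory Submission
  imports Defs "HOL-Complex_Analysis.Complex_Analysis"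
begin

text \<open>
  The proof is complex interpolation. Since \<open>p 0\<close> and \<open>q 0\<close> may be below \<open>1\<close>, the target spaces are only
  quasi-normed and \<open>T f\<close> cannot be tested against a dual space. Logarithmic subharmonicity of moduli of
  holomorphic functions takes the place of duality.
  
  Let \<open>\<parallel>f j\<parallel>\<close> be the norm of \<open>f j\<close> in \<open>L\<^bsup>r j\<^esup>(u j)\<close>. The entry \<open>f j\<close> is embedded in the family
  \<open>f j * exp (L j * (z - \<theta>))\<close>, where \<open>L j\<close> is a real function that takes finitely many values. The usual
  extremal choice, rounded down to a multiple of \<open>\<epsilon>\<close>, makes the norms in \<open>L\<^bsup>p j\<^esup>(w j)\<close> on \<open>Re z = 0\<close> and
  in \<open>L\<^bsup>q j\<^esup>(v j)\<close> on \<open>Re z = 1\<close> at most \<open>exp \<epsilon> * \<parallel>f j\<parallel>\<close> (\<open>extremal_frequency\<close>). For each \<open>z\<close> the new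
  entries are still simple functions, so multilinearity turns \<open>T\<close> of the family into a finite sum
  \<open>F z = (\<Sum>l. exp (l * z) * g l)\<close> with real frequencies \<open>l\<close> and with coefficients \<open>g l\<close> in both target
  spaces (\<open>T_twist_expansion\<close>). What is left is a three lines theorem for such sums
  (\<open>expsum_three_lines\<close>).
  
  Let \<open>n z\<close> be the norm of \<open>F z\<close> in the space between \<open>L\<^bsup>p 0\<^esup>(w 0)\<close> and \<open>L\<^bsup>q 0\<^esup>(v 0)\<close> with parameter \<open>Re z\<close>.
  For a disc of radius \<open>d\<close> about \<open>z\<close> in the strip, the maximum principle for the product of \<open>F\<close> over
  \<open>N\<close> equally spaced rotations bounds \<open>\<bar>F z\<bar> ^ N\<close> pointwise by the product of \<open>\<bar>F\<bar> + O(1 / N) * (\<Sum>l. \<bar>g l\<bar>)\<close>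
  over \<open>N\<close> fixed points of the circle (\<open>expsum_submean\<close>). Hoelder's inequality with \<open>N\<close> factors carries
  this over to \<open>n\<close>: the reciprocal exponents and the logarithms of the weights are affine in \<open>Re z\<close>, and
  the points have the barycentre \<open>z\<close>, so the means of both are the right ones
  (\<open>mid_int_geometric_mean\<close>). The error vanishes as \<open>N \<longlonglongrightarrow> \<infinity>\<close> (\<open>mid_int_perturb\<close>). Hence \<open>ln n\<close> has a sub-mean
  value property; two-point Hoelder shows that it exceeds the affine function of the claim by at most
  \<open>O(Re z * (1 - Re z))\<close>, which vanishes on the boundary, and a maximum principle on \<open>[0, 1]\<close> removes
  the excess. Only finite products occur, so no harmonic measure of the strip and no
  exchange of integrals is involved.
  
  The functions \<open>L j\<close> are bounded if \<open>\<bar>f j\<bar> * w j\<close> and \<open>\<bar>f j\<bar> * v j\<close> are bounded above and below where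
  \<open>f j\<close> does not vanish. The general tuple is reached by truncating one entry at a time: the piece cut
  off is small in one of the two endpoint norms and bounded in the other, so Hoelder's inequality in the
  target makes its image small (\<open>log_truncation\<close>, \<open>T_tail_small\<close>).
\<close>

section \<open>Inequalities for products and sums of powers\<close>

lemma weighted_am_gm:
  fixes c y :: "'k \<Rightarrow> real"
  assumes fin: "finite K" and c: "\<And>k. k \<in> K \<Longrightarrow> 0 < c k" and c1: "(\<Sum>k\<in>K. c k) = 1"
    and y: "\<And>k. k \<in> K \<Longrightarrow> 0 \<le> y k"
  shows "(\<Prod>k\<in>K. y k powr c k) \<le> (\<Sum>k\<in>K. c k * y k)"
proof (cases "\<exists>k\<in>K. y k = 0")
  case True
  then have "(\<Prod>k\<in>K. y k powr c k) = 0"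
    using fin by (auto intro!: prod_zero)
  then show ?thesis
    using c y by (auto intro!: sum_nonneg mult_nonneg_nonneg simp: less_imp_le)
next
  case False
  then have yp: "0 < y k" if "k \<in> K" for k
    using y[OF that] that by force
  define m where "m = (\<Sum>k\<in>K. c k * y k)"
  have "K \<noteq> {}" using c1 by auto
  then have m: "0 < m"
    unfolding m_def using fin c yp by (intro sum_pos) auto
  have "c k * ln (y k) \<le> c k * (ln m + y k / m - 1)" if "k \<in> K" for k
  proof -
    have "ln (y k / m) \<le> y k / m - 1"
      using yp[OF that] m by (intro ln_le_minus_one) auto
    then show ?thesis
      using yp[OF that] m c[OF that] by (simp add: ln_div)
  qed
  then have "(\<Sum>k\<in>K. c k * ln (y k)) \<le> (\<Sum>k\<in>K. c k * (ln m + y k / m - 1))"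
    by (rule sum_mono)
  also have "\<dots> = ln m * (\<Sum>k\<in>K. c k) + (\<Sum>k\<in>K. c k * y k) / m - (\<Sum>k\<in>K. c k)"
    by (simp add: sum_distrib_left sum_divide_distrib algebra_simps sum.distrib sum_subtractf)
  also have "\<dots> = ln m"
    using m by (simp add: c1 m_def[symmetric])
  finally have *: "(\<Sum>k\<in>K. c k * ln (y k)) \<le> ln m" .
  have "(\<Prod>k\<in>K. y k powr c k) = exp (\<Sum>k\<in>K. c k * ln (y k))"
    using yp fin by (simp add: exp_sum powr_def less_imp_neq[symmetric])
  also have "\<dots> \<le> m"
    using * m by (simp add: ln_ge_iff)
  finally show ?thesis by (simp add: m_def)
qed

text \<open>
  Hoelder's inequality for several functions. Bounds of the form \<open>exp (B k)\<close> instead of the integrals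
  themselves make every factor normalisable, which leaves no case of a zero or infinite integral.
\<close>

lemma nn_integral_prod_powr_le:
  fixes F :: "'k \<Rightarrow> 'a \<Rightarrow> real"
  assumes fin: "finite K" and c: "\<And>k. k \<in> K \<Longrightarrow> 0 < c k" and c1: "(\<Sum>k\<in>K. c k) = 1"
    and meas[measurable]: "\<And>k. k \<in> K \<Longrightarrow> F k \<in> borel_measurable M"
    and F: "\<And>k x. k \<in> K \<Longrightarrow> 0 \<le> F k x"
    and int: "\<And>k. k \<in> K \<Longrightarrow> (\<integral>\<^sup>+x. ennreal (F k x) \<partial>M) \<le> ennreal (exp (B k))"
  shows "(\<integral>\<^sup>+x. ennreal (\<Prod>k\<in>K. F k x powr c k) \<partial>M) \<le> ennreal (exp (\<Sum>k\<in>K. c k * B k))"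
proof -
  define E where "E = exp (\<Sum>k\<in>K. c k * B k)"
  have pw: "(\<Prod>k\<in>K. F k x powr c k) \<le> E * (\<Sum>k\<in>K. c k * (F k x * exp (- B k)))" for x
  proof -
    have "(\<Prod>k\<in>K. F k x powr c k) = (\<Prod>k\<in>K. exp (c k * B k) * (F k x * exp (- B k)) powr c k)"
    proof (intro prod.cong refl)
      fix k assume "k \<in> K"
      show "F k x powr c k = exp (c k * B k) * (F k x * exp (- B k)) powr c k"
      proof -
        have "exp (c k * B k) * (F k x * exp (- B k)) powr c k
            = F k x powr c k * (exp (c k * B k) * exp (- (c k * B k)))"
          using F[OF \<open>k \<in> K\<close>, of x] by (simp add: powr_mult exp_powr_real mult_ac)
        then show ?thesis by (simp only: exp_minus_inverse mult_1_right)
      qed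
    qed
    also have "\<dots> = E * (\<Prod>k\<in>K. (F k x * exp (- B k)) powr c k)"
      using fin by (simp add: prod.distrib E_def exp_sum)
    also have "\<dots> \<le> E * (\<Sum>k\<in>K. c k * (F k x * exp (- B k)))"
      using fin c c1 F by (intro mult_left_mono weighted_am_gm) (auto simp: E_def)
    finally show ?thesis .
  qed
  have "(\<integral>\<^sup>+x. ennreal (\<Prod>k\<in>K. F k x powr c k) \<partial>M)
      \<le> (\<integral>\<^sup>+x. ennreal E * (\<Sum>k\<in>K. ennreal (c k * exp (- B k)) * ennreal (F k x)) \<partial>M)"
  proof (rule nn_integral_mono)
    fix x
    have "ennreal (\<Prod>k\<in>K. F k x powr c k) \<le> ennreal (E * (\<Sum>k\<in>K. c k * exp (- B k) * F k x))"
      using pw[of x] by (intro ennreal_leI) (simp add: mult_ac)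
    also have "\<dots> = ennreal E * (\<Sum>k\<in>K. ennreal (c k * exp (- B k)) * ennreal (F k x))"
    proof -
      have "ennreal (\<Sum>k\<in>K. c k * exp (- B k) * F k x) = (\<Sum>k\<in>K. ennreal (c k * exp (- B k) * F k x))"
        using c F by (intro sum_ennreal[symmetric]) (auto simp: less_imp_le)
      also have "\<dots> = (\<Sum>k\<in>K. ennreal (c k * exp (- B k)) * ennreal (F k x))"
        using c F by (intro sum.cong refl ennreal_mult) (auto simp: less_imp_le)
      finally show ?thesis
        using c F by (subst ennreal_mult) (auto simp: E_def less_imp_le intro!: sum_nonneg)
    qed
    finally show "ennreal (\<Prod>k\<in>K. F k x powr c k)
      \<le> ennreal E * (\<Sum>k\<in>K. ennreal (c k * exp (- B k)) * ennreal (F k x))" .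
  qed
  also have "\<dots> = ennreal E * (\<Sum>k\<in>K. ennreal (c k * exp (- B k)) * (\<integral>\<^sup>+x. ennreal (F k x) \<partial>M))"
    by (simp add: nn_integral_cmult nn_integral_sum)
  also have "\<dots> \<le> ennreal E * (\<Sum>k\<in>K. ennreal (c k * exp (- B k)) * ennreal (exp (B k)))"
    using int by (intro mult_left_mono sum_mono) auto
  also have "\<dots> = ennreal E * (\<Sum>k\<in>K. ennreal (c k))"
    using c by (intro arg_cong2[where f="(*)"] sum.cong refl)
      (simp add: exp_minus less_imp_le flip: ennreal_mult)
  also have "\<dots> = ennreal E"
    using c c1 by (simp add: sum_ennreal less_imp_le)
  finally show ?thesis by (simp add: E_def)
qed

text \<open>
  A substitute for the triangle inequality that holds for every \<open>s > 0\<close>: one of \<open>A\<close> and \<open>B\<close> dominates,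
  so \<open>A + B\<close> is at most \<open>(1 + t) * A\<close> or at most \<open>(1 + 1 / t) * B\<close>. The factor of \<open>A\<close> is as close to \<open>1\<close>
  as desired, at the expense of the factor of \<open>B\<close>, which will be small.
\<close>

lemma add_powr_le:
  fixes A B t s :: real
  assumes "0 \<le> A" "0 \<le> B" "0 < t" "0 < s"
  shows "(A + B) powr s \<le> (1 + t) powr s * A powr s + (1 + 1 / t) powr s * B powr s"
proof (cases "B \<le> t * A")
  case True
  then have "(A + B) powr s \<le> ((1 + t) * A) powr s"
    using assms by (intro powr_mono2) (auto simp: algebra_simps)
  also have "\<dots> = (1 + t) powr s * A powr s"
    using assms by (simp add: powr_mult)
  finally show ?thesis
    using mult_nonneg_nonneg[OF powr_ge_zero powr_ge_zero, of "1 + 1 / t" s B s] by linarith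
next
  case False
  then have "(A + B) powr s \<le> ((1 + 1 / t) * B) powr s"
    using assms by (intro powr_mono2) (auto simp: field_simps)
  also have "\<dots> = (1 + 1 / t) powr s * B powr s"
    using assms by (simp add: powr_mult)
  finally show ?thesis
    using mult_nonneg_nonneg[OF powr_ge_zero powr_ge_zero, of "1 + t" s A s] by linarith
qed

section \<open>Exponential sums\<close>

text \<open>
  The list holds pairs of a real frequency and a coefficient function; frequencies may repeat.
\<close>

definition expsum :: "(real \<times> ('a \<Rightarrow> complex)) list \<Rightarrow> complex \<Rightarrow> 'a \<Rightarrow> complex" where
  "expsum h z x = (\<Sum>(l, g)\<leftarrow>h. exp (of_real l * z) * g x)"

definition coeff_sum :: "(real \<times> ('a \<Rightarrow> complex)) list \<Rightarrow> 'a \<Rightarrow> real" where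
  "coeff_sum h x = (\<Sum>(l, g)\<leftarrow>h. cmod (g x))"

lemma expsum_Nil [simp]: "expsum [] z x = 0" and expsum_Cons:
  "expsum ((l, g) # h) z x = exp (of_real l * z) * g x + expsum h z x"
  by (simp_all add: expsum_def)

lemma expsum_append: "expsum (h @ h') z x = expsum h z x + expsum h' z x"
  by (simp add: expsum_def)

lemma coeff_sum_Nil [simp]: "coeff_sum [] x = 0" and coeff_sum_Cons:
  "coeff_sum ((l, g) # h) x = cmod (g x) + coeff_sum h x"
  by (simp_all add: coeff_sum_def)

lemma coeff_sum_nonneg: "0 \<le> coeff_sum h x"
  by (induction h) (auto simp: coeff_sum_Cons)

lemma expsum_holomorphic: "(\<lambda>z. expsum h z x) holomorphic_on A"
  by (induction h) (auto simp: expsum_Cons intro!: holomorphic_intros)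

lemma expsum_measurable:
  assumes "\<And>l g. (l, g) \<in> set h \<Longrightarrow> g \<in> borel_measurable M"
  shows "expsum h z \<in> borel_measurable M"
  using assms
proof (induction h)
  case Nil
  then show ?case by (simp add: expsum_def[abs_def])
next
  case (Cons a h)
  obtain l g where a: "a = (l, g)" by force
  have [measurable]: "g \<in> borel_measurable M" "expsum h z \<in> borel_measurable M"
    using Cons by (auto simp: a)
  have "expsum (a # h) z = (\<lambda>x. exp (of_real l * z) * g x + expsum h z x)"
    by (simp add: a expsum_Cons fun_eq_iff)
  then show ?case by simp
qed

lemma coeff_sum_measurable:
  assumes "\<And>l g. (l, g) \<in> set h \<Longrightarrow> g \<in> borel_measurable M"
  shows "coeff_sum h \<in> borel_measurable M"
  using assms
proof (induction h)
  case Nil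
  then show ?case by (simp add: coeff_sum_def[abs_def])
next
  case (Cons a h)
  obtain l g where a: "a = (l, g)" by force
  have [measurable]: "g \<in> borel_measurable M" "coeff_sum h \<in> borel_measurable M"
    using Cons by (auto simp: a)
  have "coeff_sum (a # h) = (\<lambda>x. cmod (g x) + coeff_sum h x)"
    by (simp add: a coeff_sum_Cons fun_eq_iff)
  then show ?case by simp
qed

lemma expsum_shift: "expsum (map (\<lambda>(l', g). (l + l', g)) h) z x = exp (of_real l * z) * expsum h z x"
proof (induction h)
  case (Cons a h)
  obtain l' g where a: "a = (l', g)" by force
  have "exp (of_real (l + l') * z) = exp (of_real l * z) * exp (of_real l' * z)"
    by (simp add: distrib_right exp_add)
  then show ?case using Cons by (simp add: a expsum_Cons distrib_left mult.assoc)
qed simp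

lemma expsum_concat: "expsum (concat hs) z x = (\<Sum>h\<leftarrow>hs. expsum h z x)"
  by (induction hs) (simp_all add: expsum_append)

definition strip :: "complex set" where "strip = {z. 0 \<le> Re z \<and> Re z \<le> 1}"

lemma convex_strip: "convex strip"
proof -
  have "strip = {z. Re z \<ge> 0} \<inter> {z. Re z \<le> 1}" by (auto simp: strip_def)
  then show ?thesis
    using convex_Int[OF convex_halfspace_Re_ge[of 0] convex_halfspace_Re_le[of 1]] by (simp only:)
qed

text \<open>
  On the strip \<open>\<bar>exp (l * z)\<bar> \<le> exp \<bar>l\<bar>\<close>, so the constant depends on the frequencies only. Its uniformity
  in \<open>x\<close>, relative to the sum of the moduli of the coefficients, is what later allows one number of
  sampling points for all \<open>x\<close>.
\<close>

lemma expsum_lipschitz: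
  obtains C where "0 < C" and
    "\<And>z z' x. z \<in> strip \<Longrightarrow> z' \<in> strip \<Longrightarrow>
       cmod (expsum h z x - expsum h z' x) \<le> C * coeff_sum h x * cmod (z - z')"
proof -
  have "\<exists>C>0. \<forall>z\<in>strip. \<forall>z'\<in>strip. \<forall>x. cmod (expsum h z x - expsum h z' x) \<le> C * coeff_sum h x * cmod (z - z')"
  proof (induction h)
    case (Cons a h)
    obtain l g where a: "a = (l, g)" by force
    obtain C where C: "C > 0" and *: "\<And>z z' x. z \<in> strip \<Longrightarrow> z' \<in> strip \<Longrightarrow>
       cmod (expsum h z x - expsum h z' x) \<le> C * coeff_sum h x * cmod (z - z')"
      using Cons by blast
    define D where "D = max C (\<bar>l\<bar> * exp \<bar>l\<bar>)"
    have D: "D > 0" "C \<le> D" "\<bar>l\<bar> * exp \<bar>l\<bar> \<le> D" using C by (auto simp: D_def)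
    have lip: "cmod (exp (of_real l * z) - exp (of_real l * z')) \<le> D * cmod (z - z')"
      if "z \<in> strip" "z' \<in> strip" for z z' :: complex
    proof (rule order_trans[OF field_differentiable_bound[OF convex_strip _ _ that(1,2)]])
      fix s :: complex assume s: "s \<in> strip"
      show "((\<lambda>z. exp (of_real l * z)) has_field_derivative (of_real l * exp (of_real l * s))) (at s within strip)"
        by (auto intro!: derivative_eq_intros)
      have "l * Re s \<le> \<bar>l\<bar> * 1"
      proof (rule order_trans[of _ "\<bar>l\<bar> * Re s"])
        show "l * Re s \<le> \<bar>l\<bar> * Re s" "\<bar>l\<bar> * Re s \<le> \<bar>l\<bar> * 1"
          using s by (auto simp: strip_def intro!: mult_right_mono mult_left_le)
      qed
      then show "cmod (of_real l * exp (of_real l * s)) \<le> \<bar>l\<bar> * exp \<bar>l\<bar>"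
        by (simp add: norm_mult mult_left_mono)
    qed (use D in \<open>auto intro: mult_right_mono\<close>)
    show ?case
    proof (intro exI[of _ D] conjI ballI allI D)
      fix z z' x assume z: "z \<in> strip" "z' \<in> strip"
      have "cmod (expsum (a # h) z x - expsum (a # h) z' x)
        = cmod ((exp (of_real l * z) - exp (of_real l * z')) * g x + (expsum h z x - expsum h z' x))"
        by (simp add: a expsum_Cons algebra_simps)
      also have "\<dots> \<le> cmod (exp (of_real l * z) - exp (of_real l * z')) * cmod (g x)
          + cmod (expsum h z x - expsum h z' x)"
        by (metis norm_mult norm_triangle_ineq)
      also have "\<dots> \<le> D * cmod (z - z') * cmod (g x) + D * coeff_sum h x * cmod (z - z')"
      proof (rule add_mono)
        show "cmod (exp (of_real l * z) - exp (of_real l * z')) * cmod (g x) \<le> D * cmod (z - z') * cmod (g x)"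
          using lip[OF z] by (rule mult_right_mono) simp
        show "cmod (expsum h z x - expsum h z' x) \<le> D * coeff_sum h x * cmod (z - z')"
          using *[OF z, of x] by (rule order_trans)
            (intro mult_right_mono D coeff_sum_nonneg norm_ge_zero)
      qed
      also have "\<dots> = D * coeff_sum (a # h) x * cmod (z - z')"
        by (simp add: a coeff_sum_Cons algebra_simps)
      finally show "cmod (expsum (a # h) z x - expsum (a # h) z' x) \<le> D * coeff_sum (a # h) x * cmod (z - z')" .
    qed
  qed (auto intro: exI[of _ 1])
  then show ?thesis using that by blast
qed

definition nroot :: "nat \<Rightarrow> nat \<Rightarrow> complex" where
  "nroot N k = cis (2 * pi * real k / real N)"

lemma norm_nroot [simp]: "cmod (nroot N k) = 1"
  by (simp add: nroot_def)

lemma nroot_mult: "nroot N j * nroot N k = nroot N (j + k)"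
  by (simp add: nroot_def cis_mult distrib_left add_divide_distrib)

text \<open>
  A discrete form of the subharmonicity of \<open>ln \<bar>f\<bar>\<close>. The product of \<open>f\<close> over the \<open>N\<close> rotations by roots
  of unity is itself invariant under them, so by the maximum principle its value \<open>f 0 ^ N\<close> at the centre
  is bounded by its values on an arc of length \<open>2 * pi / N\<close> that starts at \<open>1\<close>.
\<close>

lemma prod_rotations_max:
  fixes f :: "complex \<Rightarrow> complex"
  assumes hol: "f holomorphic_on UNIV" and N: "0 < N"
    and bnd: "\<And>t k. 0 \<le> t \<Longrightarrow> t < 2 * pi / real N \<Longrightarrow> k < N \<Longrightarrow> cmod (f (cis t * nroot N k)) \<le> b k"
  shows "cmod (f 0) ^ N \<le> (\<Prod>k<N. b k)"
proof -
  define H where "H \<zeta> = (\<Prod>k<N. f (\<zeta> * nroot N k))" for \<zeta>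
  have holH: "H holomorphic_on UNIV"
    unfolding H_def
    by (intro holomorphic_on_prod holomorphic_on_compose_gen[OF _ hol, unfolded o_def] holomorphic_intros) auto
  have rot: "H (\<zeta> * nroot N 1) = H \<zeta>" for \<zeta>
  proof -
    have a: "nroot N 1 * nroot N k = nroot N (Suc k)" for k
      by (simp add: nroot_mult)
    have "nroot N N = nroot N 0" using N by (simp add: nroot_def)
    have "H (\<zeta> * nroot N 1) = (\<Prod>k<N. f (\<zeta> * nroot N (Suc k)))"
      by (simp only: H_def mult.assoc a)
    also have "\<dots> = (\<Prod>k\<in>{1..<Suc N}. f (\<zeta> * nroot N k))"
      by (rule prod.reindex_bij_witness[of _ "\<lambda>k. k - 1" Suc]) auto
    also have "\<dots> = (\<Prod>k\<in>{1..<N}. f (\<zeta> * nroot N k)) * f (\<zeta> * nroot N N)"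
      using N by (simp add: prod.atLeastLessThan_Suc)
    also have "\<dots> = f (\<zeta> * nroot N 0) * (\<Prod>k\<in>{1..<N}. f (\<zeta> * nroot N k))"
      by (simp add: \<open>nroot N N = nroot N 0\<close>)
    also have "\<dots> = H \<zeta>"
      using N by (simp add: H_def lessThan_atLeast0 prod.atLeast_Suc_lessThan)
    finally show ?thesis .
  qed
  have rots: "H (\<zeta> * nroot N k) = H \<zeta>" for \<zeta> k
  proof (induction k)
    case (Suc k)
    have "nroot N (Suc k) = nroot N k * nroot N 1"
      by (simp add: nroot_mult)
    then show ?case using rot[of "\<zeta> * nroot N k"] Suc by (simp add: mult.assoc)
  qed (simp add: nroot_def)
  have arc: "cmod (H (cis t)) \<le> (\<Prod>k<N. b k)" if "0 \<le> t" "t < 2 * pi / real N" for t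
    unfolding H_def prod_norm[symmetric] using bnd[OF that] by (intro prod_mono) auto
  have circ: "cmod (H \<zeta>) \<le> (\<Prod>k<N. b k)" if "cmod \<zeta> = 1" for \<zeta>
  proof -
    obtain t where t: "0 \<le> t" "t < 2 * pi" "\<zeta> = cis t"
    proof (rule that)
      show "\<zeta> = cis (Arg2pi \<zeta>)"
        using Arg2pi_eq[of \<zeta>] \<open>cmod \<zeta> = 1\<close> by (simp add: cis_conv_exp)
    qed (use Arg2pi_ge_0[of \<zeta>] Arg2pi_lt_2pi[of \<zeta>] in auto)
    define u where "u = 2 * pi / real N"
    have u: "0 < u" using N by (simp add: u_def)
    define k where "k = nat \<lfloor>t / u\<rfloor>"
    have k: "real k \<le> t / u" "t / u < real k + 1"
      using t u by (auto simp: k_def)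
    then have s: "0 \<le> t - real k * u" "t - real k * u < u"
      using u by (auto simp: field_simps)
    have "\<zeta> = cis (t - real k * u) * nroot N k"
      by (simp add: t nroot_def cis_mult u_def)
    then have "H \<zeta> = H (cis (t - real k * u))" by (simp add: rots)
    then show ?thesis using arc s by (simp add: u_def)
  qed
  have "cmod (H 0) \<le> (\<Prod>k<N. b k)"
  proof (rule maximum_modulus_frontier[of H "ball 0 1"])
    show "H holomorphic_on interior (ball 0 1)" using holH holomorphic_on_subset by blast
    show "continuous_on (closure (ball 0 1)) H"
      using holH holomorphic_on_imp_continuous_on holomorphic_on_subset by blast
  qed (auto simp: circ)
  then show ?thesis by (simp add: H_def norm_power)
qed

lemma cmod_cis_minus_one_le: assumes "0 \<le> t" shows "cmod (cis t - 1) \<le> t"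
proof -
  have "cmod (cis t - 1) ^ 2 = (cos t - 1)\<^sup>2 + (sin t)\<^sup>2"
    by (simp add: cmod_power2)
  also have "\<dots> = 2 - 2 * cos t"
    using sin_cos_squared_add[of t] by (simp add: power2_eq_square algebra_simps)
  also have "\<dots> = (2 * \<bar>sin (t / 2)\<bar>) ^ 2"
    using cos_double_sin[of "t / 2"] by (simp add: power_mult_distrib)
  finally have "cmod (cis t - 1) = 2 * \<bar>sin (t / 2)\<bar>"
    by (rule power2_eq_imp_eq) auto
  then show ?thesis
    using abs_sin_x_le_abs_x[of "t / 2"] assms by simp
qed

text \<open>
  On the short arc each factor differs from its value at the \<open>N\<close>-th root of unity by at most the Lipschitz
  constant times \<open>2 * pi / N\<close>. The hypotheses on \<open>d\<close> keep the disc in the strip.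
\<close>

lemma expsum_submean:
  obtains C where "0 < C" and
    "\<And>z d N x. 0 < N \<Longrightarrow> 0 \<le> d \<Longrightarrow> 0 \<le> Re z - d \<Longrightarrow> Re z + d \<le> 1 \<Longrightarrow>
       cmod (expsum h z x) ^ N
         \<le> (\<Prod>k<N. cmod (expsum h (z + of_real d * nroot N k) x) + C / real N * coeff_sum h x)"
proof -
  obtain C where C: "0 < C" and lip: "\<And>z z' x. z \<in> strip \<Longrightarrow> z' \<in> strip \<Longrightarrow>
       cmod (expsum h z x - expsum h z' x) \<le> C * coeff_sum h x * cmod (z - z')"
    using expsum_lipschitz[of h] by blast
  show ?thesis
  proof (rule that[of "C * (2 * pi)"])
    show "0 < C * (2 * pi)" using C by simp
    fix z :: complex and d :: real and N :: nat and x
    assume N: "0 < N" and d: "0 \<le> d" "0 \<le> Re z - d" "Re z + d \<le> 1"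
    have in_strip: "z + of_real d * \<zeta> \<in> strip" if "cmod \<zeta> = 1" for \<zeta>
    proof -
      have "\<bar>d * Re \<zeta>\<bar> \<le> d"
        using abs_Re_le_cmod[of \<zeta>] that d mult_left_mono[of "\<bar>Re \<zeta>\<bar>" 1 d] by (simp add: abs_mult)
      then show ?thesis using d by (auto simp: strip_def)
    qed
    have "cmod (expsum h (z + of_real d * 0) x) ^ N
      \<le> (\<Prod>k<N. cmod (expsum h (z + of_real d * nroot N k) x) + C * (2 * pi) / real N * coeff_sum h x)"
    proof (rule prod_rotations_max[OF _ N])
      show "(\<lambda>\<zeta>. expsum h (z + of_real d * \<zeta>) x) holomorphic_on UNIV"
        by (intro holomorphic_on_compose_gen[OF _ expsum_holomorphic[of h x UNIV], unfolded o_def] holomorphic_intros) auto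
      fix t k assume t: "0 \<le> t" "t < 2 * pi / real N"
      let ?z1 = "z + of_real d * (cis t * nroot N k)" and ?z0 = "z + of_real d * nroot N k"
      have "?z1 - ?z0 = of_real d * nroot N k * (cis t - 1)" by (simp add: algebra_simps)
      then have "cmod (?z1 - ?z0) = d * cmod (cis t - 1)" using d by (simp only: norm_mult) simp
      also have "\<dots> \<le> 1 * (2 * pi / real N)"
        using cmod_cis_minus_one_le[OF t(1)] t d by (intro mult_mono) auto
      finally have "C * coeff_sum h x * cmod (?z1 - ?z0) \<le> C * coeff_sum h x * (2 * pi / real N)"
        using C by (intro mult_left_mono) (auto simp: coeff_sum_nonneg)
      moreover have "cmod (expsum h ?z1 x - expsum h ?z0 x) \<le> C * coeff_sum h x * cmod (?z1 - ?z0)"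
        by (intro lip in_strip) (auto simp: norm_mult)
      ultimately have "cmod (expsum h ?z1 x - expsum h ?z0 x) \<le> C * (2 * pi) / real N * coeff_sum h x"
        by (simp add: mult_ac)
      then show "cmod (expsum h ?z1 x)
        \<le> cmod (expsum h ?z0 x) + C * (2 * pi) / real N * coeff_sum h x"
        using norm_triangle_sub[of "expsum h ?z1 x" "expsum h ?z0 x"] by linarith
    qed
    then show "cmod (expsum h z x) ^ N
      \<le> (\<Prod>k<N. cmod (expsum h (z + of_real d * nroot N k) x) + C * (2 * pi) / real N * coeff_sum h x)"
      by simp
  qed
qed

lemma sum_Re_nroot:
  assumes "2 \<le> N" shows "(\<Sum>k<N. Re (nroot N k)) = 0"
proof -
  have "cis (2 * pi / real N) \<noteq> 1"
  proof
    assume "cis (2 * pi / real N) = 1"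
    then have "cos (2 * (pi / real N)) = 1" by (simp add: complex_eq_iff)
    then have "sin (pi / real N) = 0" using cos_double_sin[of "pi / real N"] by simp
    moreover have "sin (pi / real N) > 0"
      using assms by (intro sin_gt_zero) (auto simp: field_simps)
    ultimately show False by simp
  qed
  moreover have "nroot N k = cis (2 * pi / real N) ^ k" for k
    unfolding nroot_def Complex.DeMoivre by (rule arg_cong[of _ _ cis]) (simp add: field_simps)
  moreover have "cis (2 * pi / real N) ^ N = 1"
    using assms by (simp add: Complex.DeMoivre)
  ultimately have "(\<Sum>k<N. nroot N k) = 0"
    by (simp add: geometric_sum)
  then show ?thesis by (simp flip: Re_sum)
qed

text \<open>
  The squared cosine has mean \<open>1 / 2\<close>, the average of \<open>cos (4 * pi * k / N)\<close> being zero as soon as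
  \<open>N \<ge> 3\<close>. This positive mean is the gain of a strictly concave function in the maximum principle below.
\<close>

lemma sum_Re_nroot_squared:
  assumes "3 \<le> N" shows "(\<Sum>k<N. (Re (nroot N k))\<^sup>2) = real N / 2"
proof -
  have "cis (4 * pi / real N) \<noteq> 1"
  proof
    assume "cis (4 * pi / real N) = 1"
    then have "cos (2 * (2 * pi / real N)) = 1" by (simp add: complex_eq_iff)
    then have "sin (2 * pi / real N) = 0" using cos_double_sin[of "2 * pi / real N"] by simp
    moreover have "sin (2 * pi / real N) > 0"
      using assms by (intro sin_gt_zero) (auto simp: field_simps)
    ultimately show False by simp
  qed
  moreover have "cis (2 * (2 * pi * real k / real N)) = cis (4 * pi / real N) ^ k" for k
    unfolding Complex.DeMoivre by (rule arg_cong[of _ _ cis]) (simp add: field_simps)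
  moreover have "cis (4 * pi / real N) ^ N = 1"
    using assms cis_multiple_2pi[of 2] by (simp add: Complex.DeMoivre)
  ultimately have "(\<Sum>k<N. cis (2 * (2 * pi * real k / real N))) = 0"
    by (simp add: geometric_sum)
  then have "(\<Sum>k<N. cos (2 * (2 * pi * real k / real N))) = 0"
    by (simp add: complex_eq_iff)
  moreover have "(Re (nroot N k))\<^sup>2 = 1 / 2 + cos (2 * (2 * pi * real k / real N)) / 2" for k
    unfolding nroot_def using cos_double_cos[of "2 * pi * real k / real N"] by (simp add: field_simps)
  ultimately show ?thesis
    by (simp add: sum.distrib flip: sum_divide_distrib)
qed


section \<open>Intermediate spaces between two weighted Lebesgue spaces\<close>

text \<open>
  Two weighted Lebesgue spaces \<open>L\<^bsup>s0\<^esup>(a)\<close> and \<open>L\<^bsup>s1\<^esup>(b)\<close> on one measure space. The weights are positive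
  everywhere, which spares exceptional sets in pointwise computations.
\<close>

locale weight_couple =
  fixes M :: "'a measure" and a b :: "'a \<Rightarrow> real" and s0 s1 :: real
  assumes a_meas [measurable]: "a \<in> borel_measurable M"
    and b_meas [measurable]: "b \<in> borel_measurable M"
    and a_pos: "\<And>x. 0 < a x" and b_pos: "\<And>x. 0 < b x"
    and s0: "0 < s0" and s1: "0 < s1"
begin

definition mid_exp :: "real \<Rightarrow> real" where
  "mid_exp \<sigma> = 1 / ((1 - \<sigma>) / s0 + \<sigma> / s1)"

definition mid_wt :: "real \<Rightarrow> 'a \<Rightarrow> real" where
  "mid_wt \<sigma> x = a x powr (1 - \<sigma>) * b x powr \<sigma>"

text \<open>
  The power \<open>mid_exp \<sigma>\<close> of the norm in the intermediate space. Upper bounds for it are always written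
  \<open>exp (mid_exp \<sigma> * B)\<close>, where \<open>B\<close> bounds the logarithm of the norm.
\<close>

definition mid_int :: "real \<Rightarrow> ('a \<Rightarrow> real) \<Rightarrow> ennreal" where
  "mid_int \<sigma> \<phi> = (\<integral>\<^sup>+x. ennreal ((\<phi> x * mid_wt \<sigma> x) powr mid_exp \<sigma>) \<partial>M)"

lemma mid_wt_meas [measurable]: "mid_wt \<sigma> \<in> borel_measurable M"
  unfolding mid_wt_def[abs_def] by measurable

lemma mid_wt_pos: "0 < mid_wt \<sigma> x"
  using a_pos[of x] b_pos[of x] by (simp add: mid_wt_def)

lemma mid_exp_denominator_pos: "0 \<le> \<sigma> \<Longrightarrow> \<sigma> \<le> 1 \<Longrightarrow> 0 < (1 - \<sigma>) / s0 + \<sigma> / s1"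
  using s0 s1 by (cases "\<sigma> = 0") (auto intro!: add_nonneg_pos)

lemma mid_exp_pos: "0 \<le> \<sigma> \<Longrightarrow> \<sigma> \<le> 1 \<Longrightarrow> 0 < mid_exp \<sigma>"
  using mid_exp_denominator_pos by (simp add: mid_exp_def)

lemma mid_exp_ge:
  assumes "0 \<le> \<sigma>" "\<sigma> \<le> 1" shows "min s0 s1 \<le> mid_exp \<sigma>"
proof -
  define m where "m = min s0 s1"
  have m: "0 < m" "m \<le> s0" "m \<le> s1" using s0 s1 by (auto simp: m_def)
  have "(1 - \<sigma>) / s0 + \<sigma> / s1 \<le> (1 - \<sigma>) / m + \<sigma> / m"
    using m assms by (intro add_mono divide_left_mono) auto
  also have "\<dots> = 1 / m" by (simp flip: add_divide_distrib)
  finally have "1 / (1 / m) \<le> mid_exp \<sigma>"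
    unfolding mid_exp_def using m mid_exp_denominator_pos[OF assms] by (intro divide_left_mono) auto
  then show ?thesis by (simp add: m_def)
qed

lemma mid_exp_0 [simp]: "mid_exp 0 = s0" and mid_exp_1 [simp]: "mid_exp 1 = s1"
  by (simp_all add: mid_exp_def)

lemma mid_wt_0 [simp]: "mid_wt 0 x = a x" and mid_wt_1 [simp]: "mid_wt 1 x = b x"
  using a_pos[of x] b_pos[of x] by (simp_all add: mid_wt_def)

lemma mid_int_cong_AE:
  "(AE x in M. \<phi> x = \<psi> x) \<Longrightarrow> mid_int \<sigma> \<phi> = mid_int \<sigma> \<psi>"
  unfolding mid_int_def by (intro nn_integral_cong_AE) (auto elim: eventually_mono)

lemma mid_int_mono:
  assumes "\<And>x. 0 \<le> \<phi> x" "\<And>x. \<phi> x \<le> \<psi> x" "0 \<le> \<sigma>" "\<sigma> \<le> 1"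
  shows "mid_int \<sigma> \<phi> \<le> mid_int \<sigma> \<psi>"
  unfolding mid_int_def
  using assms mid_exp_pos[OF assms(3,4)]
  by (intro nn_integral_mono ennreal_leI powr_mono2 mult_right_mono mult_nonneg_nonneg)
     (auto simp: less_imp_le mid_wt_pos)

lemma mid_int_cmult:
  assumes "0 \<le> c" and [measurable]: "\<phi> \<in> borel_measurable M" and "\<And>x. 0 \<le> \<phi> x"
  shows "mid_int \<sigma> (\<lambda>x. c * \<phi> x) = ennreal (c powr mid_exp \<sigma>) * mid_int \<sigma> \<phi>"
proof -
  have "ennreal ((c * \<phi> x * mid_wt \<sigma> x) powr mid_exp \<sigma>)
      = ennreal (c powr mid_exp \<sigma>) * ennreal ((\<phi> x * mid_wt \<sigma> x) powr mid_exp \<sigma>)" for x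
    using assms mid_wt_pos[of \<sigma> x] by (simp add: powr_mult less_imp_le mult.assoc flip: ennreal_mult)
  then show ?thesis by (simp add: mid_int_def nn_integral_cmult)
qed

lemma mid_int_add:
  assumes [measurable]: "\<phi> \<in> borel_measurable M" "\<psi> \<in> borel_measurable M"
    and nn: "\<And>x. 0 \<le> \<phi> x" "\<And>x. 0 \<le> \<psi> x" and t: "0 < t" and \<sigma>: "0 \<le> \<sigma>" "\<sigma> \<le> 1"
  shows "mid_int \<sigma> (\<lambda>x. \<phi> x + \<psi> x) \<le> ennreal ((1 + t) powr mid_exp \<sigma>) * mid_int \<sigma> \<phi>
           + ennreal ((1 + 1 / t) powr mid_exp \<sigma>) * mid_int \<sigma> \<psi>"
proof -
  have "ennreal (((\<phi> x + \<psi> x) * mid_wt \<sigma> x) powr mid_exp \<sigma>)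
     \<le> ennreal ((1 + t) powr mid_exp \<sigma>) * ennreal ((\<phi> x * mid_wt \<sigma> x) powr mid_exp \<sigma>)
     + ennreal ((1 + 1 / t) powr mid_exp \<sigma>) * ennreal ((\<psi> x * mid_wt \<sigma> x) powr mid_exp \<sigma>)" for x
    using add_powr_le[of "\<phi> x * mid_wt \<sigma> x" "\<psi> x * mid_wt \<sigma> x" t "mid_exp \<sigma>"]
      mid_wt_pos[of \<sigma> x] nn[of x] t mid_exp_pos[OF \<sigma>]
    by (simp add: distrib_right less_imp_le flip: ennreal_mult ennreal_plus)
  then have "mid_int \<sigma> (\<lambda>x. \<phi> x + \<psi> x)
    \<le> (\<integral>\<^sup>+x. (ennreal ((1 + t) powr mid_exp \<sigma>) * ennreal ((\<phi> x * mid_wt \<sigma> x) powr mid_exp \<sigma>)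
     + ennreal ((1 + 1 / t) powr mid_exp \<sigma>) * ennreal ((\<psi> x * mid_wt \<sigma> x) powr mid_exp \<sigma>)) \<partial>M)"
    unfolding mid_int_def by (rule nn_integral_mono)
  also have "\<dots> = ennreal ((1 + t) powr mid_exp \<sigma>) * mid_int \<sigma> \<phi>
           + ennreal ((1 + 1 / t) powr mid_exp \<sigma>) * mid_int \<sigma> \<psi>"
    by (simp add: nn_integral_add nn_integral_cmult mid_int_def)
  finally show ?thesis .
qed

text \<open>
  Log-convexity along the scale. The Hoelder exponents are \<open>\<alpha> k * mid_exp \<sigma> / mid_exp (\<tau> k)\<close>; they add up
  to \<open>1\<close> because \<open>1 / mid_exp\<close> is affine and \<open>\<sigma>\<close> is the barycentre of the \<open>\<tau> k\<close>, and the weights multiply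
  up to \<open>mid_wt \<sigma>\<close> for the same reason.
\<close>

lemma mid_int_geometric_mean:
  fixes K :: "'k set"
  assumes fin: "finite K" and \<alpha>: "\<And>k. k \<in> K \<Longrightarrow> 0 < \<alpha> k" and \<alpha>1: "(\<Sum>k\<in>K. \<alpha> k) = 1"
    and \<tau>: "\<And>k. k \<in> K \<Longrightarrow> 0 \<le> \<tau> k \<and> \<tau> k \<le> 1" and \<sigma>: "\<sigma> = (\<Sum>k\<in>K. \<alpha> k * \<tau> k)"
    and [measurable]: "\<And>k. k \<in> K \<Longrightarrow> \<phi> k \<in> borel_measurable M"
    and nn: "\<And>k x. 0 \<le> \<phi> k x" "\<And>x. 0 \<le> \<psi> x"
    and le: "\<And>x. \<psi> x \<le> (\<Prod>k\<in>K. \<phi> k x powr \<alpha> k)"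
    and int: "\<And>k. k \<in> K \<Longrightarrow> mid_int (\<tau> k) (\<phi> k) \<le> ennreal (exp (mid_exp (\<tau> k) * B k))"
  shows "mid_int \<sigma> \<psi> \<le> ennreal (exp (mid_exp \<sigma> * (\<Sum>k\<in>K. \<alpha> k * B k)))"
proof -
  have \<sigma>01: "0 \<le> \<sigma>" "\<sigma> \<le> 1"
  proof -
    show "0 \<le> \<sigma>" unfolding \<sigma> using \<alpha> \<tau> by (intro sum_nonneg mult_nonneg_nonneg) (auto simp: less_imp_le)
    have "\<sigma> \<le> (\<Sum>k\<in>K. \<alpha> k * 1)"
      unfolding \<sigma> using \<alpha> \<tau> by (intro sum_mono mult_left_mono) (auto simp: less_imp_le)
    then show "\<sigma> \<le> 1" using \<alpha>1 by simp
  qed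
  have r: "0 < mid_exp \<sigma>" using \<sigma>01 by (rule mid_exp_pos)
  have rk: "0 < mid_exp (\<tau> k)" if "k \<in> K" for k using \<tau>[OF that] by (auto intro: mid_exp_pos)
  define c where "c k = \<alpha> k * mid_exp \<sigma> / mid_exp (\<tau> k)" for k
  have c: "0 < c k" if "k \<in> K" for k using \<alpha>[OF that] r rk[OF that] by (simp add: c_def)
  have "(\<Sum>k\<in>K. c k) = mid_exp \<sigma> * (\<Sum>k\<in>K. \<alpha> k * ((1 - \<tau> k) / s0 + \<tau> k / s1))"
    unfolding sum_distrib_left by (intro sum.cong refl) (simp add: c_def mid_exp_def)
  also have "(\<Sum>k\<in>K. \<alpha> k * ((1 - \<tau> k) / s0 + \<tau> k / s1))
      = ((\<Sum>k\<in>K. \<alpha> k) - (\<Sum>k\<in>K. \<alpha> k * \<tau> k)) / s0 + (\<Sum>k\<in>K. \<alpha> k * \<tau> k) / s1"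
    by (simp add: distrib_left right_diff_distrib sum.distrib sum_subtractf sum_divide_distrib diff_divide_distrib)
  also have "\<dots> = (1 - \<sigma>) / s0 + \<sigma> / s1" by (simp add: \<alpha>1 \<sigma>)
  finally have c1: "(\<Sum>k\<in>K. c k) = 1"
    using mid_exp_denominator_pos[OF \<sigma>01] by (simp add: mid_exp_def)
  have wt: "(\<Prod>k\<in>K. mid_wt (\<tau> k) x powr \<alpha> k) = mid_wt \<sigma> x" for x
  proof -
    have e: "mid_wt t x = exp ((1 - t) * ln (a x) + t * ln (b x))" for t
      using a_pos[of x] b_pos[of x] by (simp add: mid_wt_def powr_def exp_add)
    have "(\<Prod>k\<in>K. mid_wt (\<tau> k) x powr \<alpha> k)
        = exp (\<Sum>k\<in>K. \<alpha> k * ((1 - \<tau> k) * ln (a x) + \<tau> k * ln (b x)))"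
      using fin by (simp add: e exp_sum exp_powr_real mult.commute)
    also have "(\<Sum>k\<in>K. \<alpha> k * ((1 - \<tau> k) * ln (a x) + \<tau> k * ln (b x)))
        = ((\<Sum>k\<in>K. \<alpha> k) - (\<Sum>k\<in>K. \<alpha> k * \<tau> k)) * ln (a x) + (\<Sum>k\<in>K. \<alpha> k * \<tau> k) * ln (b x)"
      by (simp add: distrib_left right_diff_distrib left_diff_distrib sum.distrib sum_subtractf
          sum_distrib_left mult_ac \<alpha>1 flip: sum_distrib_right)
    finally show ?thesis by (simp add: e \<alpha>1 \<sigma>)
  qed
  define F where "F k x = (\<phi> k x * mid_wt (\<tau> k) x) powr mid_exp (\<tau> k)" for k x
  have F: "(\<Prod>k\<in>K. F k x powr c k) = ((\<Prod>k\<in>K. \<phi> k x powr \<alpha> k) * mid_wt \<sigma> x) powr mid_exp \<sigma>" for x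
  proof -
    have "(\<Prod>k\<in>K. F k x powr c k) = (\<Prod>k\<in>K. (\<phi> k x powr \<alpha> k * mid_wt (\<tau> k) x powr \<alpha> k) powr mid_exp \<sigma>)"
    proof (intro prod.cong refl)
      fix k assume k: "k \<in> K"
      have "F k x powr c k = (\<phi> k x * mid_wt (\<tau> k) x) powr (\<alpha> k * mid_exp \<sigma>)"
        using rk[OF k] by (simp add: F_def powr_powr c_def)
      then show "F k x powr c k = (\<phi> k x powr \<alpha> k * mid_wt (\<tau> k) x powr \<alpha> k) powr mid_exp \<sigma>"
        using nn mid_wt_pos by (simp add: powr_mult powr_powr less_imp_le)
    qed
    also have "\<dots> = (\<Prod>k\<in>K. \<phi> k x powr \<alpha> k * mid_wt (\<tau> k) x powr \<alpha> k) powr mid_exp \<sigma>"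
      using fin by (simp add: prod_powr_distrib)
    finally show ?thesis by (simp add: prod.distrib wt)
  qed
  have "mid_int \<sigma> \<psi> \<le> (\<integral>\<^sup>+x. ennreal (\<Prod>k\<in>K. F k x powr c k) \<partial>M)"
    unfolding mid_int_def F using r nn le
    by (intro nn_integral_mono ennreal_leI powr_mono2 mult_right_mono mult_nonneg_nonneg)
       (auto simp: less_imp_le mid_wt_pos)
  also have "\<dots> \<le> ennreal (exp (\<Sum>k\<in>K. c k * (mid_exp (\<tau> k) * B k)))"
  proof (rule nn_integral_prod_powr_le[OF fin c c1])
    show "F k \<in> borel_measurable M" if "k \<in> K" for k
      unfolding F_def[abs_def] using that by measurable
  qed (use int in \<open>auto simp: F_def mid_int_def\<close>)
  also have "(\<Sum>k\<in>K. c k * (mid_exp (\<tau> k) * B k)) = mid_exp \<sigma> * (\<Sum>k\<in>K. \<alpha> k * B k)"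
    unfolding sum_distrib_left
  proof (intro sum.cong refl)
    fix k assume "k \<in> K"
    then show "c k * (mid_exp (\<tau> k) * B k) = mid_exp \<sigma> * (\<alpha> k * B k)"
      using rk[of k] by (simp add: c_def)
  qed
  finally show ?thesis .
qed

lemma mid_int_endpoints:
  assumes [measurable]: "\<phi> \<in> borel_measurable M" and nn: "\<And>x. 0 \<le> \<phi> x"
    and "mid_int 0 \<phi> \<le> ennreal (exp (s0 * B0))" "mid_int 1 \<phi> \<le> ennreal (exp (s1 * B1))"
    and \<sigma>: "0 \<le> \<sigma>" "\<sigma> \<le> 1"
  shows "mid_int \<sigma> \<phi> \<le> ennreal (exp (mid_exp \<sigma> * ((1 - \<sigma>) * B0 + \<sigma> * B1)))"
proof (cases "\<sigma> = 0 \<or> \<sigma> = 1")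
  case True
  then show ?thesis using assms by auto
next
  case False
  have "mid_int \<sigma> \<phi> \<le> ennreal (exp (mid_exp \<sigma> *
    (\<Sum>k\<in>{0, 1::real}. (if k = 0 then 1 - \<sigma> else \<sigma>) * (if k = 0 then B0 else B1))))"
  proof (rule mid_int_geometric_mean[where \<tau> = "\<lambda>k. k" and \<phi> = "\<lambda>k. \<phi>"])
    show "\<phi> x \<le> (\<Prod>k\<in>{0, 1::real}. \<phi> x powr (if k = 0 then 1 - \<sigma> else \<sigma>))" for x
      using nn[of x] by (cases "\<phi> x = 0") (auto simp flip: powr_add)
  qed (use False \<sigma> nn assms(3,4) in auto)
  then show ?thesis by simp
qed

text \<open>
  Adding \<open>c / N\<close> times a fixed function \<open>S\<close> costs at most \<open>\<delta>\<close> in the logarithm of the norm, as soon as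
  \<open>N\<close> is large. The same \<open>N0\<close> serves all \<open>\<sigma>\<close> and \<open>\<phi>\<close>; this needs the lower bound \<open>m\<close> of the given
  bounds \<open>B\<close>, below which the perturbation could dominate.
\<close>

lemma mid_int_perturb:
  assumes S[measurable]: "S \<in> borel_measurable M" "\<And>x. 0 \<le> S x"
    and SD: "\<And>\<sigma>. 0 \<le> \<sigma> \<Longrightarrow> \<sigma> \<le> 1 \<Longrightarrow> mid_int \<sigma> S \<le> ennreal (exp (mid_exp \<sigma> * D))"
    and c: "0 < c" and \<delta>: "0 < \<delta>"
  obtains N0 :: nat where
    "\<And>N \<sigma> \<phi> B. N0 \<le> N \<Longrightarrow> 0 \<le> \<sigma> \<Longrightarrow> \<sigma> \<le> 1 \<Longrightarrow> m \<le> B \<Longrightarrow> \<phi> \<in> borel_measurable M \<Longrightarrow> (\<And>x. 0 \<le> \<phi> x) \<Longrightarrow>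
       mid_int \<sigma> \<phi> \<le> ennreal (exp (mid_exp \<sigma> * B)) \<Longrightarrow>
       mid_int \<sigma> (\<lambda>x. \<phi> x + c / real N * S x) \<le> ennreal (exp (mid_exp \<sigma> * (B + \<delta>)))"
proof -
  \<comment> \<open>Half of \<open>\<delta>\<close> pays for the factor \<open>1 + t\<close> of the main term, the other half for the perturbation.\<close>
  define t where "t = exp (\<delta> / 2) - 1"
  have t: "0 < t" using \<delta> by (simp add: t_def)
  define K where "K = (1 + 1 / t) * c"
  have K: "0 < K" using t c by (simp add: K_def add_pos_pos)
  define rm where "rm = min s0 s1"
  have rm: "0 < rm" using s0 s1 by (simp add: rm_def)
  \<comment> \<open>\<open>K / N\<close> will be at most \<open>exp (m - D - X)\<close>. The perturbation is then at most \<open>exp (- rm * X)\<close> times the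
    main term, and \<open>X\<close> makes this factor at most \<open>rm * \<delta> / 2\<close>.\<close>
  define X where "X = max 0 (- ln (rm * \<delta> / 2) / rm)"
  have X0: "0 \<le> X" by (simp add: X_def)
  have "- ln (rm * \<delta> / 2) / rm \<le> X" by (simp add: X_def)
  then have "- (rm * X) \<le> ln (rm * \<delta> / 2)" using rm by (simp add: field_simps)
  then have X: "exp (- (rm * X)) \<le> rm * \<delta> / 2"
    using rm \<delta> by (simp add: ln_ge_iff)
  define N0 where "N0 = Suc (nat \<lceil>K / exp (m - D - X)\<rceil>)"
  show ?thesis
  proof (rule that[of N0])
    fix N \<sigma> \<phi> B
    assume N: "N0 \<le> N" and \<sigma>: "0 \<le> \<sigma>" "\<sigma> \<le> 1" and B: "m \<le> B"
      and [measurable]: "\<phi> \<in> borel_measurable M" and \<phi>: "\<And>x. 0 \<le> \<phi> x"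
      and int: "mid_int \<sigma> \<phi> \<le> ennreal (exp (mid_exp \<sigma> * B))"
    define r where "r = mid_exp \<sigma>"
    have r: "0 < r" "rm \<le> r" using mid_exp_pos[OF \<sigma>] mid_exp_ge[OF \<sigma>] by (auto simp: r_def rm_def)
    have N': "0 < real N" "K / exp (m - D - X) \<le> real N" using N by (auto simp: N0_def) linarith
    then have KN: "K / real N \<le> exp (m - D - X)" by (simp add: field_simps)
    have "mid_int \<sigma> (\<lambda>x. \<phi> x + c / real N * S x) \<le> ennreal ((1 + t) powr r) * mid_int \<sigma> \<phi>
        + ennreal ((1 + 1 / t) powr r) * mid_int \<sigma> (\<lambda>x. c / real N * S x)"
      unfolding r_def using S \<phi> c t \<sigma> by (intro mid_int_add) auto
    also have "mid_int \<sigma> (\<lambda>x. c / real N * S x) = ennreal ((c / real N) powr r) * mid_int \<sigma> S"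
      unfolding r_def using c S by (intro mid_int_cmult) auto
    also have "ennreal ((1 + t) powr r) * mid_int \<sigma> \<phi>
        + ennreal ((1 + 1 / t) powr r) * (ennreal ((c / real N) powr r) * mid_int \<sigma> S)
      \<le> ennreal ((1 + t) powr r) * ennreal (exp (r * B))
        + ennreal ((1 + 1 / t) powr r) * (ennreal ((c / real N) powr r) * ennreal (exp (r * D)))"
      using int SD[OF \<sigma>] by (intro add_mono mult_left_mono) (auto simp: r_def)
    also have "\<dots> = ennreal ((1 + t) powr r * exp (r * B)
        + (1 + 1 / t) powr r * ((c / real N) powr r * exp (r * D)))"
      by (simp add: ennreal_mult ennreal_plus)
    also have "\<dots> \<le> ennreal (exp (r * (B + \<delta>)))"
    proof (rule ennreal_leI)
      have e1: "(1 + t) powr r * exp (r * B) = exp (r * (B + \<delta> / 2))"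
        by (simp add: t_def exp_powr_real mult_exp_exp distrib_left)
      have "(1 + 1 / t) powr r * (c / real N) powr r = (K / real N) powr r"
        unfolding K_def using t c N' by (subst powr_mult[symmetric]) (auto intro: less_imp_le add_pos_pos)
      also have "\<dots> \<le> exp (m - D - X) powr r"
        using KN K N' r by (intro powr_mono2) auto
      finally have "(1 + 1 / t) powr r * ((c / real N) powr r * exp (r * D)) \<le> exp (r * (m - D - X)) * exp (r * D)"
        by (simp add: exp_powr_real mult.commute[of r] mult_right_mono flip: mult.assoc)
      also have "\<dots> = exp (r * m) * exp (- (r * X))"
        by (simp add: mult_exp_exp right_diff_distrib)
      also have "\<dots> \<le> exp (r * (B + \<delta> / 2)) * exp (- (rm * X))"
        using r B \<delta> X0 by (intro mult_mono) (auto intro: mult_right_mono)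
      also have "\<dots> \<le> exp (r * (B + \<delta> / 2)) * (r * \<delta> / 2)"
      proof (rule mult_left_mono)
        have "rm * \<delta> / 2 \<le> r * \<delta> / 2" using r \<delta> by (simp add: mult_right_mono)
        then show "exp (- (rm * X)) \<le> r * \<delta> / 2" using X by linarith
      qed simp
      finally have e2: "(1 + 1 / t) powr r * ((c / real N) powr r * exp (r * D))
          \<le> exp (r * (B + \<delta> / 2)) * (r * \<delta> / 2)" .
      have "exp (r * (B + \<delta> / 2)) * (1 + r * \<delta> / 2) \<le> exp (r * (B + \<delta> / 2)) * exp (r * \<delta> / 2)"
        by (intro mult_left_mono exp_ge_add_one_self) simp
      also have "\<dots> = exp (r * (B + \<delta>))"
        by (simp add: mult_exp_exp distrib_left)
      finally show "(1 + t) powr r * exp (r * B) + (1 + 1 / t) powr r * ((c / real N) powr r * exp (r * D))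
          \<le> exp (r * (B + \<delta>))"
        using e1 e2 by (simp add: distrib_left)
    qed
    finally show "mid_int \<sigma> (\<lambda>x. \<phi> x + c / real N * S x) \<le> ennreal (exp (mid_exp \<sigma> * (B + \<delta>)))"
      by (simp add: r_def)
  qed
qed

section \<open>The three lines theorem for exponential sums\<close>

lemma mid_int_coeff_sum_finite:
  assumes "\<And>l g. (l, g) \<in> set h \<Longrightarrow> g \<in> borel_measurable M \<and> mid_int \<sigma> (\<lambda>x. cmod (g x)) < top"
    and \<sigma>: "0 \<le> \<sigma>" "\<sigma> \<le> 1"
  shows "mid_int \<sigma> (coeff_sum h) < top"
  using assms(1)
proof (induction h)
  case Nil
  show ?case by (simp add: mid_int_def)
next
  case (Cons a h)
  obtain l g where a: "a = (l, g)" by force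
  have g[measurable]: "g \<in> borel_measurable M" and gf: "mid_int \<sigma> (\<lambda>x. cmod (g x)) < top"
    using Cons.prems[of l g] by (auto simp: a)
  have h[measurable]: "coeff_sum h \<in> borel_measurable M"
    by (rule coeff_sum_measurable) (use Cons.prems in auto)
  have hf: "mid_int \<sigma> (coeff_sum h) < top" using Cons by auto
  have "coeff_sum (a # h) = (\<lambda>x. cmod (g x) + coeff_sum h x)" by (simp add: a coeff_sum_Cons fun_eq_iff)
  then have "mid_int \<sigma> (coeff_sum (a # h)) \<le> ennreal ((1 + 1) powr mid_exp \<sigma>) * mid_int \<sigma> (\<lambda>x. cmod (g x))
           + ennreal ((1 + 1 / 1) powr mid_exp \<sigma>) * mid_int \<sigma> (coeff_sum h)"
    using mid_int_add[of "\<lambda>x. cmod (g x)" "coeff_sum h" 1 \<sigma>] \<sigma> by (simp add: coeff_sum_nonneg)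
  also have "\<dots> < top" using gf hf by (simp add: ennreal_mult_less_top)
  finally show ?case .
qed

text \<open>
  The endpoint bounds are assumed on the whole strip, growing at most exponentially away from their
  line; for \<open>Re z = 0\<close> and \<open>Re z = 1\<close> they read \<open>B0\<close> and \<open>B1\<close>.
  
  Write \<open>\<sigma>\<close> for \<open>Re z\<close>. The statement \<open>P \<eta> A\<close> in the proof says that the logarithm of the norm exceeds
  the affine function \<open>L\<close> by at most \<open>A + \<eta> * (1 - \<sigma>\<^sup>2)\<close>. Averaging over a circle of radius \<open>d\<close> preserves
  \<open>L\<close> and lowers the barrier \<open>\<eta> * (1 - \<sigma>\<^sup>2)\<close> by \<open>\<eta> * d\<^sup>2 / 2\<close>, so away from the edges \<open>A\<close> can be
  decreased; near the edges the a priori bound \<open>2 * C * \<sigma> * (1 - \<sigma>)\<close> is already below \<open>A\<close>. As long as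
  \<open>A\<close> stays above \<open>\<epsilon>\<close> the decrease is bounded below, so finitely many steps give \<open>P \<epsilon> \<epsilon>\<close>.
\<close>

lemma expsum_three_lines:
  assumes h: "\<And>l g. (l, g) \<in> set h \<Longrightarrow> g \<in> borel_measurable M"
    and fin: "mid_int 0 (coeff_sum h) < \<infinity>" "mid_int 1 (coeff_sum h) < \<infinity>"
    and C: "0 \<le> C"
    and bnd0: "\<And>z. z \<in> strip \<Longrightarrow> mid_int 0 (\<lambda>x. cmod (expsum h z x)) \<le> ennreal (exp (s0 * (B0 + C * Re z)))"
    and bnd1: "\<And>z. z \<in> strip \<Longrightarrow> mid_int 1 (\<lambda>x. cmod (expsum h z x)) \<le> ennreal (exp (s1 * (B1 + C * (1 - Re z))))"
    and z0: "z0 \<in> strip"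
  shows "mid_int (Re z0) (\<lambda>x. cmod (expsum h z0 x))
    \<le> ennreal (exp (mid_exp (Re z0) * ((1 - Re z0) * B0 + Re z0 * B1)))"
proof -
  define n where "n z = mid_int (Re z) (\<lambda>x. cmod (expsum h z x))" for z
  define L where "L \<sigma> = (1 - \<sigma>) * B0 + \<sigma> * B1" for \<sigma>
  note [measurable] = expsum_measurable[OF h] coeff_sum_measurable[OF h]
  have crude: "n z \<le> ennreal (exp (mid_exp (Re z) * (L (Re z) + 2 * C * Re z * (1 - Re z))))"
    if z: "z \<in> strip" for z
  proof -
    have "n z \<le> ennreal (exp (mid_exp (Re z) * ((1 - Re z) * (B0 + C * Re z) + Re z * (B1 + C * (1 - Re z)))))"
      unfolding n_def using z bnd0[OF z] bnd1[OF z] by (intro mid_int_endpoints) (auto simp: strip_def)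
    also have "(1 - Re z) * (B0 + C * Re z) + Re z * (B1 + C * (1 - Re z)) = L (Re z) + 2 * C * Re z * (1 - Re z)"
      by (simp add: L_def algebra_simps)
    finally show ?thesis .
  qed
  obtain D where D: "\<And>\<sigma>. 0 \<le> \<sigma> \<Longrightarrow> \<sigma> \<le> 1 \<Longrightarrow> mid_int \<sigma> (coeff_sum h) \<le> ennreal (exp (mid_exp \<sigma> * D))"
  proof -
    have *: "\<exists>d. y \<le> ennreal (exp (s * d))" if "y < \<infinity>" "0 < s" for y s
    proof -
      obtain t where t: "0 \<le> t" "y = ennreal t" using \<open>y < \<infinity>\<close> by (cases y) auto
      have "t \<le> exp (s * (t / s))" using \<open>0 < s\<close> exp_ge_add_one_self[of t] by (simp del: exp_ge_add_one_self)
      then show ?thesis using t by (auto intro!: exI[of _ "t / s"] ennreal_leI)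
    qed
    obtain d0 d1 where d: "mid_int 0 (coeff_sum h) \<le> ennreal (exp (s0 * d0))"
      "mid_int 1 (coeff_sum h) \<le> ennreal (exp (s1 * d1))"
      using *[OF fin(1) s0] *[OF fin(2) s1] by blast
    show ?thesis
    proof (rule that[of "max d0 d1"])
      fix \<sigma> :: real assume \<sigma>: "0 \<le> \<sigma>" "\<sigma> \<le> 1"
      have "mid_int \<sigma> (coeff_sum h) \<le> ennreal (exp (mid_exp \<sigma> * ((1 - \<sigma>) * d0 + \<sigma> * d1)))"
        using d \<sigma> by (intro mid_int_endpoints) (auto simp: coeff_sum_nonneg)
      also have "\<dots> \<le> ennreal (exp (mid_exp \<sigma> * max d0 d1))"
      proof -
        have "(1 - \<sigma>) * d0 + \<sigma> * d1 \<le> (1 - \<sigma>) * max d0 d1 + \<sigma> * max d0 d1"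
          using \<sigma> by (intro add_mono mult_left_mono) auto
        also have "\<dots> = max d0 d1" by (simp add: algebra_simps)
        finally show ?thesis using mid_exp_pos[OF \<sigma>] by (intro ennreal_leI) (simp add: mult_left_mono)
      qed
      finally show "mid_int \<sigma> (coeff_sum h) \<le> ennreal (exp (mid_exp \<sigma> * max d0 d1))" .
    qed
  qed
  obtain c where c: "0 < c" and submean: "\<And>z d N x. 0 < N \<Longrightarrow> 0 \<le> d \<Longrightarrow> 0 \<le> Re z - d \<Longrightarrow> Re z + d \<le> 1 \<Longrightarrow>
       cmod (expsum h z x) ^ N
         \<le> (\<Prod>k<N. cmod (expsum h (z + of_real d * nroot N k) x) + c / real N * coeff_sum h x)"
    using expsum_submean[of h] by blast
  define P where "P \<eta> A \<longleftrightarrow> (\<forall>z\<in>strip. n z \<le> ennreal (exp (mid_exp (Re z) * (L (Re z) + A + \<eta> * (1 - (Re z)\<^sup>2)))))"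
    for \<eta> A
  have P_mono: "P \<eta> A'" if "P \<eta> A" "A \<le> A'" for \<eta> A A'
    unfolding P_def
  proof
    fix z assume z: "z \<in> strip"
    have "n z \<le> ennreal (exp (mid_exp (Re z) * (L (Re z) + A + \<eta> * (1 - (Re z)\<^sup>2))))"
      using that z by (auto simp: P_def)
    also have "\<dots> \<le> ennreal (exp (mid_exp (Re z) * (L (Re z) + A' + \<eta> * (1 - (Re z)\<^sup>2))))"
      using mid_exp_pos[of "Re z"] z \<open>A \<le> A'\<close> by (intro ennreal_leI) (auto simp: strip_def mult_left_mono)
    finally show "n z \<le> ennreal (exp (mid_exp (Re z) * (L (Re z) + A' + \<eta> * (1 - (Re z)\<^sup>2))))" .
  qed
  have improve: "P \<eta> (A - \<eta> * d\<^sup>2 / 4)"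
    if P: "P \<eta> A" and \<eta>: "0 < \<eta>" and d: "0 < d" and bdry: "\<eta> * d\<^sup>2 / 4 + 2 * C * d \<le> A" for \<eta> A d
    unfolding P_def
  proof
    fix z assume z: "z \<in> strip"
    define \<sigma> where "\<sigma> = Re z"
    have \<sigma>: "0 \<le> \<sigma>" "\<sigma> \<le> 1" using z by (auto simp: \<sigma>_def strip_def)
    have \<sigma>2: "\<sigma>\<^sup>2 \<le> 1" using \<sigma> by (simp add: power_le_one)
    have "n z \<le> ennreal (exp (mid_exp \<sigma> * (L \<sigma> + (A - \<eta> * d\<^sup>2 / 4) + \<eta> * (1 - \<sigma>\<^sup>2))))"
    proof (cases "d \<le> \<sigma> \<and> \<sigma> \<le> 1 - d")
      case False
      have "2 * C * (\<sigma> * (1 - \<sigma>)) \<le> 2 * C * d"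
      proof (rule mult_left_mono)
        have "\<sigma> * (1 - \<sigma>) \<le> \<sigma> * 1" "\<sigma> * (1 - \<sigma>) \<le> 1 * (1 - \<sigma>)"
          using \<sigma> by (intro mult_left_mono mult_right_mono; simp)+
        then show "\<sigma> * (1 - \<sigma>) \<le> d" using False by auto
      qed (use C in simp)
      moreover have "0 \<le> \<eta> * (1 - \<sigma>\<^sup>2)" using \<eta> \<sigma>2 by simp
      ultimately have "2 * C * \<sigma> * (1 - \<sigma>) \<le> (A - \<eta> * d\<^sup>2 / 4) + \<eta> * (1 - \<sigma>\<^sup>2)"
        using bdry by (simp add: mult.assoc)
      then show ?thesis
        using crude[OF z] mid_exp_pos[OF \<sigma>]
        by (auto elim!: order_trans intro!: ennreal_leI mult_left_mono simp: \<sigma>_def)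
    next
      case True
      \<comment> \<open>A lower bound on \<open>[0, 1]\<close> of the function that bounds the logarithm of the norm.\<close>
      define m where "m = - \<bar>B0\<bar> - \<bar>B1\<bar> + A"
      have m: "m \<le> L \<tau> + A + \<eta> * (1 - \<tau>\<^sup>2)" if "0 \<le> \<tau>" "\<tau> \<le> 1" for \<tau>
      proof -
        have "\<bar>(1 - \<tau>) * B0\<bar> \<le> 1 * \<bar>B0\<bar>" "\<bar>\<tau> * B1\<bar> \<le> 1 * \<bar>B1\<bar>"
          unfolding abs_mult using that by (intro mult_right_mono; simp)+
        moreover have "0 \<le> \<eta> * (1 - \<tau>\<^sup>2)" using \<eta> that by (simp add: power_le_one)
        ultimately show ?thesis unfolding m_def L_def by linarith
      qed
      \<comment> \<open>Half of the gain \<open>\<eta> * d\<^sup>2 / 2\<close> of the barrier absorbs the error of the sub-mean value inequality.\<close>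
      define \<delta> where "\<delta> = \<eta> * d\<^sup>2 / 4"
      have \<delta>: "0 < \<delta>" using \<eta> d by (simp add: \<delta>_def)
      obtain N0 where N0: "\<And>N \<sigma> \<phi> B. N0 \<le> N \<Longrightarrow> 0 \<le> \<sigma> \<Longrightarrow> \<sigma> \<le> 1 \<Longrightarrow> m \<le> B \<Longrightarrow> \<phi> \<in> borel_measurable M \<Longrightarrow> (\<And>x. 0 \<le> \<phi> x) \<Longrightarrow>
         mid_int \<sigma> \<phi> \<le> ennreal (exp (mid_exp \<sigma> * B)) \<Longrightarrow>
         mid_int \<sigma> (\<lambda>x. \<phi> x + c / real N * coeff_sum h x) \<le> ennreal (exp (mid_exp \<sigma> * (B + \<delta>)))"
        using mid_int_perturb[of "coeff_sum h" D c \<delta> m] D c \<delta> by (auto simp: coeff_sum_nonneg)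
      \<comment> \<open>\<open>N \<ge> 3\<close> makes the first and second moments of the sampling points exact.\<close>
      define N where "N = max N0 3"
      have N: "N0 \<le> N" "3 \<le> N" by (auto simp: N_def)
      define w where "w k = z + of_real d * nroot N k" for k
      have Re_w: "Re (w k) = \<sigma> + d * Re (nroot N k)" for k by (simp add: w_def \<sigma>_def)
      have w: "0 \<le> Re (w k)" "Re (w k) \<le> 1" "w k \<in> strip" for k
      proof -
        have "\<bar>d * Re (nroot N k)\<bar> \<le> d * 1"
          unfolding abs_mult using d abs_Re_le_cmod[of "nroot N k"] by (intro mult_mono) auto
        then show "0 \<le> Re (w k)" "Re (w k) \<le> 1" using True by (auto simp: Re_w)
        then show "w k \<in> strip" by (simp add: strip_def)
      qed
      define \<phi> where "\<phi> k x = cmod (expsum h (w k) x) + c / real N * coeff_sum h x" for k x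
      have \<phi>_nn: "0 \<le> \<phi> k x" for k x using c by (simp add: \<phi>_def coeff_sum_nonneg)
      define B where "B k = L (Re (w k)) + A + \<eta> * (1 - (Re (w k))\<^sup>2) + \<delta>" for k
      have "mid_int \<sigma> (\<lambda>x. cmod (expsum h z x)) \<le> ennreal (exp (mid_exp \<sigma> * (\<Sum>k<N. 1 / real N * B k)))"
      proof (rule mid_int_geometric_mean[where \<tau> = "\<lambda>k. Re (w k)" and \<phi> = \<phi>])
        show "\<sigma> = (\<Sum>k<N. 1 / real N * Re (w k))"
          using sum_Re_nroot[of N] N
          by (simp add: Re_w sum.distrib flip: sum_divide_distrib sum_distrib_left)
        show "\<phi> k \<in> borel_measurable M" for k unfolding \<phi>_def[abs_def] by measurable
        show "cmod (expsum h z x) \<le> (\<Prod>k<N. \<phi> k x powr (1 / real N))" for x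
        proof -
          have "cmod (expsum h z x) = (cmod (expsum h z x) powr real N) powr (1 / real N)"
            using N by (simp add: powr_powr)
          also have "cmod (expsum h z x) powr real N = cmod (expsum h z x) ^ N"
            using N by (cases "cmod (expsum h z x) = 0") (auto simp: powr_realpow)
          also have "(cmod (expsum h z x) ^ N) powr (1 / real N) \<le> (\<Prod>k<N. \<phi> k x) powr (1 / real N)"
            using submean[of N d z x] N True d
            by (intro powr_mono2) (auto simp: \<phi>_def w_def \<sigma>_def)
          also have "\<dots> = (\<Prod>k<N. \<phi> k x powr (1 / real N))"
            by (simp add: prod_powr_distrib)
          finally show ?thesis .
        qed
        show "mid_int (Re (w k)) (\<phi> k) \<le> ennreal (exp (mid_exp (Re (w k)) * B k))" for k
          unfolding \<phi>_def B_def
          using N w[of k] m[of "Re (w k)"] P by (intro N0) (auto simp: P_def n_def)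
      qed (use N w \<phi>_nn in auto)
      also have "(\<Sum>k<N. 1 / real N * B k) = L \<sigma> + (A - \<eta> * d\<^sup>2 / 4) + \<eta> * (1 - \<sigma>\<^sup>2)"
      proof -
        have B: "B k = (L \<sigma> + A + \<eta> * (1 - \<sigma>\<^sup>2) + \<delta>) + (B1 - B0 - 2 * \<eta> * \<sigma>) * d * Re (nroot N k)
            - \<eta> * d\<^sup>2 * (Re (nroot N k))\<^sup>2" for k
          by (simp add: B_def Re_w L_def algebra_simps power2_eq_square)
        have "(\<Sum>k<N. B k) = real N * (L \<sigma> + A + \<eta> * (1 - \<sigma>\<^sup>2) + \<delta>) - \<eta> * d\<^sup>2 * (real N / 2)"
          unfolding B sum_subtractf sum.distrib sum_distrib_left[symmetric]
          using N by (simp add: sum_Re_nroot sum_Re_nroot_squared algebra_simps)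
        then have "(\<Sum>k<N. 1 / real N * B k) = (real N * (L \<sigma> + A + \<eta> * (1 - \<sigma>\<^sup>2) + \<delta>) - \<eta> * d\<^sup>2 * (real N / 2)) / real N"
          by (simp flip: sum_divide_distrib)
        also have "\<dots> = L \<sigma> + A + \<eta> * (1 - \<sigma>\<^sup>2) + \<delta> - \<eta> * d\<^sup>2 / 2"
          using N by (simp add: diff_divide_distrib)
        finally show ?thesis by (simp add: \<delta>_def)
      qed
      finally show ?thesis by (simp add: n_def \<sigma>_def)
    qed
    then show "n z \<le> ennreal (exp (mid_exp (Re z) * (L (Re z) + (A - \<eta> * d\<^sup>2 / 4) + \<eta> * (1 - (Re z)\<^sup>2))))"
      by (simp add: \<sigma>_def)
  qed
  have P_all: "P \<epsilon> \<epsilon>" if \<epsilon>: "0 < \<epsilon>" for \<epsilon>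
  proof -
    \<comment> \<open>The boundary zone of width \<open>d\<close> is chosen so that \<open>2 * C * d \<le> \<epsilon> / 2\<close>.\<close>
    define d where "d = min 1 (\<epsilon> / (4 * C + 1))"
    have d: "0 < d" "d \<le> 1" using \<epsilon> C by (auto simp: d_def)
    have "d \<le> \<epsilon> / (4 * C + 1)" by (simp add: d_def)
    then have "d * (4 * C + 1) \<le> \<epsilon>"
      using C by (subst (asm) pos_le_divide_eq) auto
    then have dC: "4 * C * d \<le> \<epsilon>" using d by (simp add: algebra_simps)
    define g where "g = \<epsilon> * d\<^sup>2 / 4"
    have g: "0 < g" using \<epsilon> d by (simp add: g_def)
    have "\<epsilon> * d\<^sup>2 \<le> \<epsilon> * 1" using d \<epsilon> by (intro mult_left_mono power_le_one) auto
    then have gd: "g + 2 * C * d \<le> \<epsilon>" using dC \<epsilon> unfolding g_def by linarith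
    have iter: "P \<epsilon> (max \<epsilon> (2 * C - real k * g))" for k
    proof (induction k)
      case 0
      have "P \<epsilon> (2 * C)"
        unfolding P_def
      proof
        fix z assume z: "z \<in> strip"
        have \<sigma>: "0 \<le> Re z" "Re z \<le> 1" using z by (auto simp: strip_def)
        have "2 * C * (Re z * (1 - Re z)) \<le> 2 * C * 1"
          using \<sigma> C by (intro mult_left_mono) (auto simp: mult_le_one)
        moreover have "0 \<le> \<epsilon> * (1 - (Re z)\<^sup>2)" using \<epsilon> \<sigma> by (simp add: power_le_one)
        ultimately have "2 * C * Re z * (1 - Re z) \<le> 2 * C + \<epsilon> * (1 - (Re z)\<^sup>2)"
          by (simp add: mult.assoc)
        then show "n z \<le> ennreal (exp (mid_exp (Re z) * (L (Re z) + 2 * C + \<epsilon> * (1 - (Re z)\<^sup>2))))"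
          using crude[OF z] mid_exp_pos[OF \<sigma>]
          by (auto elim!: order_trans intro!: ennreal_leI mult_left_mono)
      qed
      then show ?case by (rule P_mono) simp
    next
      case (Suc k)
      have "P \<epsilon> (max \<epsilon> (2 * C - real k * g) - g)"
        unfolding g_def by (rule improve[OF Suc[unfolded g_def] \<epsilon> d(1)]) (use gd in \<open>simp add: g_def\<close>)
      then show ?case by (rule P_mono) (use g in \<open>auto simp: max_def algebra_simps\<close>)
    qed
    obtain k :: nat where "2 * C / g < real k" using reals_Archimedean2 by blast
    then have "2 * C - real k * g \<le> \<epsilon>" using g \<epsilon> by (simp add: field_simps)
    then show ?thesis using iter[of k] by (simp add: max_absorb1)
  qed
  define \<sigma> where "\<sigma> = Re z0"
  have \<sigma>: "0 \<le> \<sigma>" "\<sigma> \<le> 1" using z0 by (auto simp: \<sigma>_def strip_def)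
  have "((\<lambda>\<epsilon>. ennreal (exp (mid_exp \<sigma> * (L \<sigma> + \<epsilon> + \<epsilon> * (1 - \<sigma>\<^sup>2))))) \<longlongrightarrow>
    ennreal (exp (mid_exp \<sigma> * (L \<sigma> + 0 + 0 * (1 - \<sigma>\<^sup>2))))) (at_right 0)"
    by (intro tendsto_intros)
  moreover have "\<forall>\<^sub>F \<epsilon> in at_right 0. n z0 \<le> ennreal (exp (mid_exp \<sigma> * (L \<sigma> + \<epsilon> + \<epsilon> * (1 - \<sigma>\<^sup>2))))"
    using P_all z0 by (auto simp: P_def \<sigma>_def eventually_at_right_less intro!: eventually_at_rightI[of 0 1])
  ultimately have "n z0 \<le> ennreal (exp (mid_exp \<sigma> * (L \<sigma> + 0 + 0 * (1 - \<sigma>\<^sup>2))))"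
    by (rule tendsto_lowerbound) simp
  then show ?thesis by (simp add: n_def \<sigma>_def L_def)
qed

end

section \<open>Powers and norms with values in the extended half-line\<close>

lemma ennpow_ennreal: "0 \<le> x \<Longrightarrow> ennpow (ennreal x) a = ennreal (x powr a)"
  by (simp add: ennpow_def)

lemma ennpow_top [simp]: "ennpow top a = top"
  by (simp add: ennpow_def)

lemma ennpow_measurable [measurable]:
  "g \<in> borel_measurable M \<Longrightarrow> (\<lambda>x. ennpow (g x) a) \<in> borel_measurable M"
  unfolding ennpow_def infinity_ennreal_def
proof (rule measurable_If)
  assume [measurable]: "g \<in> borel_measurable M"
  have "g -` {top} \<inter> space M \<in> sets M" by (rule measurable_sets[where A = borel]) auto
  then show "{x \<in> space M. g x = top} \<in> sets M" by (simp add: vimage_def Int_def conj_commute)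
  show "(\<lambda>x. ennreal (enn2real (g x) powr a)) \<in> borel_measurable M" by measurable
qed simp

lemma ennpow_eq_0_iff [simp]: "ennpow x a = 0 \<longleftrightarrow> x = 0"
  by (cases x) (auto simp: ennpow_ennreal)

lemma ennpow_0 [simp]: "ennpow 0 a = 0"
  by simp

lemma ennpow_less_top_iff [simp]: "ennpow x a < top \<longleftrightarrow> x < top"
  by (cases x) (auto simp: ennpow_ennreal)

lemma ennpow_mono: "0 \<le> a \<Longrightarrow> x \<le> y \<Longrightarrow> ennpow x a \<le> ennpow y a"
  by (cases x; cases y) (auto simp: ennpow_ennreal top_unique intro!: ennreal_leI powr_mono2)

lemma ennpow_mult: "ennpow (x * y) a = ennpow x a * ennpow y a"
  by (cases x; cases y)
    (auto simp: ennpow_ennreal powr_mult ennreal_top_mult ennreal_mult_top simp flip: ennreal_mult'')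

lemma ennpow_ennpow: "ennpow (ennpow x a) b = ennpow x (a * b)"
  by (cases x) (auto simp: ennpow_ennreal powr_powr)

lemma ennpow_1 [simp]: "ennpow x 1 = x"
  by (cases x) (auto simp: ennpow_ennreal)

text \<open>
  Turns a bound for a norm into a bound for the integral without the outer root.
\<close>

lemma ennpow_inverse_le_iff:
  assumes "0 < a" shows "ennpow x (1 / a) \<le> K \<longleftrightarrow> x \<le> ennpow K a"
proof
  assume "ennpow x (1 / a) \<le> K"
  then have "ennpow (ennpow x (1 / a)) a \<le> ennpow K a" using assms by (intro ennpow_mono) auto
  then show "x \<le> ennpow K a" using assms by (simp add: ennpow_ennpow)
next
  assume "x \<le> ennpow K a"
  then have "ennpow x (1 / a) \<le> ennpow (ennpow K a) (1 / a)" using assms by (intro ennpow_mono) auto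
  then show "ennpow x (1 / a) \<le> K" using assms by (simp add: ennpow_ennpow)
qed

lemma Lp_norm_le_iff_integral:
  assumes "0 < p" "p < top"
  shows "Lp_norm p M g \<le> K \<longleftrightarrow> (\<integral>\<^sup>+x. ennpow (g x) (enn2real p) \<partial>M) \<le> ennpow K (enn2real p)"
proof -
  have "0 < enn2real p" using assms by (simp add: enn2real_positive_iff)
  then show ?thesis using assms by (auto simp: Lp_norm_def ennpow_inverse_le_iff)
qed

lemma Lp_norm_infinity_le_iff:
  assumes [measurable]: "g \<in> borel_measurable M"
  shows "Lp_norm top M g \<le> K \<longleftrightarrow> (AE x in M. g x \<le> K)"
proof
  assume "Lp_norm top M g \<le> K"
  moreover have "AE x in M. g x \<le> esssup M g" by (rule esssup_AE)
  ultimately show "AE x in M. g x \<le> K" by (auto simp: Lp_norm_def)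
next
  assume "AE x in M. g x \<le> K"
  then show "Lp_norm top M g \<le> K" by (simp add: Lp_norm_def esssup_I)
qed

lemma Lp_norm_mono_AE:
  assumes [measurable]: "g \<in> borel_measurable M" "h \<in> borel_measurable M"
    and p: "0 < p" and le: "AE x in M. g x \<le> h x"
  shows "Lp_norm p M g \<le> Lp_norm p M h"
proof (cases "p = top")
  case True
  have "AE x in M. h x \<le> Lp_norm top M h" using Lp_norm_infinity_le_iff[of h M "Lp_norm top M h"] by simp
  then show ?thesis unfolding True using le by (subst Lp_norm_infinity_le_iff) auto
next
  case False
  then have "p < top" by (simp add: less_top)
  moreover have "(\<integral>\<^sup>+x. ennpow (g x) (enn2real p) \<partial>M) \<le> (\<integral>\<^sup>+x. ennpow (h x) (enn2real p) \<partial>M)"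
    using le by (intro nn_integral_mono_AE) (auto elim!: eventually_mono intro: ennpow_mono)
  ultimately show ?thesis
    using Lp_norm_le_iff_integral[OF p, of M h "Lp_norm p M h"] p
    by (simp add: Lp_norm_le_iff_integral)
qed

lemma Lp_norm_cmult_le:
  assumes [measurable]: "g \<in> borel_measurable M" and p: "0 < p"
  shows "Lp_norm p M (\<lambda>x. c * g x) \<le> c * Lp_norm p M g"
proof (cases "p = top")
  case True
  have "AE x in M. g x \<le> Lp_norm top M g" using Lp_norm_infinity_le_iff[of g M "Lp_norm top M g"] by simp
  then show ?thesis unfolding True by (subst Lp_norm_infinity_le_iff) (auto elim!: eventually_mono intro: mult_left_mono)
next
  case False
  then have p': "p < top" by (simp add: less_top)
  have "(\<integral>\<^sup>+x. ennpow (g x) (enn2real p) \<partial>M) \<le> ennpow (Lp_norm p M g) (enn2real p)"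
    using Lp_norm_le_iff_integral[OF p p', of M g "Lp_norm p M g"] by simp
  then show ?thesis
    unfolding Lp_norm_le_iff_integral[OF p p'] ennpow_mult
    by (subst nn_integral_cmult) (auto intro: mult_left_mono)
qed

lemma Lp_norm_eq_0_iff:
  assumes [measurable]: "g \<in> borel_measurable M" and p: "0 < p"
  shows "Lp_norm p M g = 0 \<longleftrightarrow> (AE x in M. g x = 0)"
proof (cases "p = top")
  case True
  then show ?thesis using Lp_norm_infinity_le_iff[of g M 0] by simp
next
  case False
  then have p': "p < top" by (simp add: less_top)
  have "Lp_norm p M g = 0 \<longleftrightarrow> (\<integral>\<^sup>+x. ennpow (g x) (enn2real p) \<partial>M) = 0"
    using False by (simp add: Lp_norm_def)
  also have "\<dots> \<longleftrightarrow> (AE x in M. g x = 0)" by (simp add: nn_integral_0_iff_AE)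
  finally show ?thesis .
qed

lemma wLp_norm_mono:
  assumes [measurable]: "f \<in> borel_measurable M" "g \<in> borel_measurable M" "w \<in> borel_measurable M"
    and "0 < p" "\<And>x. cmod (f x) \<le> cmod (g x)"
  shows "wLp_norm p M w f \<le> wLp_norm p M w g"
  unfolding wLp_norm_def using assms(4,5)
  by (intro Lp_norm_mono_AE) (auto intro!: mult_right_mono ennreal_leI)

lemma ennreal_cmult_prod:
  fixes X :: "'i \<Rightarrow> real"
  assumes "0 \<le> M" "\<And>i. i \<in> I \<Longrightarrow> 0 \<le> X i"
  shows "ennreal M * (\<Prod>i\<in>I. ennreal (X i)) = ennreal (M * (\<Prod>i\<in>I. X i))"
  using assms by (simp add: prod_ennreal ennreal_mult prod_nonneg)

section \<open>Extremal analytic families\<close>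

text \<open>
  If \<open>y\<close> lies in the unit ball of \<open>L\<^bsup>r\<^esup>\<close>, then \<open>y\<close> to the power \<open>r / p\<close> lies in that of \<open>L\<^bsup>p\<^esup>\<close>. The
  exponent \<open>\<kappa>\<close> is the version of \<open>r / p\<close> that covers infinite exponents: it is \<open>0\<close> if only \<open>p\<close> is
  infinite, and \<open>1\<close> if both are. As \<open>0 powr 0 = 0\<close>, a function dominated this way vanishes where \<open>y\<close> does.
\<close>

lemma Lp_norm_powr_le:
  fixes y :: "'a \<Rightarrow> real"
  assumes [measurable]: "y \<in> borel_measurable M" "g \<in> borel_measurable M"
    and y: "\<And>x. 0 \<le> y x" and p: "0 < p" and r: "0 < r" and pr: "r = top \<Longrightarrow> p = top"
    and norm: "Lp_norm r M (\<lambda>x. ennreal (y x)) \<le> 1" and C: "0 \<le> C"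
    and \<kappa>: "\<kappa> = (if r = top then 1 else enn2real r * enn2real (1 / p))"
    and le: "\<And>x. x \<in> space M \<Longrightarrow> g x \<le> ennreal (C * y x powr \<kappa>)"
  shows "Lp_norm p M g \<le> ennreal C"
proof (cases "p = top")
  case True
  have "AE x in M. y x powr \<kappa> \<le> 1"
  proof (cases "r = top")
    case True
    then have "AE x in M. ennreal (y x) \<le> 1" using norm by (simp add: Lp_norm_infinity_le_iff del: ennreal_le_1)
    then show ?thesis using y \<kappa> True by (auto elim!: eventually_mono)
  next
    case False
    then have "\<kappa> = 0" using \<kappa> \<open>p = top\<close> by simp
    then show ?thesis by auto
  qed
  then have "AE x in M. g x \<le> ennreal C"
  proof (rule AE_mp[OF _ AE_I2])
    fix x assume "x \<in> space M"
    show "y x powr \<kappa> \<le> 1 \<longrightarrow> g x \<le> ennreal C"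
      using le[OF \<open>x \<in> space M\<close>] C by (auto elim!: order_trans intro!: ennreal_leI mult_left_le)
  qed
  then show ?thesis unfolding True by (subst Lp_norm_infinity_le_iff) auto
next
  case False
  then have p': "p < top" and r': "r < top" using pr by (auto simp: less_top[symmetric])
  have pos: "0 < enn2real p" "0 < enn2real r" using p p' r r' by (auto simp: enn2real_positive_iff)
  have inv: "enn2real (1 / p) = 1 / enn2real p"
    using p p' by (cases p) (auto simp: divide_ennreal ennreal_1[symmetric] simp del: ennreal_1)
  have \<kappa>': "\<kappa> * enn2real p = enn2real r" using \<kappa> r' pos inv by auto
  have int: "(\<integral>\<^sup>+x. ennreal (y x powr enn2real r) \<partial>M) \<le> 1"
    using norm y unfolding Lp_norm_le_iff_integral[OF r r']
    by (simp add: ennpow_ennreal ennreal_1[symmetric] del: ennreal_1)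
  have "(\<integral>\<^sup>+x. ennpow (g x) (enn2real p) \<partial>M)
      \<le> (\<integral>\<^sup>+x. ennreal (C powr enn2real p) * ennreal (y x powr enn2real r) \<partial>M)"
  proof (rule nn_integral_mono)
    fix x assume x: "x \<in> space M"
    have "ennpow (g x) (enn2real p) \<le> ennpow (ennreal (C * y x powr \<kappa>)) (enn2real p)"
      using le[OF x] by (intro ennpow_mono) auto
    also have "\<dots> = ennreal (C powr enn2real p * y x powr enn2real r)"
      using C y by (simp add: ennpow_ennreal powr_mult powr_powr \<kappa>')
    finally show "ennpow (g x) (enn2real p) \<le> ennreal (C powr enn2real p) * ennreal (y x powr enn2real r)"
      by (simp add: ennreal_mult)
  qed
  also have "\<dots> = ennreal (C powr enn2real p) * (\<integral>\<^sup>+x. ennreal (y x powr enn2real r) \<partial>M)"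
    by (simp add: nn_integral_cmult)
  also have "\<dots> \<le> ennreal (C powr enn2real p) * 1"
    using int by (intro mult_left_mono) auto
  finally show ?thesis
    using C by (simp add: Lp_norm_le_iff_integral[OF p p'] ennpow_ennreal)
qed

text \<open>
  The modulus \<open>\<bar>f\<bar> * w\<close> is bounded above and away from zero on the set where \<open>f\<close> does not vanish.
\<close>

definition log_bounded :: "'a measure \<Rightarrow> ('a \<Rightarrow> ennreal) \<Rightarrow> ('a \<Rightarrow> complex) \<Rightarrow> bool" where
  "log_bounded M w f \<longleftrightarrow> (\<exists>n\<ge>1. \<forall>x\<in>space M. f x \<noteq> 0 \<longrightarrow>
     ennreal (1 / n) \<le> ennreal (cmod (f x)) * w x \<and> ennreal (cmod (f x)) * w x \<le> ennreal n)"

lemma log_boundedE: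
  assumes "log_bounded M w f"
  obtains k where "0 \<le> k"
    "\<And>x. x \<in> space M \<Longrightarrow> f x \<noteq> 0 \<Longrightarrow> 0 < cmod (f x) * enn2real (w x)
       \<and> \<bar>ln (cmod (f x) * enn2real (w x))\<bar> \<le> k"
    "\<And>x. x \<in> space M \<Longrightarrow> f x \<noteq> 0 \<Longrightarrow> w x = ennreal (enn2real (w x))"
proof -
  obtain n where n: "1 \<le> n" and *: "\<And>x. x \<in> space M \<Longrightarrow> f x \<noteq> 0 \<Longrightarrow>
     ennreal (1 / n) \<le> ennreal (cmod (f x)) * w x \<and> ennreal (cmod (f x)) * w x \<le> ennreal n"
    using assms by (auto simp: log_bounded_def)
  have fin: "w x = ennreal (enn2real (w x))" if "x \<in> space M" "f x \<noteq> 0" for x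
  proof -
    have "w x \<noteq> top" using *[OF that] that by (auto simp: ennreal_mult_top top_unique)
    then show ?thesis by (simp add: less_top)
  qed
  have b: "1 / n \<le> cmod (f x) * enn2real (w x) \<and> cmod (f x) * enn2real (w x) \<le> n"
    if x: "x \<in> space M" "f x \<noteq> 0" for x
  proof -
    have "ennreal (cmod (f x)) * w x = ennreal (cmod (f x) * enn2real (w x))"
      by (subst fin[OF x]) (simp add: ennreal_mult)
    then show ?thesis using *[OF x] n by simp
  qed
  show ?thesis
  proof (rule that[of "ln n"])
    show "0 \<le> ln n" using n by simp
    fix x assume x: "x \<in> space M" "f x \<noteq> 0"
    show "w x = ennreal (enn2real (w x))" by (rule fin[OF x])
    have pos: "0 < cmod (f x) * enn2real (w x)"
      using b[OF x] n by (auto intro: less_le_trans[of 0 "1 / n"])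
    have "ln (1 / n) \<le> ln (cmod (f x) * enn2real (w x))" "ln (cmod (f x) * enn2real (w x)) \<le> ln n"
      using b[OF x] pos n by (subst ln_le_cancel_iff; simp)+
    moreover have "ln (1 / n) = - ln n" using n by (simp add: ln_div)
    ultimately have "\<bar>ln (cmod (f x) * enn2real (w x))\<bar> \<le> ln n" by linarith
    then show "0 < cmod (f x) * enn2real (w x) \<and> \<bar>ln (cmod (f x) * enn2real (w x))\<bar> \<le> ln n"
      using pos by blast
  qed
qed

lemma log_bounded_pointwise:
  assumes "log_bounded M w f" "x \<in> space M" "f x \<noteq> 0"
  shows "0 < cmod (f x) * enn2real (w x)" "w x = ennreal (enn2real (w x))"
  using log_boundedE[OF assms(1)] assms(2,3) by meson+

text \<open>
  Splitting \<open>\<bar>f\<bar> = \<bar>f\<bar> powr (1 - \<theta>) * \<bar>f\<bar> powr \<theta>\<close> between the two weights.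
\<close>

lemma interpolated_modulus:
  assumes u: "\<And>x. x \<in> space M \<Longrightarrow> u x = ennpow (w x) (1 - \<theta>) * ennpow (v x) \<theta>"
    and fin: "f x \<noteq> 0 \<Longrightarrow> w x = ennreal (enn2real (w x))" "f x \<noteq> 0 \<Longrightarrow> v x = ennreal (enn2real (v x))"
    and x: "x \<in> space M"
  shows "ennreal (cmod (f x)) * u x = ennreal ((cmod (f x) * enn2real (w x)) powr (1 - \<theta>)
           * (cmod (f x) * enn2real (v x)) powr \<theta>)"
proof (cases "f x = 0")
  case False
  have "u x = ennreal (enn2real (w x) powr (1 - \<theta>) * enn2real (v x) powr \<theta>)"
    unfolding u[OF x] using fin[OF False] by (metis ennpow_ennreal enn2real_nonneg ennreal_mult powr_ge_zero)
  moreover have "cmod (f x) = cmod (f x) powr (1 - \<theta>) * cmod (f x) powr \<theta>"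
    using False by (simp flip: powr_add)
  ultimately show ?thesis
    by (simp add: powr_mult mult_ac flip: ennreal_mult)
qed simp

text \<open>
  With \<open>W = \<bar>f\<bar> * w\<close>, \<open>V = \<bar>f\<bar> * v\<close> and \<open>y = \<bar>f\<bar> * u / R\<close>, a function of norm \<open>1\<close> in \<open>L\<^bsup>r\<^esup>\<close>, the ideal
  frequency \<open>Ls\<close> is determined by
  \<open>W * exp (- \<theta> * Ls) = R * y powr (r / p)\<close> and \<open>V * exp ((1 - \<theta>) * Ls) = R * y powr (r / q)\<close>: the family then
  has the norm \<open>R\<close> in both endpoint spaces. The two equations are compatible since \<open>R * y\<close> is the
  geometric mean of \<open>W\<close> and \<open>V\<close> with weights \<open>1 - \<theta>\<close> and \<open>\<theta>\<close>, and \<open>1 / r\<close> the corresponding mean of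
  \<open>1 / p\<close> and \<open>1 / q\<close>. Rounding \<open>Ls\<close> down to a
  multiple of \<open>\<epsilon>\<close> leaves finitely many values, since \<open>Ls\<close> is bounded, and changes the norms by a factor
  of at most \<open>exp \<epsilon>\<close>. Off the two boundary lines the norms grow at the rate of a bound \<open>\<Lambda>\<close> of the
  frequency.
\<close>

lemma extremal_frequency:
  fixes f :: "'a \<Rightarrow> complex"
  assumes [measurable]: "f \<in> borel_measurable M" "w \<in> borel_measurable M" "v \<in> borel_measurable M"
    and good: "log_bounded M w f" "log_bounded M v f"
    and p: "0 < p" and q: "0 < q" and r: "0 < r" and \<theta>: "0 < \<theta>" "\<theta> < 1"
    and pqr: "enn2real (1 / r) = (1 - \<theta>) * enn2real (1 / p) + \<theta> * enn2real (1 / q)"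
    and r_top: "r = top \<Longrightarrow> p = top \<and> q = top"
    and u: "\<And>x. x \<in> space M \<Longrightarrow> u x = ennpow (w x) (1 - \<theta>) * ennpow (v x) \<theta>"
    and R: "wLp_norm r M u f = ennreal R" "0 < R" and \<epsilon>: "0 < \<epsilon>"
  obtains L :: "'a \<Rightarrow> real" and \<Lambda> :: real where
    "L \<in> borel_measurable M" "finite (range L)" "0 \<le> \<Lambda>"
    "\<And>z. z \<in> strip \<Longrightarrow> wLp_norm p M w (\<lambda>x. f x * exp (of_real (L x) * (z - of_real \<theta>)))
       \<le> ennreal (exp (\<epsilon> + \<Lambda> * Re z) * R)"
    "\<And>z. z \<in> strip \<Longrightarrow> wLp_norm q M v (\<lambda>x. f x * exp (of_real (L x) * (z - of_real \<theta>)))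
       \<le> ennreal (exp (\<epsilon> + \<Lambda> * (1 - Re z)) * R)"
proof -
  obtain kw where kw: "0 \<le> kw"
    "\<And>x. x \<in> space M \<Longrightarrow> f x \<noteq> 0 \<Longrightarrow> 0 < cmod (f x) * enn2real (w x)
       \<and> \<bar>ln (cmod (f x) * enn2real (w x))\<bar> \<le> kw"
    "\<And>x. x \<in> space M \<Longrightarrow> f x \<noteq> 0 \<Longrightarrow> w x = ennreal (enn2real (w x))"
    using log_boundedE[OF good(1)] by blast
  obtain kv where kv: "0 \<le> kv"
    "\<And>x. x \<in> space M \<Longrightarrow> f x \<noteq> 0 \<Longrightarrow> 0 < cmod (f x) * enn2real (v x)
       \<and> \<bar>ln (cmod (f x) * enn2real (v x))\<bar> \<le> kv"
    "\<And>x. x \<in> space M \<Longrightarrow> f x \<noteq> 0 \<Longrightarrow> v x = ennreal (enn2real (v x))"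
    using log_boundedE[OF good(2)] by blast
  define W where "W x = cmod (f x) * enn2real (w x)" for x
  define V where "V x = cmod (f x) * enn2real (v x)" for x
  have [measurable]: "W \<in> borel_measurable M" "V \<in> borel_measurable M"
    unfolding W_def[abs_def] V_def[abs_def] by measurable
  define y where "y x = W x powr (1 - \<theta>) * V x powr \<theta> / R" for x
  have [measurable]: "y \<in> borel_measurable M" unfolding y_def[abs_def] by measurable
  have y_nn: "0 \<le> y x" for x using R by (simp add: y_def)
  have fu: "ennreal (cmod (f x)) * u x = ennreal (R * y x)" if "x \<in> space M" for x
  proof -
    have "ennreal (cmod (f x)) * u x = ennreal (W x powr (1 - \<theta>) * V x powr \<theta>)"
      unfolding W_def V_def by (rule interpolated_modulus[where M = M]) (auto intro: u kw(3) kv(3) that)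
    then show ?thesis using R by (simp add: y_def)
  qed
  have norm_y: "Lp_norm r M (\<lambda>x. ennreal (y x)) \<le> 1"
  proof -
    have "Lp_norm r M (\<lambda>x. ennreal (y x)) = Lp_norm r M (\<lambda>x. ennreal (1 / R) * ennreal (R * y x))"
      using R y_nn by (simp flip: ennreal_mult)
    also have "\<dots> \<le> ennreal (1 / R) * Lp_norm r M (\<lambda>x. ennreal (R * y x))"
      by (rule Lp_norm_cmult_le[OF _ r]) measurable
    also have "Lp_norm r M (\<lambda>x. ennreal (R * y x)) \<le> Lp_norm r M (\<lambda>x. ennreal (cmod (f x)) * u x)"
    proof (rule Lp_norm_mono_AE[OF _ _ r])
      have "(\<lambda>x. ennreal (cmod (f x)) * u x) \<in> borel_measurable M \<longleftrightarrow> (\<lambda>x. ennreal (R * y x)) \<in> borel_measurable M"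
        by (intro measurable_cong fu)
      then show "(\<lambda>x. ennreal (cmod (f x)) * u x) \<in> borel_measurable M" by simp
    qed (auto simp: fu)
    also have "\<dots> = ennreal R" using R by (simp add: wLp_norm_def)
    also have "ennreal (1 / R) * ennreal R = 1" using R by (simp flip: ennreal_mult)
    finally show ?thesis by (simp add: mult_left_mono)
  qed
  \<comment> \<open>\<open>kp\<close> and \<open>kq\<close> stand for \<open>r / p\<close> and \<open>r / q\<close>, with the value \<open>1\<close> if all exponents are infinite.\<close>
  define kp where "kp = (if r = top then 1 else enn2real r * enn2real (1 / p))"
  define kq where "kq = (if r = top then 1 else enn2real r * enn2real (1 / q))"
  have k1: "(1 - \<theta>) * kp + \<theta> * kq = 1"
  proof (cases "r = top")
    case False
    then have "enn2real r * enn2real (1 / r) = 1"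
      using r by (cases r) (auto simp: divide_ennreal ennreal_1[symmetric] simp del: ennreal_1)
    then show ?thesis using False unfolding pqr by (simp add: kp_def kq_def algebra_simps)
  qed (simp add: kp_def kq_def)
  define Ls where "Ls x = (if f x = 0 then 0 else (kq - kp) * ln (y x) + ln (W x) - ln (V x))" for x
  have [measurable]: "Ls \<in> borel_measurable M" unfolding Ls_def[abs_def] by measurable
  define K where "K = \<bar>kq - kp\<bar> * (kw + kv + \<bar>ln R\<bar>) + kw + kv"
  have pos: "0 < W x" "0 < V x" "0 < y x" "\<bar>ln (W x)\<bar> \<le> kw" "\<bar>ln (V x)\<bar> \<le> kv"
    "ln (y x) = (1 - \<theta>) * ln (W x) + \<theta> * ln (V x) - ln R" if "x \<in> space M" "f x \<noteq> 0" for x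
  proof -
    show WV: "0 < W x" "0 < V x" "\<bar>ln (W x)\<bar> \<le> kw" "\<bar>ln (V x)\<bar> \<le> kv"
      unfolding W_def V_def using kw(2)[OF that] kv(2)[OF that] by blast+
    show "0 < y x" using WV(1,2) R by (simp add: y_def)
    show "ln (y x) = (1 - \<theta>) * ln (W x) + \<theta> * ln (V x) - ln R"
      using WV(1,2) R by (simp add: y_def ln_div ln_mult)
  qed
  have Ls_bnd: "\<bar>Ls x\<bar> \<le> K" if x: "x \<in> space M" for x
  proof (cases "f x = 0")
    case False
    note P = pos[OF x False]
    have "\<bar>(1 - \<theta>) * ln (W x)\<bar> \<le> 1 * kw" "\<bar>\<theta> * ln (V x)\<bar> \<le> 1 * kv"
      unfolding abs_mult using P \<theta> kw(1) kv(1) by (intro mult_mono; simp)+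
    then have "\<bar>ln (y x)\<bar> \<le> kw + kv + \<bar>ln R\<bar>" unfolding P(6) by linarith
    then have "\<bar>(kq - kp) * ln (y x)\<bar> \<le> \<bar>kq - kp\<bar> * (kw + kv + \<bar>ln R\<bar>)"
      unfolding abs_mult by (intro mult_left_mono) auto
    then show ?thesis using P(4,5) False unfolding K_def by (simp add: Ls_def)
  qed (use kw(1) kv(1) in \<open>simp add: Ls_def K_def\<close>)
  have K0: "0 \<le> K" using kw(1) kv(1) by (simp add: K_def)
  define L where "L x = (if x \<in> space M then \<epsilon> * of_int \<lfloor>Ls x / \<epsilon>\<rfloor> else 0)" for x
  have L_le: "L x \<le> Ls x" "Ls x - \<epsilon> \<le> L x" if "x \<in> space M" for x
  proof -
    have "of_int \<lfloor>Ls x / \<epsilon>\<rfloor> \<le> Ls x / \<epsilon>" "Ls x / \<epsilon> \<le> of_int \<lfloor>Ls x / \<epsilon>\<rfloor> + 1" by linarith+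
    then have "\<epsilon> * of_int \<lfloor>Ls x / \<epsilon>\<rfloor> \<le> \<epsilon> * (Ls x / \<epsilon>)" "\<epsilon> * (Ls x / \<epsilon>) \<le> \<epsilon> * (of_int \<lfloor>Ls x / \<epsilon>\<rfloor> + 1)"
      using \<epsilon> by (auto intro!: mult_left_mono simp del: nonzero_mult_div_cancel_left times_divide_eq_right)
    then show "L x \<le> Ls x" "Ls x - \<epsilon> \<le> L x" using \<epsilon> that by (auto simp: L_def distrib_left)
  qed
  define \<Lambda> where "\<Lambda> = K + \<epsilon>"
  have L_bnd: "\<bar>L x\<bar> \<le> \<Lambda>" for x
    using L_le[of x] Ls_bnd[of x] \<epsilon> K0 by (cases "x \<in> space M") (auto simp: \<Lambda>_def L_def)
  have L_meas [measurable]: "L \<in> borel_measurable M"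
  proof -
    have "(\<lambda>x. \<epsilon> * of_int \<lfloor>Ls x / \<epsilon>\<rfloor>) \<in> borel_measurable M" by measurable
    then show ?thesis by (rule measurable_cong[THEN iffD1, rotated]) (simp add: L_def)
  qed
  have main: "cmod (f x * exp (of_real (L x) * (z - of_real \<theta>))) = cmod (f x) * exp (L x * (Re z - \<theta>))" for x z
    by (simp add: norm_mult)
  show ?thesis
  proof (rule that[of L \<Lambda>])
    show "L \<in> borel_measurable M" by (rule L_meas)
    have "range L \<subseteq> insert 0 ((\<lambda>k. \<epsilon> * of_int k) ` {\<lfloor>- K / \<epsilon>\<rfloor>..\<lfloor>K / \<epsilon>\<rfloor>})"
    proof
      fix l assume "l \<in> range L"
      then obtain x where l: "l = L x" by auto
      show "l \<in> insert 0 ((\<lambda>k. \<epsilon> * of_int k) ` {\<lfloor>- K / \<epsilon>\<rfloor>..\<lfloor>K / \<epsilon>\<rfloor>})"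
      proof (cases "x \<in> space M")
        case True
        have "- K / \<epsilon> \<le> Ls x / \<epsilon>" "Ls x / \<epsilon> \<le> K / \<epsilon>"
          using Ls_bnd[OF True] \<epsilon> by (intro divide_right_mono; simp add: abs_le_iff)+
        then have "\<lfloor>Ls x / \<epsilon>\<rfloor> \<in> {\<lfloor>- K / \<epsilon>\<rfloor>..\<lfloor>K / \<epsilon>\<rfloor>}" by (auto intro: floor_mono)
        then show ?thesis using True by (auto simp: l L_def)
      qed (simp add: l L_def)
    qed
    then show "finite (range L)" by (rule finite_subset) simp
    show "0 \<le> \<Lambda>" using K0 \<epsilon> by (simp add: \<Lambda>_def)
  next
    fix z assume z: "z \<in> strip"
    define \<sigma> where "\<sigma> = Re z"
    have \<sigma>: "0 \<le> \<sigma>" "\<sigma> \<le> 1" using z by (auto simp: strip_def \<sigma>_def)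
    show "wLp_norm p M w (\<lambda>x. f x * exp (of_real (L x) * (z - of_real \<theta>))) \<le> ennreal (exp (\<epsilon> + \<Lambda> * Re z) * R)"
      unfolding wLp_norm_def main
    proof (rule Lp_norm_powr_le[OF _ _ y_nn p r _ norm_y _ kp_def])
      fix x assume x: "x \<in> space M"
      show "ennreal (cmod (f x) * exp (L x * (Re z - \<theta>))) * w x
        \<le> ennreal (exp (\<epsilon> + \<Lambda> * Re z) * R * y x powr kp)"
      proof (cases "f x = 0")
        case False
        note P = pos[OF x False]
        have "ennreal (cmod (f x) * exp (L x * (Re z - \<theta>))) * w x = ennreal (W x * exp (L x * (\<sigma> - \<theta>)))"
          by (subst kw(3)[OF x False]) (simp add: W_def \<sigma>_def mult_ac flip: ennreal_mult)
        also have "\<dots> \<le> ennreal (exp (\<epsilon> + \<Lambda> * \<sigma>) * R * y x powr kp)"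
        proof (rule ennreal_leI)
          have "L x * \<sigma> \<le> \<Lambda> * \<sigma>" using L_bnd[of x] \<sigma> by (intro mult_right_mono) auto
          moreover have "(Ls x - \<epsilon>) * \<theta> \<le> L x * \<theta>" using L_le[OF x] \<theta> by (intro mult_right_mono) auto
          moreover have "\<epsilon> * \<theta> \<le> \<epsilon>" using \<epsilon> \<theta> by (simp add: mult_left_le)
          ultimately have "L x * (\<sigma> - \<theta>) \<le> \<epsilon> + \<Lambda> * \<sigma> - \<theta> * Ls x" by (simp add: algebra_simps)
          moreover have "ln (W x) - \<theta> * Ls x = ln R + kp * ln (y x)"
          proof -
            have "ln (W x) - \<theta> * Ls x = (1 - \<theta>) * ln (W x) + \<theta> * ln (V x) - \<theta> * (kq - kp) * ln (y x)"
              using False by (simp add: Ls_def algebra_simps)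
            also have "\<dots> = ln R + (1 - \<theta> * (kq - kp)) * ln (y x)"
              using P(6) by (simp add: algebra_simps)
            also have "1 - \<theta> * (kq - kp) = kp" using k1 by (simp add: algebra_simps)
            finally show ?thesis .
          qed
          ultimately have "ln (W x) + L x * (\<sigma> - \<theta>) \<le> \<epsilon> + \<Lambda> * \<sigma> + ln R + kp * ln (y x)" by linarith
          then have "exp (ln (W x) + L x * (\<sigma> - \<theta>)) \<le> exp (\<epsilon> + \<Lambda> * \<sigma> + ln R + kp * ln (y x))" by simp
          then show "W x * exp (L x * (\<sigma> - \<theta>)) \<le> exp (\<epsilon> + \<Lambda> * \<sigma>) * R * y x powr kp"
            using P R by (simp add: exp_add powr_def)
        qed
        finally show ?thesis by (simp add: \<sigma>_def)
      qed simp
    qed (use r_top R in auto)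
    show "wLp_norm q M v (\<lambda>x. f x * exp (of_real (L x) * (z - of_real \<theta>))) \<le> ennreal (exp (\<epsilon> + \<Lambda> * (1 - Re z)) * R)"
      unfolding wLp_norm_def main
    proof (rule Lp_norm_powr_le[OF _ _ y_nn q r _ norm_y _ kq_def])
      fix x assume x: "x \<in> space M"
      show "ennreal (cmod (f x) * exp (L x * (Re z - \<theta>))) * v x
        \<le> ennreal (exp (\<epsilon> + \<Lambda> * (1 - Re z)) * R * y x powr kq)"
      proof (cases "f x = 0")
        case False
        note P = pos[OF x False]
        have "ennreal (cmod (f x) * exp (L x * (Re z - \<theta>))) * v x = ennreal (V x * exp (L x * (\<sigma> - \<theta>)))"
          by (subst kv(3)[OF x False]) (simp add: V_def \<sigma>_def mult_ac flip: ennreal_mult)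
        also have "\<dots> \<le> ennreal (exp (\<epsilon> + \<Lambda> * (1 - \<sigma>)) * R * y x powr kq)"
        proof (rule ennreal_leI)
          have "- L x * (1 - \<sigma>) \<le> \<Lambda> * (1 - \<sigma>)" using L_bnd[of x] \<sigma> by (intro mult_right_mono) auto
          moreover have "L x * (1 - \<theta>) \<le> Ls x * (1 - \<theta>)" using L_le[OF x] \<theta> by (intro mult_right_mono) auto
          ultimately have "L x * (\<sigma> - \<theta>) \<le> \<epsilon> + \<Lambda> * (1 - \<sigma>) + (1 - \<theta>) * Ls x"
            using \<epsilon> by (simp add: algebra_simps)
          moreover have "ln (V x) + (1 - \<theta>) * Ls x = ln R + kq * ln (y x)"
          proof -
            have "ln (V x) + (1 - \<theta>) * Ls x = (1 - \<theta>) * ln (W x) + \<theta> * ln (V x) + (1 - \<theta>) * (kq - kp) * ln (y x)"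
              using False by (simp add: Ls_def algebra_simps)
            also have "\<dots> = ln R + (1 + (1 - \<theta>) * (kq - kp)) * ln (y x)"
              using P(6) by (simp add: algebra_simps)
            also have "1 + (1 - \<theta>) * (kq - kp) = kq" using k1 by (simp add: algebra_simps)
            finally show ?thesis .
          qed
          ultimately have "ln (V x) + L x * (\<sigma> - \<theta>) \<le> \<epsilon> + \<Lambda> * (1 - \<sigma>) + ln R + kq * ln (y x)" by linarith
          then have "exp (ln (V x) + L x * (\<sigma> - \<theta>)) \<le> exp (\<epsilon> + \<Lambda> * (1 - \<sigma>) + ln R + kq * ln (y x))" by simp
          then show "V x * exp (L x * (\<sigma> - \<theta>)) \<le> exp (\<epsilon> + \<Lambda> * (1 - \<sigma>)) * R * y x powr kq"
            using P R by (simp add: exp_add powr_def)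
        qed
        finally show ?thesis by (simp add: \<sigma>_def)
      qed simp
    qed (use r_top R in auto)
  qed
qed

section \<open>Simple functions\<close>

lemma simple_functionsI:
  fixes n :: nat
  assumes "\<And>i. i < n \<Longrightarrow> A i \<in> fmeasurable M" "f = (\<lambda>x. \<Sum>i<n. c i * indicator (A i) x)"
  shows "f \<in> simple_functions M"
  using assms unfolding simple_functions_def by blast

lemma simple_functions_measurable:
  assumes "f \<in> simple_functions M" shows "f \<in> borel_measurable M"
proof -
  obtain n :: nat and c A where A: "\<And>i. i < n \<Longrightarrow> A i \<in> fmeasurable M"
    and f: "f = (\<lambda>x. \<Sum>i<n. c i * indicator (A i) x)"
    using assms unfolding simple_functions_def by blast
  show ?thesis
    unfolding f using A
    by (intro borel_measurable_sum borel_measurable_times borel_measurable_indicator) (auto intro: fmeasurableD)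
qed

lemma simple_functions_support:
  assumes "f \<in> simple_functions M"
  obtains A where "A \<in> fmeasurable M" "\<And>x. f x \<noteq> 0 \<Longrightarrow> x \<in> A"
proof -
  obtain n :: nat and c A where A: "\<And>i. i < n \<Longrightarrow> A i \<in> fmeasurable M"
    and f: "f = (\<lambda>x. \<Sum>i<n. c i * indicator (A i) x)"
    using assms unfolding simple_functions_def by blast
  show ?thesis
  proof (rule that[of "\<Union>i<n. A i"])
    show "(\<Union>i<n. A i) \<in> fmeasurable M" using A by (intro fmeasurable.finite_UN) auto
    fix x assume "f x \<noteq> 0"
    then obtain i where "i < n" "c i * indicator (A i) x \<noteq> 0"
      unfolding f by (metis (no_types, lifting) lessThan_iff sum.neutral)
    then show "x \<in> (\<Union>i<n. A i)" by (auto simp: indicator_def split: if_splits)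
  qed
qed

lemma simple_functions_outside: "f \<in> simple_functions M \<Longrightarrow> x \<notin> space M \<Longrightarrow> f x = 0"
  using simple_functions_support[of f M] by (metis fmeasurableD sets.sets_into_space subsetD)

lemma simple_functions_0: "(\<lambda>x. 0) \<in> simple_functions M"
  by (rule simple_functionsI[of 0]) auto

lemma simple_functions_cmult_indicator:
  assumes f: "f \<in> simple_functions M" and B: "B \<in> sets M"
  shows "(\<lambda>x. a * (f x * indicator B x)) \<in> simple_functions M"
proof -
  obtain n :: nat and c A where A: "\<And>i. i < n \<Longrightarrow> A i \<in> fmeasurable M"
    and f: "f = (\<lambda>x. \<Sum>i<n. c i * indicator (A i) x)"
    using f unfolding simple_functions_def by blast
  show ?thesis
  proof (rule simple_functionsI[of n "\<lambda>i. A i \<inter> B" _ _ "\<lambda>i. a * c i"])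
    show "A i \<inter> B \<in> fmeasurable M" if "i < n" for i
      using A[OF that] B by (rule fmeasurable_Int_fmeasurable)
    show "(\<lambda>x. a * (f x * indicator B x)) = (\<lambda>x. \<Sum>i<n. a * c i * indicator (A i \<inter> B) x)"
      unfolding f sum_distrib_left sum_distrib_right
      by (intro ext sum.cong refl) (simp add: indicator_inter_arith)
  qed
qed

lemma simple_functions_add:
  assumes f: "f \<in> simple_functions M" and g: "g \<in> simple_functions M"
  shows "(\<lambda>x. f x + g x) \<in> simple_functions M"
proof -
  obtain n :: nat and c A where A: "\<And>i. i < n \<Longrightarrow> A i \<in> fmeasurable M"
    and f: "f = (\<lambda>x. \<Sum>i<n. c i * indicator (A i) x)"
    using f unfolding simple_functions_def by blast
  obtain n' :: nat and c' A' where A': "\<And>i. i < n' \<Longrightarrow> A' i \<in> fmeasurable M"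
    and g: "g = (\<lambda>x. \<Sum>i<n'. c' i * indicator (A' i) x)"
    using g unfolding simple_functions_def by blast
  let ?A = "\<lambda>i. if i < n then A i else A' (i - n)" and ?c = "\<lambda>i. if i < n then c i else c' (i - n)"
  show ?thesis
  proof (rule simple_functionsI[of "n + n'" ?A _ _ ?c])
    have "(\<Sum>i<n + n'. ?c i * indicator (?A i) x) = f x + g x" for x
    proof -
      have "{..<n + n'} = {..<n} \<union> {n..<n + n'}" by auto
      then have "(\<Sum>i<n + n'. ?c i * indicator (?A i) x)
          = (\<Sum>i<n. ?c i * indicator (?A i) x) + (\<Sum>i\<in>{n..<n + n'}. ?c i * indicator (?A i) x)"
        by (simp only: sum.union_disjoint[OF finite_lessThan finite_atLeastLessThan ivl_disj_int_one(2)])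
      also have "(\<Sum>i\<in>{n..<n + n'}. ?c i * indicator (?A i) x) = (\<Sum>i<n'. c' i * indicator (A' i) x)"
        by (rule sum.reindex_bij_witness[of _ "\<lambda>i. i + n" "\<lambda>i. i - n"]) auto
      also have "(\<Sum>i<n. ?c i * indicator (?A i) x) = (\<Sum>i<n. c i * indicator (A i) x)"
        by (rule sum.cong) auto
      finally show ?thesis unfolding f g .
    qed
    then show "(\<lambda>x. f x + g x) = (\<lambda>x. \<Sum>i<n + n'. ?c i * indicator (?A i) x)" by auto
  qed (use A A' in auto)
qed

lemma simple_functions_sum:
  assumes "finite I" "\<And>i. i \<in> I \<Longrightarrow> f i \<in> simple_functions M"
  shows "(\<lambda>x. \<Sum>i\<in>I. f i x) \<in> simple_functions M"
  using assms by (induction I) (auto intro: simple_functions_0 simple_functions_add)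

text \<open>
  The reason why the members of the analytic families are again simple functions.
\<close>

lemma finite_range_decomposition:
  assumes "finite (range L)" "\<And>x. x \<notin> space M \<Longrightarrow> f x = 0"
  shows "f x * \<phi> (L x) = (\<Sum>l\<in>range L. \<phi> l * (f x * indicator {x \<in> space M. L x = l} x :: complex))"
proof (cases "x \<in> space M")
  case True
  have "(\<Sum>l\<in>range L. \<phi> l * (f x * indicator {x \<in> space M. L x = l} x))
      = (\<Sum>l\<in>{L x}. \<phi> l * (f x * indicator {x \<in> space M. L x = l} x))"
    using assms(1) by (intro sum.mono_neutral_right) (auto simp: indicator_def)
  then show ?thesis using True by (simp add: indicator_def)
qed (use assms in simp)

lemma simple_functions_times_finite_range:
  fixes L :: "'a \<Rightarrow> real"
  assumes f: "f \<in> simple_functions M" and [measurable]: "L \<in> borel_measurable M" and fin: "finite (range L)"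
  shows "(\<lambda>x. f x * \<phi> (L x)) \<in> simple_functions M"
proof -
  have "(\<lambda>x. \<Sum>l\<in>range L. \<phi> l * (f x * indicator {x \<in> space M. L x = l} x)) \<in> simple_functions M"
    by (intro simple_functions_sum simple_functions_cmult_indicator f fin) auto
  moreover have "f x * \<phi> (L x) = (\<Sum>l\<in>range L. \<phi> l * (f x * indicator {x \<in> space M. L x = l} x))" for x
    by (rule finite_range_decomposition[OF fin]) (rule simple_functions_outside[OF f])
  ultimately show ?thesis by (simp only:)
qed

lemma wLp_norm_cmult_le:
  assumes [measurable]: "f \<in> borel_measurable M" "g \<in> borel_measurable M" "w \<in> borel_measurable M"
    and p: "0 < p" and C: "0 \<le> C" and le: "\<And>x. cmod (g x) \<le> C * cmod (f x)"
  shows "wLp_norm p M w g \<le> ennreal C * wLp_norm p M w f"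
proof -
  have "wLp_norm p M w g \<le> Lp_norm p M (\<lambda>x. ennreal C * (ennreal (cmod (f x)) * w x))"
    unfolding wLp_norm_def
  proof (rule Lp_norm_mono_AE[OF _ _ p])
    show "AE x in M. ennreal (cmod (g x)) * w x \<le> ennreal C * (ennreal (cmod (f x)) * w x)"
    proof (rule AE_I2)
      fix x
      have "ennreal (cmod (g x)) \<le> ennreal C * ennreal (cmod (f x))"
        using le[of x] C by (simp add: ennreal_leI flip: ennreal_mult)
      then show "ennreal (cmod (g x)) * w x \<le> ennreal C * (ennreal (cmod (f x)) * w x)"
        by (simp add: mult_right_mono flip: mult.assoc)
    qed
  qed measurable
  also have "\<dots> \<le> ennreal C * wLp_norm p M w f"
    unfolding wLp_norm_def by (rule Lp_norm_cmult_le[OF _ p]) measurable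
  finally show ?thesis .
qed

section \<open>Truncation of the modulus\<close>

lemma log_bounded_indicator:
  assumes "log_bounded M w f"
  shows "log_bounded M w (\<lambda>x. f x * indicator A x)"
proof -
  obtain n where "n \<ge> 1" "\<And>x. x \<in> space M \<Longrightarrow> f x \<noteq> 0 \<Longrightarrow>
     ennreal (1 / n) \<le> ennreal (cmod (f x)) * w x \<and> ennreal (cmod (f x)) * w x \<le> ennreal n"
    using assms by (auto simp: log_bounded_def)
  then show ?thesis
    unfolding log_bounded_def by (intro exI[of _ n]) (auto simp: indicator_def)
qed

text \<open>
  The set \<open>A\<close> consists of the points where \<open>1 / n \<le> \<bar>f\<bar> * w \<le> n\<close> for a large \<open>n\<close>. If \<open>p < \<infinity>\<close> the norm of
  the remainder tends to zero by dominated convergence. If \<open>p = \<infinity>\<close> then \<open>\<bar>f\<bar> * w\<close> is essentially bounded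
  by some \<open>K < n\<close>, so on the remainder it is almost everywhere below \<open>1 / n\<close>.
\<close>

lemma log_truncation:
  fixes f :: "'a \<Rightarrow> complex"
  assumes [measurable]: "f \<in> borel_measurable M" and w: "weight M w"
    and p: "0 < p" and fin: "wLp_norm p M w f < top" and \<delta>: "0 < \<delta>"
  obtains A where "A \<in> sets M" "log_bounded M w (\<lambda>x. f x * indicator A x)"
    "wLp_norm p M w (\<lambda>x. f x * indicator (space M - A) x) \<le> ennreal \<delta>"
proof -
  have [measurable]: "w \<in> borel_measurable M" and w01: "AE x in M. 0 < w x \<and> w x < top"
    using w by (auto simp: weight_def)
  define g where "g x = ennreal (cmod (f x)) * w x" for x
  have [measurable]: "g \<in> borel_measurable M" unfolding g_def[abs_def] by measurable
  define A where "A n = {x \<in> space M. ennreal (1 / real (Suc n)) \<le> g x \<and> g x \<le> ennreal (real (Suc n))}" for n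
  have A[measurable]: "A n \<in> sets M" for n unfolding A_def by measurable
  have bounded: "log_bounded M w (\<lambda>x. f x * indicator (A n) x)" for n
    unfolding log_bounded_def
    by (intro exI[of _ "real (Suc n)"]) (auto simp: A_def g_def indicator_def)
  have tail: "ennreal (cmod (f x * indicator (space M - A n) x)) * w x = g x * indicator (space M - A n) x"
    for x n by (auto simp: g_def indicator_def)
  have "\<exists>n. Lp_norm p M (\<lambda>x. g x * indicator (space M - A n) x) \<le> ennreal \<delta>"
  proof (cases "p = top")
    case True
    obtain K where K: "0 \<le> K" "wLp_norm p M w f = ennreal K" using fin by (cases "wLp_norm p M w f") auto
    have gK: "AE x in M. g x \<le> ennreal K"
      using K(2) Lp_norm_infinity_le_iff[of g M "ennreal K"] by (simp add: True wLp_norm_def flip: g_def)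
    obtain n where n: "max K (1 / \<delta>) < real n" using reals_Archimedean2 by blast
    have n': "K < real (Suc n)" "1 / real (Suc n) \<le> \<delta>"
      using n \<delta> by (auto simp: field_simps)
    have "AE x in M. g x * indicator (space M - A n) x \<le> ennreal \<delta>"
      using gK
    proof (rule AE_mp[OF _ AE_I2], intro impI)
      fix x assume x: "x \<in> space M" "g x \<le> ennreal K"
      show "g x * indicator (space M - A n) x \<le> ennreal \<delta>"
      proof (cases "x \<in> A n")
        case False
        have "g x \<le> ennreal (real (Suc n))"
          using x(2) n'(1) by (meson ennreal_leI less_imp_le order_trans)
        then have "g x \<le> ennreal (1 / real (Suc n))"
          using False x(1) by (auto simp: A_def)
        also have "\<dots> \<le> ennreal \<delta>" using n' by (intro ennreal_leI)
        finally show ?thesis by (simp add: indicator_def)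
      qed simp
    qed
    then show ?thesis unfolding True by (intro exI[of _ n]) (simp add: Lp_norm_infinity_le_iff)
  next
    case False
    then have p': "p < top" by (simp add: less_top)
    define G where "G n x = ennpow (g x * indicator (space M - A n) x) (enn2real p)" for n x
    have [measurable]: "G n \<in> borel_measurable M" for n unfolding G_def[abs_def] by measurable
    have "(\<lambda>n. \<integral>\<^sup>+x. G n x \<partial>M) \<longlonglongrightarrow> (\<integral>\<^sup>+x. 0 \<partial>M)"
    proof (rule nn_integral_dominated_convergence[where w = "\<lambda>x. ennpow (g x) (enn2real p)"])
      have "(\<integral>\<^sup>+x. ennpow (g x) (enn2real p) \<partial>M) \<le> ennpow (wLp_norm p M w f) (enn2real p)"
        using Lp_norm_le_iff_integral[OF p p', of M g "wLp_norm p M w f"] by (simp add: wLp_norm_def flip: g_def)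
      also have "\<dots> < top" using fin by simp
      finally show "(\<integral>\<^sup>+x. ennpow (g x) (enn2real p) \<partial>M) < \<infinity>" by simp
      show "AE x in M. G n x \<le> ennpow (g x) (enn2real p)" for n
        by (auto simp: G_def indicator_def intro!: AE_I2)
      show "AE x in M. (\<lambda>n. G n x) \<longlonglongrightarrow> 0"
        using w01
      proof (rule AE_mp[OF _ AE_I2], intro impI)
        fix x assume x: "x \<in> space M" and wx: "0 < w x \<and> w x < top"
        show "(\<lambda>n. G n x) \<longlonglongrightarrow> 0"
        proof (cases "f x = 0")
          case True
          then show ?thesis by (simp add: G_def g_def)
        next
          case False
          have "g x < top" "0 < g x" using wx False by (auto simp: g_def ennreal_mult_less_top ennreal_zero_less_mult_iff)
          then obtain t where t: "0 < t" "g x = ennreal t" by (cases "g x") auto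
          obtain n0 where n0: "max t (1 / t) < real n0" using reals_Archimedean2 by blast
          have "G n x = 0" if "n0 \<le> n" for n
          proof -
            have "max t (1 / t) < real (Suc n)" using n0 that by linarith
            then have "1 / real (Suc n) \<le> t" "t \<le> real (Suc n)" using t(1) by (auto simp: field_simps)
            then have "x \<in> A n" using x t by (simp add: A_def del: of_nat_Suc)
            then show ?thesis by (simp add: G_def)
          qed
          then show ?thesis
            by (intro tendsto_eventually) (auto simp: eventually_sequentially)
        qed
      qed
    qed measurable
    then have "(\<lambda>n. \<integral>\<^sup>+x. G n x \<partial>M) \<longlonglongrightarrow> 0" by simp
    moreover have "0 < ennreal (\<delta> powr enn2real p)" using \<delta> by simp
    ultimately have "\<forall>\<^sub>F n in sequentially. (\<integral>\<^sup>+x. G n x \<partial>M) < ennreal (\<delta> powr enn2real p)"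
      by (rule order_tendstoD)
    then obtain n where "(\<integral>\<^sup>+x. G n x \<partial>M) < ennreal (\<delta> powr enn2real p)"
      by (auto simp: eventually_sequentially)
    then show ?thesis
      using \<delta> by (intro exI[of _ n]) (simp add: Lp_norm_le_iff_integral[OF p p'] G_def ennpow_ennreal)
  qed
  then obtain n where "Lp_norm p M (\<lambda>x. g x * indicator (space M - A n) x) \<le> ennreal \<delta>" ..
  then show ?thesis using that[of "A n"] bounded A by (simp add: wLp_norm_def tail)
qed

section \<open>Multilinear operators with two endpoint bounds\<close>

lemma interpolated_exponent:
  assumes p: "0 < p" and q: "0 < q" and \<theta>: "0 < \<theta>" "\<theta> < 1"
    and r: "1 / r = ennreal (1 - \<theta>) / p + ennreal \<theta> / q"
  shows "0 < r" "r = top \<Longrightarrow> p = top \<and> q = top"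
    "enn2real (1 / r) = (1 - \<theta>) * enn2real (1 / p) + \<theta> * enn2real (1 / q)"
proof -
  have inv: "\<exists>t\<ge>0. 1 / s = ennreal t" if "0 < s" for s :: ennreal
  proof -
    have "1 / s < top" using that by (simp add: divide_ennreal_def less_top[symmetric])
    then show ?thesis by (cases "1 / s") auto
  qed
  obtain P Q where P: "0 \<le> P" "1 / p = ennreal P" and Q: "0 \<le> Q" "1 / q = ennreal Q"
    using inv[OF p] inv[OF q] by blast
  have "1 / r = ennreal (1 - \<theta>) * (1 / p) + ennreal \<theta> * (1 / q)"
    using r by (simp add: divide_ennreal_def)
  also have "\<dots> = ennreal ((1 - \<theta>) * P + \<theta> * Q)"
    using P Q \<theta> by (simp add: ennreal_mult ennreal_plus)
  finally have r': "1 / r = ennreal ((1 - \<theta>) * P + \<theta> * Q)" .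
  show "0 < r"
  proof (rule ccontr)
    assume "\<not> 0 < r"
    then have "r = 0" by simp
    then have "1 / r = top" by (simp add: divide_ennreal_def)
    then show False using r' by simp
  qed
  show "enn2real (1 / r) = (1 - \<theta>) * enn2real (1 / p) + \<theta> * enn2real (1 / q)"
    unfolding r' P(2) Q(2) using P(1) Q(1) \<theta> by (simp del: ennreal_plus)
  assume "r = top"
  then have "1 / r = 0" by simp
  then have "(1 - \<theta>) * P + \<theta> * Q \<le> 0" using r' by (metis ennreal_eq_0_iff)
  moreover have "0 \<le> (1 - \<theta>) * P" "0 \<le> \<theta> * Q" using P Q \<theta> by auto
  ultimately have "(1 - \<theta>) * P = 0" "\<theta> * Q = 0" by linarith+
  then have "P = 0" "Q = 0" using \<theta> by auto
  then have "1 / p = 0" "1 / q = 0" using P Q by auto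
  then show "p = top \<and> q = top" by (simp add: divide_ennreal_def)
qed

locale interpolation_data =
  fixes m :: nat and \<mu> :: "nat \<Rightarrow> 'a measure"
    and T :: "(nat \<Rightarrow> 'a \<Rightarrow> complex) \<Rightarrow> 'a \<Rightarrow> complex"
    and p q r :: "nat \<Rightarrow> ennreal" and w v u :: "nat \<Rightarrow> 'a \<Rightarrow> ennreal" and M1 M2 \<theta> :: real
  assumes T: "multilinear_operator m \<mu> T"
    and p: "\<And>j. j \<in> {0..m} \<Longrightarrow> 0 < p j" and q: "\<And>j. j \<in> {0..m} \<Longrightarrow> 0 < q j"
    and p0: "p 0 < top" and q0: "q 0 < top"
    and w: "\<And>j. j \<in> {0..m} \<Longrightarrow> weight (\<mu> j) (w j)" and v: "\<And>j. j \<in> {0..m} \<Longrightarrow> weight (\<mu> j) (v j)"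
    and M1: "0 < M1" and M2: "0 < M2"
    and bound1: "norm_bound_on (finite_norm_tuples m \<mu> p w) m \<mu> T p w M1"
    and bound2: "norm_bound_on (finite_norm_tuples m \<mu> q v) m \<mu> T q v M2"
    and \<theta>: "0 < \<theta>" "\<theta> < 1"
    and r: "\<And>j. j \<in> {0..m} \<Longrightarrow> 1 / r j = ennreal (1 - \<theta>) / p j + ennreal \<theta> / q j"
    and u: "\<And>j x. j \<in> {0..m} \<Longrightarrow> x \<in> space (\<mu> j) \<Longrightarrow>
           u j x = ennpow (w j x) (1 - \<theta>) * ennpow (v j x) \<theta>"
begin

lemma weights_measurable:
  assumes "j \<in> {0..m}"
  shows "w j \<in> borel_measurable (\<mu> j)" "v j \<in> borel_measurable (\<mu> j)" "u j \<in> borel_measurable (\<mu> j)"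
proof -
  show w': "w j \<in> borel_measurable (\<mu> j)" and v': "v j \<in> borel_measurable (\<mu> j)"
    using w[OF assms] v[OF assms] by (auto simp: weight_def)
  have "(\<lambda>x. ennpow (w j x) (1 - \<theta>) * ennpow (v j x) \<theta>) \<in> borel_measurable (\<mu> j)"
    using w' v' by measurable
  then show "u j \<in> borel_measurable (\<mu> j)"
    by (rule measurable_cong[THEN iffD2, rotated]) (rule u[OF assms])
qed

lemma r_props:
  assumes "j \<in> {0..m}"
  shows "0 < r j" "r j = top \<Longrightarrow> p j = top \<and> q j = top"
    "enn2real (1 / r j) = (1 - \<theta>) * enn2real (1 / p j) + \<theta> * enn2real (1 / q j)"
  using interpolated_exponent[OF p[OF assms] q[OF assms] \<theta> r[OF assms]] by auto

subsection \<open>Admissible tuples\<close>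

text \<open>
  The entries of the tuples on which both endpoint bounds are available.
\<close>

definition admissible :: "nat \<Rightarrow> ('a \<Rightarrow> complex) set" where
  "admissible j = {f \<in> simple_functions (\<mu> j).
     wLp_norm (p j) (\<mu> j) (w j) f < top \<and> wLp_norm (q j) (\<mu> j) (v j) f < top}"

abbreviation "admissible_tuples \<equiv> finite_norm_tuples m \<mu> p w \<inter> finite_norm_tuples m \<mu> q v"

lemma admissible_tuples_eq: "admissible_tuples = (\<Pi>\<^sub>E j\<in>{1..m}. admissible j)"
  unfolding finite_norm_tuples_def simple_tuples_def admissible_def
  by (intro set_eqI) (simp add: PiE_iff, blast)

lemma admissible_tuplesD:
  assumes "f \<in> admissible_tuples" "j \<in> {1..m}"
  shows "f j \<in> admissible j" "f j \<in> simple_functions (\<mu> j)" "f j \<in> borel_measurable (\<mu> j)"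
    "wLp_norm (p j) (\<mu> j) (w j) (f j) < top" "wLp_norm (q j) (\<mu> j) (v j) (f j) < top"
proof -
  show *: "f j \<in> admissible j" using assms unfolding admissible_tuples_eq by (rule PiE_mem)
  then show "f j \<in> simple_functions (\<mu> j)" by (simp add: admissible_def)
  then show "f j \<in> borel_measurable (\<mu> j)" by (rule simple_functions_measurable)
  show "wLp_norm (p j) (\<mu> j) (w j) (f j) < top" "wLp_norm (q j) (\<mu> j) (v j) (f j) < top"
    using * by (auto simp: admissible_def)
qed

lemma admissible_tuples_upd:
  assumes "f \<in> admissible_tuples" "j \<in> {1..m}" "g \<in> admissible j"
  shows "f(j := g) \<in> admissible_tuples"
  using assms unfolding admissible_tuples_eq by (simp add: PiE_iff extensional_def)

lemma admissible_tuples_simple: "f \<in> admissible_tuples \<Longrightarrow> f \<in> simple_tuples m \<mu>"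
  by (simp add: finite_norm_tuples_def)

lemma T_measurable: "f \<in> admissible_tuples \<Longrightarrow> T f \<in> borel_measurable (\<mu> 0)"
  using T admissible_tuples_simple unfolding multilinear_operator_def by blast

lemma admissible_dominated:
  assumes f: "f \<in> admissible j" and j: "j \<in> {1..m}" and g: "g \<in> simple_functions (\<mu> j)"
    and C: "0 \<le> C" and le: "\<And>x. cmod (g x) \<le> C * cmod (f x)"
  shows "g \<in> admissible j"
proof -
  have m: "f \<in> borel_measurable (\<mu> j)" "g \<in> borel_measurable (\<mu> j)"
    using f g by (auto simp: admissible_def intro: simple_functions_measurable)
  have j0: "j \<in> {0..m}" using j by auto
  have C_top: "ennreal C * wLp_norm (p j) (\<mu> j) (w j) f < top" "ennreal C * wLp_norm (q j) (\<mu> j) (v j) f < top"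
    using f by (auto simp: admissible_def ennreal_mult_less_top)
  have "wLp_norm (p j) (\<mu> j) (w j) g \<le> ennreal C * wLp_norm (p j) (\<mu> j) (w j) f"
    by (rule wLp_norm_cmult_le[OF m weights_measurable(1)[OF j0] p[OF j0] C le])
  then have "wLp_norm (p j) (\<mu> j) (w j) g < top" using C_top(1) by (rule le_less_trans)
  moreover have "wLp_norm (q j) (\<mu> j) (v j) g \<le> ennreal C * wLp_norm (q j) (\<mu> j) (v j) f"
    by (rule wLp_norm_cmult_le[OF m weights_measurable(2)[OF j0] q[OF j0] C le])
  then have "wLp_norm (q j) (\<mu> j) (v j) g < top" using C_top(2) by (rule le_less_trans)
  ultimately show ?thesis
    using g by (simp add: admissible_def)
qed

lemma admissible_times_finite_range:
  fixes L :: "'a \<Rightarrow> real"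
  assumes f: "f \<in> admissible j" and j: "j \<in> {1..m}"
    and L: "L \<in> borel_measurable (\<mu> j)" "finite (range L)"
  shows "(\<lambda>x. f x * \<phi> (L x)) \<in> admissible j"
proof (rule admissible_dominated[OF f j])
  show "(\<lambda>x. f x * \<phi> (L x)) \<in> simple_functions (\<mu> j)"
    using f L by (intro simple_functions_times_finite_range) (auto simp: admissible_def)
  show "0 \<le> (\<Sum>l\<in>range L. cmod (\<phi> l))" by (simp add: sum_nonneg)
  fix x
  have "cmod (\<phi> (L x)) \<le> (\<Sum>l\<in>range L. cmod (\<phi> l))"
    by (rule member_le_sum) (use L in auto)
  then show "cmod (f x * \<phi> (L x)) \<le> (\<Sum>l\<in>range L. cmod (\<phi> l)) * cmod (f x)"
    by (simp add: norm_mult mult.commute mult_left_mono)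
qed

lemma admissible_indicator:
  assumes f: "f \<in> admissible j" and j: "j \<in> {1..m}" and A: "A \<in> sets (\<mu> j)"
  shows "(\<lambda>x. f x * indicator A x) \<in> admissible j"
proof (rule admissible_dominated[OF f j, of _ 1])
  show "(\<lambda>x. f x * indicator A x) \<in> simple_functions (\<mu> j)"
    using simple_functions_cmult_indicator[of f "\<mu> j" A 1] f A by (simp add: admissible_def)
qed (auto simp: indicator_def)

lemma T_linear:
  assumes "f \<in> admissible_tuples" "j \<in> {1..m}" "g \<in> simple_functions (\<mu> j)" "h \<in> simple_functions (\<mu> j)"
  shows "AE x in \<mu> 0. T (f(j := (\<lambda>y. a * g y + b * h y))) x = a * T (f(j := g)) x + b * T (f(j := h)) x"
  using T[unfolded multilinear_operator_def, THEN conjunct2, rule_format, OF admissible_tuples_simple]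
    assms by blast

text \<open>
  The empty sum, that is \<open>T\<close> of a tuple with a zero entry, is covered by linearity with coefficients \<open>0\<close>.
\<close>

lemma T_linear_sum:
  assumes f: "f \<in> admissible_tuples" and j: "j \<in> {1..m}" and fin: "finite I"
    and G: "\<And>i. i \<in> I \<Longrightarrow> G i \<in> simple_functions (\<mu> j)"
  shows "AE x in \<mu> 0. T (f(j := (\<lambda>y. \<Sum>i\<in>I. c i * G i y))) x = (\<Sum>i\<in>I. c i * T (f(j := G i)) x)"
  using fin G
proof (induction I)
  case empty
  show ?case
    using T_linear[OF f j admissible_tuplesD(2)[OF f j] admissible_tuplesD(2)[OF f j], of 0 0]
    by (simp only: mult_zero_left add_0_left sum.empty)
next
  case (insert i I)
  have G: "G k \<in> simple_functions (\<mu> j)" if "k \<in> insert i I" for k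
    using insert.prems that by blast
  have "(\<lambda>y. \<Sum>i\<in>I. c i * G i y) \<in> simple_functions (\<mu> j)"
  proof (rule simple_functions_sum[OF insert.hyps(1)])
    fix k assume "k \<in> I"
    then have *: "G k \<in> simple_functions (\<mu> j)" using G by blast
    have "G k x * indicator (space (\<mu> j)) x = G k x" for x
      using simple_functions_outside[OF *] by (cases "x \<in> space (\<mu> j)") auto
    then show "(\<lambda>y. c k * G k y) \<in> simple_functions (\<mu> j)"
      using simple_functions_cmult_indicator[OF *, of "space (\<mu> j)" "c k"] by (simp only: sets.top simp_thms)
  qed
  then have 1: "AE x in \<mu> 0. T (f(j := (\<lambda>y. c i * G i y + 1 * (\<Sum>i\<in>I. c i * G i y)))) x
     = c i * T (f(j := G i)) x + 1 * T (f(j := (\<lambda>y. \<Sum>i\<in>I. c i * G i y))) x"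
    by (intro T_linear f j G insertI1)
  have 2: "AE x in \<mu> 0. T (f(j := (\<lambda>y. \<Sum>i\<in>I. c i * G i y))) x = (\<Sum>i\<in>I. c i * T (f(j := G i)) x)"
    by (rule insert.IH) (rule G, blast)
  show ?case
    unfolding sum.insert[OF insert.hyps]
    using 1 2 by eventually_elim (simp only: mult_1_left)
qed

lemma T_split_indicator:
  assumes f: "f \<in> admissible_tuples" and j: "j \<in> {1..m}" and A: "A \<in> sets (\<mu> j)"
  shows "AE x in \<mu> 0. T f x = T (f(j := (\<lambda>y. f j y * indicator A y))) x
           + T (f(j := (\<lambda>y. f j y * indicator (space (\<mu> j) - A) y))) x"
proof -
  have s: "(\<lambda>y. f j y * indicator B y) \<in> simple_functions (\<mu> j)" if "B \<in> sets (\<mu> j)" for B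
    using admissible_indicator[OF admissible_tuplesD(1)[OF f j] j that] by (simp add: admissible_def)
  have eq: "(\<lambda>y. 1 * (f j y * indicator A y) + 1 * (f j y * indicator (space (\<mu> j) - A) y)) = f j"
  proof
    fix y
    show "1 * (f j y * indicator A y) + 1 * (f j y * indicator (space (\<mu> j) - A) y) = f j y"
      using simple_functions_outside[OF admissible_tuplesD(2)[OF f j], of y]
      by (cases "y \<in> space (\<mu> j)"; cases "y \<in> A") auto
  qed
  have "AE x in \<mu> 0. T (f(j := (\<lambda>y. 1 * (f j y * indicator A y) + 1 * (f j y * indicator (space (\<mu> j) - A) y)))) x
     = 1 * T (f(j := (\<lambda>y. f j y * indicator A y))) x
       + 1 * T (f(j := (\<lambda>y. f j y * indicator (space (\<mu> j) - A) y))) x"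
    by (intro T_linear f j s A sets.compl_sets)
  then show ?thesis unfolding eq by (simp only: fun_upd_triv mult_1_left)
qed

subsection \<open>The target space\<close>

text \<open>
  Representatives of the target weights that are finite and positive everywhere; the value \<open>1\<close> is taken
  on a null set only.
\<close>

definition target_w :: "'a \<Rightarrow> real" where
  "target_w x = (if 0 < w 0 x \<and> w 0 x < top then enn2real (w 0 x) else 1)"

definition target_v :: "'a \<Rightarrow> real" where
  "target_v x = (if 0 < v 0 x \<and> v 0 x < top then enn2real (v 0 x) else 1)"

sublocale target: weight_couple "\<mu> 0" target_w target_v "enn2real (p 0)" "enn2real (q 0)"
proof
  have [measurable]: "w 0 \<in> borel_measurable (\<mu> 0)" "v 0 \<in> borel_measurable (\<mu> 0)"
    by (auto intro: weights_measurable)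
  show "target_w \<in> borel_measurable (\<mu> 0)" "target_v \<in> borel_measurable (\<mu> 0)"
    unfolding target_w_def[abs_def] target_v_def[abs_def] by measurable
qed (use p[of 0] q[of 0] p0 q0 in \<open>auto simp: target_w_def target_v_def enn2real_positive_iff\<close>)

lemma target_weights: "AE x in \<mu> 0. w 0 x = ennreal (target_w x) \<and> v 0 x = ennreal (target_v x)
    \<and> u 0 x = ennreal (target.mid_wt \<theta> x)"
proof -
  have "AE x in \<mu> 0. 0 < w 0 x \<and> w 0 x < \<infinity>" "AE x in \<mu> 0. 0 < v 0 x \<and> v 0 x < \<infinity>"
    using w[of 0] v[of 0] by (auto simp: weight_def)
  then have "AE x in \<mu> 0. w 0 x = ennreal (target_w x) \<and> v 0 x = ennreal (target_v x)"
    by eventually_elim (simp add: target_w_def target_v_def)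
  then show ?thesis
  proof (rule AE_mp[OF _ AE_I2], intro impI conjI)
    fix x assume x: "x \<in> space (\<mu> 0)" and *: "w 0 x = ennreal (target_w x) \<and> v 0 x = ennreal (target_v x)"
    show "u 0 x = ennreal (target.mid_wt \<theta> x)"
      using u[of 0 x] x * target.a_pos[of x] target.b_pos[of x]
      by (simp add: ennpow_ennreal target.mid_wt_def less_imp_le ennreal_mult)
  qed blast+
qed

lemma target_exponent: "enn2real (r 0) = target.mid_exp \<theta>" "r 0 < top"
proof -
  have inv: "enn2real (1 / s) = 1 / enn2real s" if "0 < s" "s < top" for s :: ennreal
    using that by (cases s) (auto simp: divide_ennreal ennreal_1[symmetric] simp del: ennreal_1)
  show r0: "r 0 < top" using r_props(2)[of 0] p0 by (auto simp: less_top[symmetric])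
  have "1 / enn2real (r 0) = (1 - \<theta>) / enn2real (p 0) + \<theta> / enn2real (q 0)"
    using r_props(3)[of 0] inv[OF r_props(1) r0] inv[OF p p0] inv[OF q q0] by simp
  then have "1 / (1 / enn2real (r 0)) = target.mid_exp \<theta>"
    unfolding target.mid_exp_def by (rule arg_cong)
  then show "enn2real (r 0) = target.mid_exp \<theta>" by simp
qed

lemma wLp_norm_le_iff:
  assumes P: "0 < P" "P < top" and \<omega>: "AE x in M. \<omega> x = ennreal (c x)" and c: "\<And>x. 0 \<le> c x" and K: "0 \<le> K"
  shows "wLp_norm P M \<omega> g \<le> ennreal K \<longleftrightarrow>
    (\<integral>\<^sup>+x. ennreal ((cmod (g x) * c x) powr enn2real P) \<partial>M) \<le> ennreal (K powr enn2real P)"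
proof -
  have "(\<integral>\<^sup>+x. ennpow (ennreal (cmod (g x)) * \<omega> x) (enn2real P) \<partial>M)
      = (\<integral>\<^sup>+x. ennreal ((cmod (g x) * c x) powr enn2real P) \<partial>M)"
    using \<omega> by (intro nn_integral_cong_AE) (auto elim!: eventually_mono simp: c ennpow_ennreal simp flip: ennreal_mult)
  then show ?thesis
    unfolding wLp_norm_def Lp_norm_le_iff_integral[OF P] using K by (simp add: ennpow_ennreal)
qed

lemma target_norm_le_iff:
  assumes K: "0 \<le> K"
  shows "wLp_norm (p 0) (\<mu> 0) (w 0) g \<le> ennreal K \<longleftrightarrow>
      target.mid_int 0 (\<lambda>x. cmod (g x)) \<le> ennreal (K powr enn2real (p 0))"
    "wLp_norm (q 0) (\<mu> 0) (v 0) g \<le> ennreal K \<longleftrightarrow>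
      target.mid_int 1 (\<lambda>x. cmod (g x)) \<le> ennreal (K powr enn2real (q 0))"
    "wLp_norm (r 0) (\<mu> 0) (u 0) g \<le> ennreal K \<longleftrightarrow>
      target.mid_int \<theta> (\<lambda>x. cmod (g x)) \<le> ennreal (K powr target.mid_exp \<theta>)"
proof -
  show "wLp_norm (p 0) (\<mu> 0) (w 0) g \<le> ennreal K \<longleftrightarrow>
      target.mid_int 0 (\<lambda>x. cmod (g x)) \<le> ennreal (K powr enn2real (p 0))"
    unfolding target.mid_int_def target.mid_wt_0 target.mid_exp_0 using target_weights
    by (intro wLp_norm_le_iff K p0 p) (auto simp: less_imp_le target.a_pos)
  show "wLp_norm (q 0) (\<mu> 0) (v 0) g \<le> ennreal K \<longleftrightarrow>
      target.mid_int 1 (\<lambda>x. cmod (g x)) \<le> ennreal (K powr enn2real (q 0))"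
    unfolding target.mid_int_def target.mid_wt_1 target.mid_exp_1 using target_weights
    by (intro wLp_norm_le_iff K q0 q) (auto simp: less_imp_le target.b_pos)
  show "wLp_norm (r 0) (\<mu> 0) (u 0) g \<le> ennreal K \<longleftrightarrow>
      target.mid_int \<theta> (\<lambda>x. cmod (g x)) \<le> ennreal (K powr target.mid_exp \<theta>)"
    unfolding target.mid_int_def target_exponent(1)[symmetric] using target_weights
    by (intro wLp_norm_le_iff K target_exponent r_props) (auto simp: less_imp_le target.mid_wt_pos)
qed

lemma endpoint_bounds:
  assumes f: "f \<in> admissible_tuples"
  shows "wLp_norm (p 0) (\<mu> 0) (w 0) (T f) \<le> ennreal M1 * (\<Prod>j=1..m. wLp_norm (p j) (\<mu> j) (w j) (f j))"
    "wLp_norm (q 0) (\<mu> 0) (v 0) (T f) \<le> ennreal M2 * (\<Prod>j=1..m. wLp_norm (q j) (\<mu> j) (v j) (f j))"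
  using bound1 bound2 f by (auto simp: norm_bound_on_def)

text \<open>
  The images of admissible tuples are the coefficients of the exponential sums, so they must lie in both
  target spaces.
\<close>

lemma mid_int_T_finite:
  assumes f: "f \<in> admissible_tuples"
  shows "target.mid_int 0 (\<lambda>x. cmod (T f x)) < top" "target.mid_int 1 (\<lambda>x. cmod (T f x)) < top"
proof -
  have "(\<Prod>j=1..m. wLp_norm (p j) (\<mu> j) (w j) (f j)) < top" "(\<Prod>j=1..m. wLp_norm (q j) (\<mu> j) (v j) (f j)) < top"
    using admissible_tuplesD(4,5)[OF f] by (auto simp: less_top[symmetric] ennreal_prod_eq_top)
  then have "ennreal M1 * (\<Prod>j=1..m. wLp_norm (p j) (\<mu> j) (w j) (f j)) < top"
    "ennreal M2 * (\<Prod>j=1..m. wLp_norm (q j) (\<mu> j) (v j) (f j)) < top"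
    by (auto simp: ennreal_mult_less_top)
  note top = le_less_trans[OF endpoint_bounds(1)[OF f] this(1)] le_less_trans[OF endpoint_bounds(2)[OF f] this(2)]
  obtain K where K: "0 \<le> K" "wLp_norm (p 0) (\<mu> 0) (w 0) (T f) \<le> ennreal K"
    using top(1) by (cases "wLp_norm (p 0) (\<mu> 0) (w 0) (T f)") auto
  obtain K' where K': "0 \<le> K'" "wLp_norm (q 0) (\<mu> 0) (v 0) (T f) \<le> ennreal K'"
    using top(2) by (cases "wLp_norm (q 0) (\<mu> 0) (v 0) (T f)") auto
  show "target.mid_int 0 (\<lambda>x. cmod (T f x)) < top"
    by (rule le_less_trans[OF target_norm_le_iff(1)[THEN iffD1, OF K] ennreal_less_top])
  show "target.mid_int 1 (\<lambda>x. cmod (T f x)) < top"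
    by (rule le_less_trans[OF target_norm_le_iff(2)[THEN iffD1, OF K'] ennreal_less_top])
qed

section \<open>Interpolation for moduli bounded above and below\<close>

text \<open>
  The analytic family through the tuple \<open>f\<close> at \<open>z = s\<close>. Only the entries \<open>1, \<dots>, k\<close> vary with \<open>z\<close>, so that
  \<open>T\<close> of it can be expanded by induction on \<open>k\<close>.
\<close>

definition twist :: "(nat \<Rightarrow> 'a \<Rightarrow> real) \<Rightarrow> complex \<Rightarrow> nat \<Rightarrow> (nat \<Rightarrow> 'a \<Rightarrow> complex) \<Rightarrow> complex \<Rightarrow> nat \<Rightarrow> 'a \<Rightarrow> complex" where
  "twist L s k f z = (\<lambda>j. if j \<in> {1..k} then (\<lambda>x. f j x * exp (of_real (L j x) * (z - s))) else f j)"

lemma twist_admissible: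
  assumes f: "f \<in> admissible_tuples" and k: "k \<le> m"
    and L: "\<And>j. j \<in> {1..m} \<Longrightarrow> L j \<in> borel_measurable (\<mu> j)" "\<And>j. j \<in> {1..m} \<Longrightarrow> finite (range (L j))"
  shows "twist L s k f z \<in> admissible_tuples"
  unfolding admissible_tuples_eq
proof (rule PiE_I)
  fix j assume j: "j \<in> {1..m}"
  show "twist L s k f z j \<in> admissible j"
    using admissible_tuplesD(1)[OF f j]
      admissible_times_finite_range[OF admissible_tuplesD(1)[OF f j] j L(1)[OF j] L(2)[OF j],
        of "\<lambda>l. exp (of_real l * (z - s))"]
    by (simp add: twist_def)
next
  fix j assume j: "j \<notin> {1..m}"
  then have "f j = undefined" using f unfolding admissible_tuples_eq by (rule PiE_arb[rotated])
  then show "twist L s k f z j = undefined" using j k by (auto simp: twist_def)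
qed

definition regular_expansion :: "(real \<times> ('a \<Rightarrow> complex)) list \<Rightarrow> bool" where
  "regular_expansion h \<longleftrightarrow> (\<forall>(l, g)\<in>set h. g \<in> borel_measurable (\<mu> 0) \<and>
     target.mid_int 0 (\<lambda>x. cmod (g x)) < top \<and> target.mid_int 1 (\<lambda>x. cmod (g x)) < top)"

text \<open>
  The entry \<open>k + 1\<close> of the family is \<open>\<Sum>l. exp (l * z) * G l\<close>, where \<open>l\<close> runs over the values of the
  frequency and \<open>G l\<close> is independent of \<open>z\<close>. Linearity in this entry and the induction hypothesis for the
  tuples with \<open>G l\<close> in its place give exponential sums, whose frequencies are then shifted by \<open>l\<close>. The
  list \<open>h\<close> is the same for all \<open>z\<close>, whereas the exceptional null set may depend on \<open>z\<close>.
\<close>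

lemma T_twist_expansion:
  assumes L: "\<And>j. j \<in> {1..m} \<Longrightarrow> L j \<in> borel_measurable (\<mu> j)" "\<And>j. j \<in> {1..m} \<Longrightarrow> finite (range (L j))"
    and "f \<in> admissible_tuples" "k \<le> m"
  shows "\<exists>h. regular_expansion h \<and> (\<forall>z. AE x in \<mu> 0. T (twist L s k f z) x = expsum h z x)"
  using assms(3,4)
proof (induction k arbitrary: f)
  case 0
  have "twist L s 0 f z = f" for z by (simp add: twist_def)
  moreover have "regular_expansion [(0, T f)]"
    using T_measurable[OF 0(1)] mid_int_T_finite[OF 0(1)] by (simp add: regular_expansion_def)
  ultimately show ?case by (intro exI[of _ "[(0, T f)]"]) (simp add: expsum_Cons)
next
  case (Suc k)
  note f = Suc.prems(1)
  let ?j = "Suc k"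
  have j: "?j \<in> {1..m}" and k: "k \<le> m" using Suc.prems(2) by auto
  define \<Lambda> where "\<Lambda> = range (L ?j)"
  have \<Lambda>: "finite \<Lambda>" using L(2)[OF j] by (simp add: \<Lambda>_def)
  define G where "G l x = f ?j x * (if L ?j x = l then exp (- (of_real l * s)) else 0)" for l x
  have G: "G l \<in> admissible ?j" for l
    unfolding G_def[abs_def]
    using admissible_times_finite_range[OF admissible_tuplesD(1)[OF f j] j L(1)[OF j] L(2)[OF j],
        of "\<lambda>t. if t = l then exp (- (of_real l * s)) else 0"] .
  have "\<exists>hh. \<forall>l. regular_expansion (hh l) \<and>
      (\<forall>z. AE x in \<mu> 0. T (twist L s k (f(?j := G l)) z) x = expsum (hh l) z x)"
    using Suc.IH[OF admissible_tuples_upd[OF f j G] k] by (intro choice allI) blast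
  then obtain hh where reg: "\<And>l. regular_expansion (hh l)"
    and hh: "\<And>l z. AE x in \<mu> 0. T (twist L s k (f(?j := G l)) z) x = expsum (hh l) z x" by blast
  obtain ls where ls: "set ls = \<Lambda>" "distinct ls" using finite_distinct_list[OF \<Lambda>] by blast
  define h where "h = concat (map (\<lambda>l. map (\<lambda>(l', g). (l + l', g)) (hh l)) ls)"
  have "regular_expansion h"
    using reg unfolding regular_expansion_def h_def by fastforce
  moreover have "AE x in \<mu> 0. T (twist L s ?j f z) x = expsum h z x" for z
  proof -
    have upd: "twist L s k (f(?j := g)) z = (twist L s k f z)(?j := g)" for g
      by (auto simp: twist_def fun_eq_iff)
    have "twist L s ?j f z = (twist L s k f z)(?j := (\<lambda>x. \<Sum>l\<in>\<Lambda>. exp (of_real l * z) * G l x))"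
    proof
      fix i
      show "twist L s ?j f z i = ((twist L s k f z)(?j := (\<lambda>x. \<Sum>l\<in>\<Lambda>. exp (of_real l * z) * G l x))) i"
      proof (cases "i = ?j")
        case True
        have "f ?j x * exp (of_real (L ?j x) * (z - s)) = (\<Sum>l\<in>\<Lambda>. exp (of_real l * z) * G l x)" for x
        proof -
          have "(\<Sum>l\<in>\<Lambda>. exp (of_real l * z) * G l x) = (\<Sum>l\<in>{L ?j x}. exp (of_real l * z) * G l x)"
            using \<Lambda> by (intro sum.mono_neutral_right) (auto simp: \<Lambda>_def G_def)
          also have "\<dots> = f ?j x * (exp (of_real (L ?j x) * z) * exp (- (of_real (L ?j x) * s)))"
            by (simp add: G_def)
          finally show ?thesis by (simp add: mult_exp_exp right_diff_distrib)
        qed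
        then show ?thesis using True by (simp add: twist_def)
      qed (auto simp: twist_def)
    qed
    then have "AE x in \<mu> 0. T (twist L s ?j f z) x
        = (\<Sum>l\<in>\<Lambda>. exp (of_real l * z) * T ((twist L s k f z)(?j := G l)) x)"
      using T_linear_sum[OF twist_admissible[OF f k L] j \<Lambda>, where G = G and c = "\<lambda>l. exp (of_real l * z)"] G
      by (simp only: admissible_def mem_Collect_eq)
    moreover have "AE x in \<mu> 0. \<forall>l\<in>\<Lambda>. T ((twist L s k f z)(?j := G l)) x = expsum (hh l) z x"
      by (intro AE_finite_allI \<Lambda> hh[where z = z, unfolded upd])
    ultimately show ?thesis
    proof eventually_elim
      case (elim x)
      have "T (twist L s ?j f z) x = (\<Sum>l\<in>\<Lambda>. exp (of_real l * z) * expsum (hh l) z x)"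
        unfolding elim(1) using elim(2) by (intro sum.cong refl arg_cong2[where f = "(*)"]) blast+
      also have "\<dots> = expsum h z x"
        using ls by (simp add: h_def expsum_concat expsum_shift o_def sum_list_distinct_conv_sum_set)
      finally show ?case .
    qed
  qed
  ultimately show ?case by blast
qed

definition log_bounded_pair :: "nat \<Rightarrow> ('a \<Rightarrow> complex) \<Rightarrow> bool" where
  "log_bounded_pair j f \<longleftrightarrow> log_bounded (\<mu> j) (w j) f \<and> log_bounded (\<mu> j) (v j) f"

text \<open>
  On the support of \<open>f\<close>, a set of finite measure, \<open>\<bar>f\<bar> * u\<close> is bounded.
\<close>

lemma mid_norm_finite:
  assumes f: "f \<in> admissible j" and j: "j \<in> {1..m}" and good: "log_bounded_pair j f"
  shows "wLp_norm (r j) (\<mu> j) (u j) f < top"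
proof -
  have j0: "j \<in> {0..m}" using j by auto
  have fs: "f \<in> simple_functions (\<mu> j)" using f by (simp add: admissible_def)
  note [measurable] = simple_functions_measurable[OF fs] weights_measurable[OF j0]
  obtain kw where kw: "0 \<le> kw"
    "\<And>x. x \<in> space (\<mu> j) \<Longrightarrow> f x \<noteq> 0 \<Longrightarrow> 0 < cmod (f x) * enn2real (w j x)
       \<and> \<bar>ln (cmod (f x) * enn2real (w j x))\<bar> \<le> kw"
    "\<And>x. x \<in> space (\<mu> j) \<Longrightarrow> f x \<noteq> 0 \<Longrightarrow> w j x = ennreal (enn2real (w j x))"
    using good log_boundedE[of "\<mu> j" "w j" f] by (auto simp: log_bounded_pair_def)
  obtain kv where kv: "0 \<le> kv"
    "\<And>x. x \<in> space (\<mu> j) \<Longrightarrow> f x \<noteq> 0 \<Longrightarrow> 0 < cmod (f x) * enn2real (v j x)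
       \<and> \<bar>ln (cmod (f x) * enn2real (v j x))\<bar> \<le> kv"
    "\<And>x. x \<in> space (\<mu> j) \<Longrightarrow> f x \<noteq> 0 \<Longrightarrow> v j x = ennreal (enn2real (v j x))"
    using good log_boundedE[of "\<mu> j" "v j" f] by (auto simp: log_bounded_pair_def)
  obtain A where A: "A \<in> fmeasurable (\<mu> j)" "\<And>x. f x \<noteq> 0 \<Longrightarrow> x \<in> A"
    using simple_functions_support[OF fs] by blast
  have [measurable]: "A \<in> sets (\<mu> j)" using A by auto
  define K where "K = exp (kw + kv)"
  have K: "0 < K" by (simp add: K_def)
  have le: "ennreal (cmod (f x)) * u j x \<le> ennreal (K * indicator A x)" if x: "x \<in> space (\<mu> j)" for x
  proof (cases "f x = 0")
    case False
    let ?W = "cmod (f x) * enn2real (w j x)" and ?V = "cmod (f x) * enn2real (v j x)"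
    have W: "0 < ?W" "\<bar>ln ?W\<bar> \<le> kw" and V: "0 < ?V" "\<bar>ln ?V\<bar> \<le> kv"
      using kw(2)[OF x False] kv(2)[OF x False] by blast+
    have "\<bar>(1 - \<theta>) * ln ?W\<bar> \<le> 1 * kw" "\<bar>\<theta> * ln ?V\<bar> \<le> 1 * kv"
      unfolding abs_mult using W(2) V(2) \<theta> kw(1) kv(1) by (intro mult_mono; simp)+
    then have "(1 - \<theta>) * ln ?W \<le> kw" "\<theta> * ln ?V \<le> kv" by linarith+
    then have "exp ((1 - \<theta>) * ln ?W + \<theta> * ln ?V) \<le> K" by (simp only: K_def exp_le_cancel_iff)
    moreover have "?W powr (1 - \<theta>) * ?V powr \<theta> = exp ((1 - \<theta>) * ln ?W + \<theta> * ln ?V)"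
      using W(1) V(1) unfolding powr_def by (simp only: less_imp_neq[symmetric] if_False exp_add)
    ultimately have "?W powr (1 - \<theta>) * ?V powr \<theta> \<le> K * indicator A x"
      using A(2)[OF False] by simp
    moreover have "ennreal (cmod (f x)) * u j x = ennreal (?W powr (1 - \<theta>) * ?V powr \<theta>)"
      by (rule interpolated_modulus[where M = "\<mu> j"]) (auto intro: u[OF j0] kw(3) kv(3) x)
    ultimately show ?thesis by (simp only: ennreal_leI)
  qed simp
  have "wLp_norm (r j) (\<mu> j) (u j) f \<le> Lp_norm (r j) (\<mu> j) (\<lambda>x. ennreal (K * indicator A x))"
    unfolding wLp_norm_def using le by (intro Lp_norm_mono_AE r_props j0) auto
  also have "\<dots> < top"
  proof (cases "r j = top")
    case True
    have "Lp_norm top (\<mu> j) (\<lambda>x. ennreal (K * indicator A x)) \<le> ennreal K"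
      using K by (subst Lp_norm_infinity_le_iff) (auto simp: indicator_def)
    then show ?thesis unfolding True by (rule le_less_trans) simp
  next
    case False
    have "(\<integral>\<^sup>+x. ennpow (ennreal (K * indicator A x)) (enn2real (r j)) \<partial>\<mu> j)
        = (\<integral>\<^sup>+x. ennreal (K powr enn2real (r j)) * indicator A x \<partial>\<mu> j)"
      using K by (intro nn_integral_cong) (auto simp: indicator_def ennpow_ennreal)
    also have "\<dots> = ennreal (K powr enn2real (r j)) * emeasure (\<mu> j) A"
      by (simp add: nn_integral_cmult_indicator)
    also have "\<dots> < top" using A(1) by (auto simp: fmeasurable_def ennreal_mult_less_top)
    finally show ?thesis using False by (simp add: Lp_norm_def)
  qed
  finally show ?thesis .
qed

text \<open>
  The core case: the three lines theorem applied to \<open>T\<close> of the extremal families. Each of the \<open>m\<close> entries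
  contributes an error \<open>\<epsilon>\<close> to the logarithm of the norm, and \<open>\<epsilon>\<close> tends to zero at the end. Entries of
  norm zero, which admit no normalisation, are treated in \<open>interpolated_bound_of_zero\<close>.
\<close>

lemma bound_of_log_bounded:
  assumes f: "f \<in> admissible_tuples" and good: "\<And>j. j \<in> {1..m} \<Longrightarrow> log_bounded_pair j (f j)"
    and pos: "\<And>j. j \<in> {1..m} \<Longrightarrow> wLp_norm (r j) (\<mu> j) (u j) (f j) \<noteq> 0"
  shows "wLp_norm (r 0) (\<mu> 0) (u 0) (T f)
    \<le> ennreal (M1 powr (1 - \<theta>) * M2 powr \<theta>) * (\<Prod>j=1..m. wLp_norm (r j) (\<mu> j) (u j) (f j))"
proof -
  define R where "R j = enn2real (wLp_norm (r j) (\<mu> j) (u j) (f j))" for j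
  have R: "wLp_norm (r j) (\<mu> j) (u j) (f j) = ennreal (R j)" "0 < R j" if j: "j \<in> {1..m}" for j
    using mid_norm_finite[OF admissible_tuplesD(1)[OF f j] j good[OF j]] pos[OF j]
    by (auto simp: R_def enn2real_positive_iff zero_less_iff_neq_zero)
  define B where "B \<epsilon> = (\<Sum>j=1..m. \<epsilon> + ln (R j))" for \<epsilon> :: real
  have key: "target.mid_int \<theta> (\<lambda>x. cmod (T f x))
      \<le> ennreal (exp (target.mid_exp \<theta> * ((1 - \<theta>) * (ln M1 + B \<epsilon>) + \<theta> * (ln M2 + B \<epsilon>))))"
    if \<epsilon>: "0 < \<epsilon>" for \<epsilon>
  proof -
    define good_frequency where "good_frequency j L \<Lambda> \<longleftrightarrow>
      L \<in> borel_measurable (\<mu> j) \<and> finite (range L) \<and> 0 \<le> \<Lambda> \<and>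
      (\<forall>z\<in>strip. wLp_norm (p j) (\<mu> j) (w j) (\<lambda>x. f j x * exp (of_real (L x) * (z - of_real \<theta>)))
        \<le> ennreal (exp (\<epsilon> + \<Lambda> * Re z) * R j)) \<and>
      (\<forall>z\<in>strip. wLp_norm (q j) (\<mu> j) (v j) (\<lambda>x. f j x * exp (of_real (L x) * (z - of_real \<theta>)))
        \<le> ennreal (exp (\<epsilon> + \<Lambda> * (1 - Re z)) * R j))" for j L \<Lambda>
    have "\<exists>L \<Lambda>. good_frequency j L \<Lambda>" if j: "j \<in> {1..m}" for j
    proof -
      have j0: "j \<in> {0..m}" using j by auto
      have lb: "log_bounded (\<mu> j) (w j) (f j)" "log_bounded (\<mu> j) (v j) (f j)"
        using good[OF j] by (auto simp: log_bounded_pair_def)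
      obtain L \<Lambda> where "L \<in> borel_measurable (\<mu> j)" "finite (range L)" "0 \<le> \<Lambda>"
        "\<And>z. z \<in> strip \<Longrightarrow> wLp_norm (p j) (\<mu> j) (w j) (\<lambda>x. f j x * exp (of_real (L x) * (z - of_real \<theta>)))
           \<le> ennreal (exp (\<epsilon> + \<Lambda> * Re z) * R j)"
        "\<And>z. z \<in> strip \<Longrightarrow> wLp_norm (q j) (\<mu> j) (v j) (\<lambda>x. f j x * exp (of_real (L x) * (z - of_real \<theta>)))
           \<le> ennreal (exp (\<epsilon> + \<Lambda> * (1 - Re z)) * R j)"
        using extremal_frequency[OF admissible_tuplesD(3)[OF f j] weights_measurable(1,2)[OF j0] lb
            p[OF j0] q[OF j0] r_props(1)[OF j0] \<theta> r_props(3,2)[OF j0] u[OF j0] R[OF j] \<epsilon>] by blast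
      then show ?thesis unfolding good_frequency_def by blast
    qed
    then have "\<exists>L. \<forall>j\<in>{1..m}. \<exists>\<Lambda>. good_frequency j (L j) \<Lambda>" by (intro bchoice) blast
    then obtain L where "\<forall>j\<in>{1..m}. \<exists>\<Lambda>. good_frequency j (L j) \<Lambda>" ..
    then have "\<exists>\<Lambda>. \<forall>j\<in>{1..m}. good_frequency j (L j) (\<Lambda> j)" by (rule bchoice)
    then obtain \<Lambda> where good_freq: "\<And>j. j \<in> {1..m} \<Longrightarrow> good_frequency j (L j) (\<Lambda> j)" by blast
    have L: "\<And>j. j \<in> {1..m} \<Longrightarrow> L j \<in> borel_measurable (\<mu> j)"
      "\<And>j. j \<in> {1..m} \<Longrightarrow> finite (range (L j))" and \<Lambda>: "\<And>j. j \<in> {1..m} \<Longrightarrow> 0 \<le> \<Lambda> j"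
      and Lw: "\<And>j z. j \<in> {1..m} \<Longrightarrow> z \<in> strip \<Longrightarrow>
        wLp_norm (p j) (\<mu> j) (w j) (\<lambda>x. f j x * exp (of_real (L j x) * (z - of_real \<theta>)))
          \<le> ennreal (exp (\<epsilon> + \<Lambda> j * Re z) * R j)"
      and Lv: "\<And>j z. j \<in> {1..m} \<Longrightarrow> z \<in> strip \<Longrightarrow>
        wLp_norm (q j) (\<mu> j) (v j) (\<lambda>x. f j x * exp (of_real (L j x) * (z - of_real \<theta>)))
          \<le> ennreal (exp (\<epsilon> + \<Lambda> j * (1 - Re z)) * R j)"
      using good_freq unfolding good_frequency_def by blast+
    define F where "F z = twist L (of_real \<theta>) m f z" for z
    have F: "F z \<in> admissible_tuples" for z
      unfolding F_def by (rule twist_admissible[OF f order_refl L])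
    have Fj: "F z j = (\<lambda>x. f j x * exp (of_real (L j x) * (z - of_real \<theta>)))" if "j \<in> {1..m}" for z j
      using that by (simp add: F_def twist_def)
    have F\<theta>: "F (of_real \<theta>) = f" by (auto simp: F_def twist_def)
    obtain h where h: "regular_expansion h" and Th: "\<And>z. AE x in \<mu> 0. T (F z) x = expsum h z x"
      using T_twist_expansion[OF L f order_refl] unfolding F_def by blast
    have mid: "target.mid_int \<sigma> (\<lambda>x. cmod (expsum h z x)) = target.mid_int \<sigma> (\<lambda>x. cmod (T (F z) x))" for \<sigma> z
      by (rule target.mid_int_cong_AE) (use Th[of z] in \<open>auto elim: eventually_mono\<close>)
    define C where "C = (\<Sum>j=1..m. \<Lambda> j)"
    have prod_exp: "M * (\<Prod>j=1..m. exp (\<epsilon> + \<Lambda> j * t) * R j) = exp (ln M + B \<epsilon> + C * t)" if "0 < M" for M t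
    proof -
      have "(\<Prod>j=1..m. exp (\<epsilon> + \<Lambda> j * t) * R j) = (\<Prod>j=1..m. exp ((\<epsilon> + ln (R j)) + \<Lambda> j * t))"
        using R(2) by (intro prod.cong refl) (simp add: exp_add)
      also have "\<dots> = exp (B \<epsilon> + C * t)"
        by (simp only: exp_sum[symmetric] finite_atLeastAtMost sum.distrib[of "\<lambda>j. \<epsilon> + ln (R j)"] B_def C_def sum_distrib_right)
      finally show ?thesis using that by (simp add: exp_add)
    qed
    have b0: "target.mid_int 0 (\<lambda>x. cmod (expsum h z x))
        \<le> ennreal (exp (enn2real (p 0) * ((ln M1 + B \<epsilon>) + C * Re z)))" if z: "z \<in> strip" for z
    proof -
      have "wLp_norm (p 0) (\<mu> 0) (w 0) (T (F z)) \<le> ennreal M1 * (\<Prod>j=1..m. wLp_norm (p j) (\<mu> j) (w j) (F z j))"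
        by (rule endpoint_bounds[OF F])
      also have "\<dots> \<le> ennreal M1 * (\<Prod>j=1..m. ennreal (exp (\<epsilon> + \<Lambda> j * Re z) * R j))"
        using Lw[OF _ z] by (intro mult_left_mono prod_mono_ennreal) (auto simp: Fj)
      also have "\<dots> = ennreal (M1 * (\<Prod>j=1..m. exp (\<epsilon> + \<Lambda> j * Re z) * R j))"
        using M1 R(2) by (intro ennreal_cmult_prod) (auto simp: less_imp_le)
      also have "\<dots> = ennreal (exp (ln M1 + B \<epsilon> + C * Re z))" by (simp only: prod_exp[OF M1])
      finally show ?thesis
        unfolding mid by (subst (asm) target_norm_le_iff) (simp_all add: exp_powr_real mult.commute)
    qed
    have b1: "target.mid_int 1 (\<lambda>x. cmod (expsum h z x))
        \<le> ennreal (exp (enn2real (q 0) * ((ln M2 + B \<epsilon>) + C * (1 - Re z))))" if z: "z \<in> strip" for z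
    proof -
      have "wLp_norm (q 0) (\<mu> 0) (v 0) (T (F z)) \<le> ennreal M2 * (\<Prod>j=1..m. wLp_norm (q j) (\<mu> j) (v j) (F z j))"
        by (rule endpoint_bounds[OF F])
      also have "\<dots> \<le> ennreal M2 * (\<Prod>j=1..m. ennreal (exp (\<epsilon> + \<Lambda> j * (1 - Re z)) * R j))"
        using Lv[OF _ z] by (intro mult_left_mono prod_mono_ennreal) (auto simp: Fj)
      also have "\<dots> = ennreal (M2 * (\<Prod>j=1..m. exp (\<epsilon> + \<Lambda> j * (1 - Re z)) * R j))"
        using M2 R(2) by (intro ennreal_cmult_prod) (auto simp: less_imp_le)
      also have "\<dots> = ennreal (exp (ln M2 + B \<epsilon> + C * (1 - Re z)))" by (simp only: prod_exp[OF M2])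
      finally show ?thesis
        unfolding mid by (subst (asm) target_norm_le_iff) (simp_all add: exp_powr_real mult.commute)
    qed
    have reg: "g \<in> borel_measurable (\<mu> 0)" "target.mid_int 0 (\<lambda>x. cmod (g x)) < top"
      "target.mid_int 1 (\<lambda>x. cmod (g x)) < top" if "(l, g) \<in> set h" for l g
      using h that by (auto simp: regular_expansion_def)
    have "target.mid_int (Re (of_real \<theta>)) (\<lambda>x. cmod (expsum h (of_real \<theta>) x))
      \<le> ennreal (exp (target.mid_exp (Re (of_real \<theta>)) *
          ((1 - Re (of_real \<theta>)) * (ln M1 + B \<epsilon>) + Re (of_real \<theta>) * (ln M2 + B \<epsilon>))))"
    proof (rule target.expsum_three_lines[OF reg(1) _ _ _ b0 b1])
      show "target.mid_int 0 (coeff_sum h) < \<infinity>" "target.mid_int 1 (coeff_sum h) < \<infinity>"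
        using target.mid_int_coeff_sum_finite[of h 0] target.mid_int_coeff_sum_finite[of h 1] reg by auto
      show "0 \<le> C" unfolding C_def using \<Lambda> by (intro sum_nonneg) auto
      show "complex_of_real \<theta> \<in> strip" using \<theta> by (simp add: strip_def)
    qed
    then show ?thesis unfolding mid F\<theta> by simp
  qed
  have "target.mid_int \<theta> (\<lambda>x. cmod (T f x))
    \<le> ennreal (exp (target.mid_exp \<theta> * ((1 - \<theta>) * (ln M1 + B 0) + \<theta> * (ln M2 + B 0))))"
  proof (rule tendsto_lowerbound)
    show "((\<lambda>\<epsilon>. ennreal (exp (target.mid_exp \<theta> * ((1 - \<theta>) * (ln M1 + B \<epsilon>) + \<theta> * (ln M2 + B \<epsilon>)))))
      \<longlongrightarrow> ennreal (exp (target.mid_exp \<theta> * ((1 - \<theta>) * (ln M1 + B 0) + \<theta> * (ln M2 + B 0))))) (at_right 0)"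
      unfolding B_def by (intro tendsto_intros)
    show "\<forall>\<^sub>F \<epsilon> in at_right 0. target.mid_int \<theta> (\<lambda>x. cmod (T f x))
      \<le> ennreal (exp (target.mid_exp \<theta> * ((1 - \<theta>) * (ln M1 + B \<epsilon>) + \<theta> * (ln M2 + B \<epsilon>))))"
      using key by (intro eventually_at_rightI[of 0 1]) auto
  qed simp
  moreover define K where "K = M1 powr (1 - \<theta>) * M2 powr \<theta> * (\<Prod>j=1..m. R j)"
  have K: "K = exp ((1 - \<theta>) * (ln M1 + B 0) + \<theta> * (ln M2 + B 0))"
  proof -
    have "(\<Prod>j=1..m. R j) = exp (B 0)" using R(2) by (simp add: B_def exp_sum)
    then have "K = exp ((1 - \<theta>) * ln M1 + \<theta> * ln M2 + B 0)"
      using M1 M2 by (simp add: K_def powr_def exp_add)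
    also have "(1 - \<theta>) * ln M1 + \<theta> * ln M2 + B 0 = (1 - \<theta>) * (ln M1 + B 0) + \<theta> * (ln M2 + B 0)"
      by (simp add: algebra_simps)
    finally show ?thesis .
  qed
  ultimately have "target.mid_int \<theta> (\<lambda>x. cmod (T f x)) \<le> ennreal (K powr target.mid_exp \<theta>)"
    by (simp add: exp_powr_real mult.commute)
  then have "wLp_norm (r 0) (\<mu> 0) (u 0) (T f) \<le> ennreal K"
    by (subst target_norm_le_iff) (simp_all add: K)
  also have "ennreal K = ennreal (M1 powr (1 - \<theta>) * M2 powr \<theta>) * (\<Prod>j=1..m. ennreal (R j))"
    using R(2) unfolding K_def by (intro ennreal_cmult_prod[symmetric]) (auto simp: less_imp_le)
  also have "(\<Prod>j=1..m. ennreal (R j)) = (\<Prod>j=1..m. wLp_norm (r j) (\<mu> j) (u j) (f j))"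
    using R(1) by (intro prod.cong) auto
  finally show ?thesis .
qed

section \<open>Removal of the bounds on the moduli\<close>

definition interpolated_bound :: "(nat \<Rightarrow> 'a \<Rightarrow> complex) \<Rightarrow> bool" where
  "interpolated_bound f \<longleftrightarrow> wLp_norm (r 0) (\<mu> 0) (u 0) (T f)
    \<le> ennreal (M1 powr (1 - \<theta>) * M2 powr \<theta>) * (\<Prod>j=1..m. wLp_norm (r j) (\<mu> j) (u j) (f j))"

text \<open>
  The weight \<open>u j\<close> is positive wherever \<open>f j\<close> does not vanish, so \<open>f j\<close> is zero almost everywhere, and the
  first endpoint bound shows that \<open>T f\<close> is zero almost everywhere as well.
\<close>

lemma interpolated_bound_of_zero:
  assumes f: "f \<in> admissible_tuples" and j: "j \<in> {1..m}" and good: "log_bounded_pair j (f j)"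
    and zero: "wLp_norm (r j) (\<mu> j) (u j) (f j) = 0"
  shows "interpolated_bound f"
proof -
  have j0: "j \<in> {0..m}" and 0: "(0::nat) \<in> {0..m}" using j by auto
  note [measurable] = admissible_tuplesD(3)[OF f j] weights_measurable[OF j0] weights_measurable[OF 0]
    T_measurable[OF f]
  have "AE x in \<mu> j. ennreal (cmod (f j x)) * u j x = 0"
    using zero Lp_norm_eq_0_iff[OF _ r_props(1)[OF j0], of "\<lambda>x. ennreal (cmod (f j x)) * u j x" "\<mu> j"]
    by (simp add: wLp_norm_def)
  then have "AE x in \<mu> j. f j x = 0"
  proof (rule AE_mp[OF _ AE_I2], intro impI)
    fix x assume x: "x \<in> space (\<mu> j)" and 0: "ennreal (cmod (f j x)) * u j x = 0"
    show "f j x = 0"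
    proof (rule ccontr)
      assume nz: "f j x \<noteq> 0"
      have lb: "log_bounded (\<mu> j) (w j) (f j)" "log_bounded (\<mu> j) (v j) (f j)"
        using good by (auto simp: log_bounded_pair_def)
      note kw = log_bounded_pointwise[OF lb(1) x nz] and kv = log_bounded_pointwise[OF lb(2) x nz]
      have "ennreal (cmod (f j x)) * u j x = ennreal ((cmod (f j x) * enn2real (w j x)) powr (1 - \<theta>)
           * (cmod (f j x) * enn2real (v j x)) powr \<theta>)"
        by (rule interpolated_modulus[where M = "\<mu> j"]) (auto intro: u[OF j0] kw(2) kv(2) x)
      moreover have pos: "0 < (cmod (f j x) * enn2real (w j x)) powr (1 - \<theta>) * (cmod (f j x) * enn2real (v j x)) powr \<theta>"
        using kw(1) kv(1) by (intro mult_pos_pos) (simp_all only: powr_gt_zero less_imp_neq[symmetric] not_False_eq_True)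
      then have "ennreal ((cmod (f j x) * enn2real (w j x)) powr (1 - \<theta>)
          * (cmod (f j x) * enn2real (v j x)) powr \<theta>) \<noteq> 0"
        unfolding ennreal_eq_0_iff not_le .
      ultimately show False using 0 by (simp only:)
    qed
  qed
  then have "wLp_norm (p j) (\<mu> j) (w j) (f j) = 0"
    unfolding wLp_norm_def
    by (subst Lp_norm_eq_0_iff[OF _ p[OF j0]]) (auto elim: eventually_mono)
  then have "(\<Prod>j=1..m. wLp_norm (p j) (\<mu> j) (w j) (f j)) = 0" using j by (intro prod_zero) auto
  then have "wLp_norm (p 0) (\<mu> 0) (w 0) (T f) = 0"
    using endpoint_bounds(1)[OF f] by (simp only: mult_zero_right le_zero_eq)
  then have "AE x in \<mu> 0. ennreal (cmod (T f x)) * w 0 x = 0"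
    using Lp_norm_eq_0_iff[OF _ p[OF 0], of "\<lambda>x. ennreal (cmod (T f x)) * w 0 x" "\<mu> 0"]
    by (simp add: wLp_norm_def)
  then have "AE x in \<mu> 0. ennreal (cmod (T f x)) * u 0 x = 0"
    using target_weights
  proof eventually_elim
    case (elim x)
    then have "T f x = 0" using target.a_pos[of x] by (auto simp: not_less[symmetric])
    then show ?case by simp
  qed
  then have "wLp_norm (r 0) (\<mu> 0) (u 0) (T f) = 0"
    unfolding wLp_norm_def by (subst Lp_norm_eq_0_iff[OF _ r_props(1)[OF 0]]) auto
  then show ?thesis by (simp add: interpolated_bound_def)
qed

text \<open>
  Both endpoint norms of \<open>g\<close> are bounded by those of \<open>f j\<close>, and one of them is small. By the endpoint
  bounds the same holds for the image, and Hoelder's inequality between the endpoints makes its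
  intermediate norm small, because \<open>\<theta>\<close> and \<open>1 - \<theta>\<close> are both positive.
\<close>

lemma T_tail_small:
  assumes f: "f \<in> admissible_tuples" and j: "j \<in> {1..m}" and e: "0 < e"
  obtains \<delta> where "0 < \<delta>"
    "\<And>g. g \<in> admissible j \<Longrightarrow> (\<And>x. cmod (g x) \<le> cmod (f j x)) \<Longrightarrow>
       wLp_norm (p j) (\<mu> j) (w j) g \<le> ennreal \<delta> \<or> wLp_norm (q j) (\<mu> j) (v j) g \<le> ennreal \<delta> \<Longrightarrow>
       target.mid_int \<theta> (\<lambda>x. cmod (T (f(j := g)) x)) \<le> ennreal (e powr target.mid_exp \<theta>)"
proof -
  have j0: "j \<in> {0..m}" using j by auto
  define P where "P = ennreal M1 * (\<Prod>i\<in>{1..m} - {j}. wLp_norm (p i) (\<mu> i) (w i) (f i))"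
  define Q where "Q = ennreal M2 * (\<Prod>i\<in>{1..m} - {j}. wLp_norm (q i) (\<mu> i) (v i) (f i))"
  define K where "K = max 1 (Max {enn2real P, enn2real Q,
    enn2real (wLp_norm (p j) (\<mu> j) (w j) (f j)), enn2real (wLp_norm (q j) (\<mu> j) (v j) (f j))})"
  have "(\<Prod>i\<in>{1..m} - {j}. wLp_norm (p i) (\<mu> i) (w i) (f i)) < top"
    "(\<Prod>i\<in>{1..m} - {j}. wLp_norm (q i) (\<mu> i) (v i) (f i)) < top"
    using admissible_tuplesD(4,5)[OF f] by (auto simp: less_top[symmetric] ennreal_prod_eq_top)
  then have PQ: "P < top" "Q < top"
    by (auto simp: P_def Q_def ennreal_mult_less_top)
  have le_K: "y \<le> ennreal K" if "y < top" "enn2real y \<le> K" for y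
    using that by (cases y) (auto intro: ennreal_leI)
  have K: "1 \<le> K" "P \<le> ennreal K" "Q \<le> ennreal K"
    "wLp_norm (p j) (\<mu> j) (w j) (f j) \<le> ennreal K" "wLp_norm (q j) (\<mu> j) (v j) (f j) \<le> ennreal K"
  proof -
    have "enn2real P \<le> K" "enn2real Q \<le> K" "enn2real (wLp_norm (p j) (\<mu> j) (w j) (f j)) \<le> K"
      "enn2real (wLp_norm (q j) (\<mu> j) (v j) (f j)) \<le> K"
      unfolding K_def by (intro max.coboundedI2 Max_ge; simp)+
    then show "P \<le> ennreal K" "Q \<le> ennreal K"
      "wLp_norm (p j) (\<mu> j) (w j) (f j) \<le> ennreal K" "wLp_norm (q j) (\<mu> j) (v j) (f j) \<le> ennreal K"
      using PQ admissible_tuplesD(4,5)[OF f j] le_K by blast+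
  qed (simp add: K_def)
  \<comment> \<open>\<open>K\<close> bounds the contribution of the other entries as well as both norms of \<open>f j\<close>. Thus the logarithm of
    the intermediate norm is at most \<open>2 * k - t * X\<close>, where \<open>exp (- X)\<close> is the small norm.\<close>
  define k where "k = ln K"
  have k: "0 \<le> k" "ennreal K = ennreal (exp k)" using K(1) by (auto simp: k_def)
  define t where "t = min \<theta> (1 - \<theta>)"
  have t: "0 < t" "t \<le> \<theta>" "t \<le> 1 - \<theta>" using \<theta> by (auto simp: t_def)
  define X where "X = max 0 ((2 * k - ln e) / t)"
  have X: "0 \<le> X" "2 * k - ln e \<le> t * X"
  proof -
    have "(2 * k - ln e) / t \<le> X" by (simp add: X_def)
    then show "2 * k - ln e \<le> t * X" using t by (simp add: pos_divide_le_eq mult.commute)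
  qed (simp add: X_def)
  show ?thesis
  proof (rule that[of "exp (- X)"])
    fix g assume g: "g \<in> admissible j" and le: "\<And>x. cmod (g x) \<le> cmod (f j x)"
      and small: "wLp_norm (p j) (\<mu> j) (w j) g \<le> ennreal (exp (- X)) \<or> wLp_norm (q j) (\<mu> j) (v j) g \<le> ennreal (exp (- X))"
    have g_meas: "g \<in> borel_measurable (\<mu> j)"
      using g by (auto simp: admissible_def intro: simple_functions_measurable)
    note fg = admissible_tuples_upd[OF f j g]
    have *: "target.mid_int \<theta> (\<lambda>x. cmod (T (f(j := g)) x)) \<le> ennreal (e powr target.mid_exp \<theta>)"
      if a: "wLp_norm (p j) (\<mu> j) (w j) g \<le> ennreal (exp a)" and b: "wLp_norm (q j) (\<mu> j) (v j) g \<le> ennreal (exp b)"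
        and ab: "k + (1 - \<theta>) * a + \<theta> * b \<le> ln e" for a b
    proof -
      have "wLp_norm (p 0) (\<mu> 0) (w 0) (T (f(j := g)))
          \<le> ennreal M1 * (\<Prod>i=1..m. wLp_norm (p i) (\<mu> i) (w i) ((f(j := g)) i))"
        by (rule endpoint_bounds[OF fg])
      also have "\<dots> = P * wLp_norm (p j) (\<mu> j) (w j) g"
        using j by (simp add: P_def prod.remove mult_ac)
      also have "\<dots> \<le> ennreal (exp k) * ennreal (exp a)"
        using K(2) a k(2) by (intro mult_mono) auto
      also have "\<dots> = ennreal (exp (k + a))" by (simp add: mult_exp_exp flip: ennreal_mult)
      finally have 0: "target.mid_int 0 (\<lambda>x. cmod (T (f(j := g)) x)) \<le> ennreal (exp (enn2real (p 0) * (k + a)))"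
        by (subst (asm) target_norm_le_iff) (simp_all add: exp_powr_real mult.commute)
      have "wLp_norm (q 0) (\<mu> 0) (v 0) (T (f(j := g)))
          \<le> ennreal M2 * (\<Prod>i=1..m. wLp_norm (q i) (\<mu> i) (v i) ((f(j := g)) i))"
        by (rule endpoint_bounds[OF fg])
      also have "\<dots> = Q * wLp_norm (q j) (\<mu> j) (v j) g"
        using j by (simp add: Q_def prod.remove mult_ac)
      also have "\<dots> \<le> ennreal (exp k) * ennreal (exp b)"
        using K(3) b k(2) by (intro mult_mono) auto
      also have "\<dots> = ennreal (exp (k + b))" by (simp add: mult_exp_exp flip: ennreal_mult)
      finally have 1: "target.mid_int 1 (\<lambda>x. cmod (T (f(j := g)) x)) \<le> ennreal (exp (enn2real (q 0) * (k + b)))"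
        by (subst (asm) target_norm_le_iff) (simp_all add: exp_powr_real mult.commute)
      have "target.mid_int \<theta> (\<lambda>x. cmod (T (f(j := g)) x))
          \<le> ennreal (exp (target.mid_exp \<theta> * ((1 - \<theta>) * (k + a) + \<theta> * (k + b))))"
        using T_measurable[OF fg] \<theta> by (intro target.mid_int_endpoints 0 1) auto
      also have "(1 - \<theta>) * (k + a) + \<theta> * (k + b) = k + (1 - \<theta>) * a + \<theta> * b"
        by (simp add: algebra_simps)
      also have "ennreal (exp (target.mid_exp \<theta> * \<dots>)) \<le> ennreal (exp (target.mid_exp \<theta> * ln e))"
        using target.mid_exp_pos[of \<theta>] \<theta> ab by (intro ennreal_leI) (auto intro: mult_left_mono)
      also have "exp (target.mid_exp \<theta> * ln e) = e powr target.mid_exp \<theta>" using e by (simp add: powr_def)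
      finally show ?thesis .
    qed
    have gK: "wLp_norm (p j) (\<mu> j) (w j) g \<le> ennreal (exp k)" "wLp_norm (q j) (\<mu> j) (v j) g \<le> ennreal (exp k)"
      unfolding k(2)[symmetric]
      using wLp_norm_mono[OF g_meas admissible_tuplesD(3)[OF f j] weights_measurable(1)[OF j0] p[OF j0] le]
        wLp_norm_mono[OF g_meas admissible_tuplesD(3)[OF f j] weights_measurable(2)[OF j0] q[OF j0] le] K(4,5)
      by (blast intro: order_trans)+
    have tX: "t * X \<le> \<theta> * X" "t * X \<le> (1 - \<theta>) * X" "\<theta> * k \<le> 1 * k" "(1 - \<theta>) * k \<le> 1 * k"
      using t X(1) k(1) \<theta> by (intro mult_right_mono; simp)+
    from small show "target.mid_int \<theta> (\<lambda>x. cmod (T (f(j := g)) x)) \<le> ennreal (e powr target.mid_exp \<theta>)"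
    proof
      assume "wLp_norm (p j) (\<mu> j) (w j) g \<le> ennreal (exp (- X))"
      then show ?thesis
      proof (rule *[OF _ gK(2)])
        show "k + (1 - \<theta>) * - X + \<theta> * k \<le> ln e" using tX X(2) unfolding mult_minus_right by linarith
      qed
    next
      assume "wLp_norm (q j) (\<mu> j) (v j) g \<le> ennreal (exp (- X))"
      then show ?thesis
      proof (rule *[OF gK(1)])
        show "k + (1 - \<theta>) * k + \<theta> * - X \<le> ln e" using tX X(2) unfolding mult_minus_right by linarith
      qed
    qed
  qed simp
qed

text \<open>
  The image of the truncated tuple satisfies the bound, truncation does not increase the right-hand side,
  and the image of the remainder is arbitrarily small. The inequality \<open>add_powr_le\<close> keeps the constant:
  its parameter \<open>t\<close> tends to zero while the size \<open>e\<close> of the remainder satisfies \<open>(1 + 1 / t) * e = t\<close>.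
\<close>

lemma interpolated_bound_by_truncation:
  assumes f: "f \<in> admissible_tuples" and j: "j \<in> {1..m}"
    and trunc: "\<And>\<delta>. 0 < \<delta> \<Longrightarrow> \<exists>A\<in>sets (\<mu> j). interpolated_bound (f(j := (\<lambda>x. f j x * indicator A x))) \<and>
      (wLp_norm (p j) (\<mu> j) (w j) (\<lambda>x. f j x * indicator (space (\<mu> j) - A) x) \<le> ennreal \<delta> \<or>
       wLp_norm (q j) (\<mu> j) (v j) (\<lambda>x. f j x * indicator (space (\<mu> j) - A) x) \<le> ennreal \<delta>)"
  shows "interpolated_bound f"
proof -
  have j0: "j \<in> {0..m}" using j by auto
  define B where "B = ennreal (M1 powr (1 - \<theta>) * M2 powr \<theta>) * (\<Prod>i=1..m. wLp_norm (r i) (\<mu> i) (u i) (f i))"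
  define \<rho> where "\<rho> = target.mid_exp \<theta>"
  have \<rho>: "0 < \<rho>" using \<theta> by (simp add: \<rho>_def target.mid_exp_pos)
  show ?thesis
  proof (cases "B = top")
    case True
    then show ?thesis unfolding interpolated_bound_def B_def[symmetric] by simp
  next
    case False
    then obtain K where K: "0 \<le> K" "B = ennreal K" by (cases B) auto
    have key: "target.mid_int \<theta> (\<lambda>x. cmod (T f x)) \<le> ennreal ((1 + t) powr \<rho> * K powr \<rho> + t powr \<rho>)" if t: "0 < t" for t
    proof -
      define e where "e = t / (1 + 1 / t)"
      have e: "0 < e" "(1 + 1 / t) * e = t" using t by (auto simp: e_def add_pos_pos add_nonneg_eq_0_iff)
      obtain \<delta> where \<delta>: "0 < \<delta>"
        "\<And>g. g \<in> admissible j \<Longrightarrow> (\<And>x. cmod (g x) \<le> cmod (f j x)) \<Longrightarrow>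
           wLp_norm (p j) (\<mu> j) (w j) g \<le> ennreal \<delta> \<or> wLp_norm (q j) (\<mu> j) (v j) g \<le> ennreal \<delta> \<Longrightarrow>
           target.mid_int \<theta> (\<lambda>x. cmod (T (f(j := g)) x)) \<le> ennreal (e powr target.mid_exp \<theta>)"
        using T_tail_small[OF f j e(1)] by blast
      obtain A where A: "A \<in> sets (\<mu> j)" and bnd: "interpolated_bound (f(j := (\<lambda>x. f j x * indicator A x)))"
        and small: "wLp_norm (p j) (\<mu> j) (w j) (\<lambda>x. f j x * indicator (space (\<mu> j) - A) x) \<le> ennreal \<delta> \<or>
          wLp_norm (q j) (\<mu> j) (v j) (\<lambda>x. f j x * indicator (space (\<mu> j) - A) x) \<le> ennreal \<delta>"
        using trunc[OF \<delta>(1)] by blast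
      define g1 where "g1 = (\<lambda>x. f j x * indicator A x)"
      define g2 where "g2 = (\<lambda>x. f j x * indicator (space (\<mu> j) - A) x)"
      have g: "g1 \<in> admissible j" "g2 \<in> admissible j"
        unfolding g1_def g2_def
        by (intro admissible_indicator[OF admissible_tuplesD(1)[OF f j] j] sets.compl_sets A)+
      have g_le: "cmod (g1 x) \<le> cmod (f j x)" "cmod (g2 x) \<le> cmod (f j x)" for x
        by (auto simp: g1_def g2_def norm_mult indicator_def)
      note [measurable] = T_measurable[OF f] T_measurable[OF admissible_tuples_upd[OF f j g(1)]]
        T_measurable[OF admissible_tuples_upd[OF f j g(2)]]
      have "wLp_norm (r 0) (\<mu> 0) (u 0) (T (f(j := g1)))
        \<le> ennreal (M1 powr (1 - \<theta>) * M2 powr \<theta>) * (\<Prod>i=1..m. wLp_norm (r i) (\<mu> i) (u i) ((f(j := g1)) i))"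
        using bnd unfolding interpolated_bound_def g1_def .
      also have "\<dots> \<le> B"
        unfolding B_def
      proof (intro mult_left_mono prod_mono_ennreal)
        fix i assume "i \<in> {1..m}"
        have "wLp_norm (r j) (\<mu> j) (u j) g1 \<le> wLp_norm (r j) (\<mu> j) (u j) (f j)"
          using g(1) by (intro wLp_norm_mono admissible_tuplesD[OF f j] weights_measurable j0 r_props g_le)
            (auto simp: admissible_def intro: simple_functions_measurable)
        then show "wLp_norm (r i) (\<mu> i) (u i) ((f(j := g1)) i) \<le> wLp_norm (r i) (\<mu> i) (u i) (f i)"
          by (cases "i = j") auto
      qed simp
      finally have 1: "target.mid_int \<theta> (\<lambda>x. cmod (T (f(j := g1)) x)) \<le> ennreal (K powr \<rho>)"
        unfolding K(2) target_norm_le_iff(3)[OF K(1)] \<rho>_def .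
      have 2: "target.mid_int \<theta> (\<lambda>x. cmod (T (f(j := g2)) x)) \<le> ennreal (e powr \<rho>)"
        unfolding \<rho>_def by (rule \<delta>(2)[OF g(2) g_le(2)]) (use small in \<open>simp add: g2_def\<close>)
      have "target.mid_int \<theta> (\<lambda>x. cmod (T f x)) = target.mid_int \<theta> (\<lambda>x. cmod (T (f(j := g1)) x + T (f(j := g2)) x))"
        using T_split_indicator[OF f j A] unfolding g1_def g2_def
        by (intro target.mid_int_cong_AE) (auto elim: eventually_mono)
      also have "\<dots> \<le> target.mid_int \<theta> (\<lambda>x. cmod (T (f(j := g1)) x) + cmod (T (f(j := g2)) x))"
        using \<theta> by (intro target.mid_int_mono norm_triangle_ineq) auto
      also have "\<dots> \<le> ennreal ((1 + t) powr \<rho>) * target.mid_int \<theta> (\<lambda>x. cmod (T (f(j := g1)) x))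
           + ennreal ((1 + 1 / t) powr \<rho>) * target.mid_int \<theta> (\<lambda>x. cmod (T (f(j := g2)) x))"
        unfolding \<rho>_def using t \<theta> by (intro target.mid_int_add) auto
      also have "\<dots> \<le> ennreal ((1 + t) powr \<rho>) * ennreal (K powr \<rho>) + ennreal ((1 + 1 / t) powr \<rho>) * ennreal (e powr \<rho>)"
        by (intro add_mono mult_left_mono 1 2) auto
      also have "\<dots> = ennreal ((1 + t) powr \<rho> * K powr \<rho> + (1 + 1 / t) powr \<rho> * e powr \<rho>)"
        by (simp add: ennreal_mult ennreal_plus)
      also have "(1 + 1 / t) powr \<rho> * e powr \<rho> = t powr \<rho>"
        using t e by (simp flip: powr_mult)
      finally show ?thesis .
    qed
    have "target.mid_int \<theta> (\<lambda>x. cmod (T f x)) \<le> ennreal ((1 + 0) powr \<rho> * K powr \<rho> + 0 powr \<rho>)"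
    proof (rule tendsto_lowerbound)
      show "((\<lambda>t. ennreal ((1 + t) powr \<rho> * K powr \<rho> + t powr \<rho>)) \<longlongrightarrow> ennreal ((1 + 0) powr \<rho> * K powr \<rho> + 0 powr \<rho>)) (at_right 0)"
        using \<rho> by (intro tendsto_intros tendsto_powr') (auto simp: eventually_at_right_less intro!: eventually_at_rightI[of 0 1])
      show "\<forall>\<^sub>F t in at_right 0. target.mid_int \<theta> (\<lambda>x. cmod (T f x)) \<le> ennreal ((1 + t) powr \<rho> * K powr \<rho> + t powr \<rho>)"
        using key by (intro eventually_at_rightI[of 0 1]) auto
    qed simp
    then have "wLp_norm (r 0) (\<mu> 0) (u 0) (T f) \<le> ennreal K"
      using K(1) by (subst target_norm_le_iff) (simp_all add: \<rho>_def)
    then show ?thesis unfolding interpolated_bound_def B_def[symmetric] K(2) .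
  qed
qed

text \<open>
  Induction on the set \<open>J\<close> of entries that are not yet truncated. Each of them is truncated twice, with
  respect to \<open>w\<close> and then to \<open>v\<close>; the second truncation keeps the first property.
\<close>

lemma interpolated_bound_outside:
  assumes "finite J" "f \<in> admissible_tuples" "\<And>j. j \<in> {1..m} - J \<Longrightarrow> log_bounded_pair j (f j)"
  shows "interpolated_bound f"
  using assms
proof (induction J arbitrary: f)
  case empty
  show ?case
  proof (cases "\<exists>j\<in>{1..m}. wLp_norm (r j) (\<mu> j) (u j) (f j) = 0")
    case True
    then show ?thesis using interpolated_bound_of_zero[OF empty(1)] empty(2) by blast
  next
    case False
    then show ?thesis
      unfolding interpolated_bound_def by (intro bound_of_log_bounded empty(1)) (use empty(2) in auto)
  qed
next
  case (insert i J)
  note f = insert.prems(1)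
  show ?case
  proof (cases "i \<in> {1..m}")
    case False
    then show ?thesis by (intro insert.IH f insert.prems(2)) auto
  next
    case True
    note i = True
    have i0: "i \<in> {0..m}" using i by auto
    show ?thesis
    proof (rule interpolated_bound_by_truncation[OF f i])
      fix \<delta> :: real assume \<delta>: "0 < \<delta>"
      obtain A where A: "A \<in> sets (\<mu> i)" "log_bounded (\<mu> i) (w i) (\<lambda>x. f i x * indicator A x)"
        "wLp_norm (p i) (\<mu> i) (w i) (\<lambda>x. f i x * indicator (space (\<mu> i) - A) x) \<le> ennreal \<delta>"
        using log_truncation[OF admissible_tuplesD(3)[OF f i] w[OF i0] p[OF i0] admissible_tuplesD(4)[OF f i] \<delta>]
        by blast
      define g where "g = f(i := (\<lambda>x. f i x * indicator A x))"
      have g: "g \<in> admissible_tuples"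
        unfolding g_def by (intro admissible_tuples_upd admissible_indicator admissible_tuplesD(1) f i A)
      have "interpolated_bound g"
      proof (rule interpolated_bound_by_truncation[OF g i])
        fix \<delta>' :: real assume \<delta>': "0 < \<delta>'"
        obtain A' where A': "A' \<in> sets (\<mu> i)" "log_bounded (\<mu> i) (v i) (\<lambda>x. g i x * indicator A' x)"
          "wLp_norm (q i) (\<mu> i) (v i) (\<lambda>x. g i x * indicator (space (\<mu> i) - A') x) \<le> ennreal \<delta>'"
          using log_truncation[OF admissible_tuplesD(3)[OF g i] v[OF i0] q[OF i0] admissible_tuplesD(5)[OF g i] \<delta>']
          by blast
        have "interpolated_bound (g(i := (\<lambda>x. g i x * indicator A' x)))"
        proof (rule insert.IH)
          show "g(i := (\<lambda>x. g i x * indicator A' x)) \<in> admissible_tuples"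
            by (intro admissible_tuples_upd admissible_indicator admissible_tuplesD(1) g i A')
          fix j assume j: "j \<in> {1..m} - J"
          show "log_bounded_pair j ((g(i := (\<lambda>x. g i x * indicator A' x))) j)"
          proof (cases "j = i")
            case True
            have "log_bounded (\<mu> i) (w i) (g i)" using A(2) by (simp add: g_def)
            then show ?thesis
              using A'(2) log_bounded_indicator unfolding True log_bounded_pair_def fun_upd_same by blast
          next
            case False
            then show ?thesis using insert.prems(2)[of j] j by (simp add: g_def)
          qed
        qed
        then show "\<exists>A\<in>sets (\<mu> i). interpolated_bound (g(i := (\<lambda>x. g i x * indicator A x))) \<and>
          (wLp_norm (p i) (\<mu> i) (w i) (\<lambda>x. g i x * indicator (space (\<mu> i) - A) x) \<le> ennreal \<delta>' \<or>
           wLp_norm (q i) (\<mu> i) (v i) (\<lambda>x. g i x * indicator (space (\<mu> i) - A) x) \<le> ennreal \<delta>')"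
          using A' by blast
      qed
      then show "\<exists>A\<in>sets (\<mu> i). interpolated_bound (f(i := (\<lambda>x. f i x * indicator A x))) \<and>
          (wLp_norm (p i) (\<mu> i) (w i) (\<lambda>x. f i x * indicator (space (\<mu> i) - A) x) \<le> ennreal \<delta> \<or>
           wLp_norm (q i) (\<mu> i) (v i) (\<lambda>x. f i x * indicator (space (\<mu> i) - A) x) \<le> ennreal \<delta>)"
        using A unfolding g_def by blast
    qed
  qed
qed

end

theorem theorem3p1:
  fixes m :: nat
    and \<mu> :: "nat \<Rightarrow> 'a measure"
    and T :: "(nat \<Rightarrow> 'a \<Rightarrow> complex) \<Rightarrow> 'a \<Rightarrow> complex"
    and p q r :: "nat \<Rightarrow> ennreal"
    and w v u :: "nat \<Rightarrow> 'a \<Rightarrow> ennreal"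
    and M1 M2 \<theta> :: real
  assumes "1 \<le> m"
    and "multilinear_operator m \<mu> T"
    and "0 < p 0" "p 0 < \<infinity>" "0 < q 0" "q 0 < \<infinity>"
    and "\<And>j. j \<in> {1..m} \<Longrightarrow> 1 \<le> p j"
    and "\<And>j. j \<in> {1..m} \<Longrightarrow> 1 \<le> q j"
    and "\<And>j. j \<in> {0..m} \<Longrightarrow> weight (\<mu> j) (w j)"
    and "\<And>j. j \<in> {0..m} \<Longrightarrow> weight (\<mu> j) (v j)"
    and "0 < M1" "0 < M2"
    and "norm_bound_on (finite_norm_tuples m \<mu> p w) m \<mu> T p w M1"
    and "norm_bound_on (finite_norm_tuples m \<mu> q v) m \<mu> T q v M2"
    and "0 < \<theta>" "\<theta> < 1"
    and "\<And>j. j \<in> {0..m} \<Longrightarrow> 1 / r j = ennreal (1 - \<theta>) / p j + ennreal \<theta> / q j"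
    and "\<And>j x. j \<in> {0..m} \<Longrightarrow> x \<in> space (\<mu> j) \<Longrightarrow>
           u j x = ennpow (w j x) (1 - \<theta>) * ennpow (v j x) \<theta>"
  shows "norm_bound_on (finite_norm_tuples m \<mu> p w \<inter> finite_norm_tuples m \<mu> q v) m \<mu> T r u
           (M1 powr (1 - \<theta>) * M2 powr \<theta>)"
proof -
  have pos: "0 < s j" if "0 < s 0" "\<And>j. j \<in> {1..m} \<Longrightarrow> 1 \<le> s j" "j \<in> {0..m}" for s :: "nat \<Rightarrow> ennreal" and j
  proof (cases "j = 0")
    case False
    then have "1 \<le> s j" using that by auto
    then show ?thesis by (rule less_le_trans[OF zero_less_one])
  qed (use that in simp)
  interpret interpolation_data m \<mu> T p q r w v u M1 M2 \<theta>
    using assms pos[of p] pos[of q] by unfold_locales (simp_all only: infinity_ennreal_def)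
  show ?thesis
    using interpolated_bound_outside[of "{1..m}"]
    unfolding norm_bound_on_def interpolated_bound_def by blast
qed

end
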